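(* Let $\mathcal V$ be a closed, complete and cocomplete Cartesian monoidal category and let $\mathscr C$ be an operad in $\mathcal V$. Then $\mathscr B=\mathscr C\boxtimes\mathscr{C}omm$ is also an operad in $\mathcal V$. When $\mathscr C$ is based, $\mathscr B$ is also based.
   Context: Write $\mathcal I=*$ for the unit (= terminal object) of $\mathcal V$. $\Sigma$ is the category with objects $\mathbf n=\{0,1,\dots,n\}$ (based at $0$), $n\ge0$, and based isomorphisms; a symmetric sequence is a functor $\Sigma^{op}\to\mathcal V$. The Day convolution of symmetric sequences is $(\mathscr D\boxtimes\mathscr E)(\mathbf n)\cong\coprod_{j+k=n}(\mathscr D(\mathbf j)\otimes\mathscr E(\mathbf k))\otimes_{\Sigma_j\times\Sigma_k}\Sigma_n$ (and agrees, on underlying symmetric sequences, with the Day convolution over the category $\Lambda$ of the sets $\mathbf n$ and based injections). An operad is a symmetric operad in the sense of May with underlying symmetric sequence $\mathscr C$; it is based if equipped with a map $\eta:\mathcal I\to\mathscr C(0)$. $\mathscr{C}omm$ is the commutativity operad, $\mathscr{C}omm(n)=\mathcal I$ for all $n\ge0$. Explicitly, $\mathscr B(n)=\coprod_{S\subset\{1,\dots,n\}}\mathscr C(|S|)$. *)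

theory Defs
  imports
    "HOL-Combinatorics.Permutations"
    "HOL-Library.Equipollence"
    "HOL-Library.Infinite_Typeclass"
begin

section \<open>Categories, functors, limits and colimits\<close>

text \<open>The record fields are only meaningful on the carriers \<open>Ob\<close> and \<open>Mor\<close>; composition
  \<open>g \<cdot> f\<close> is in applicative order (first \<open>f\<close>, then \<open>g\<close>).\<close>

record ('o, 'm) cat =
  Ob :: "'o set"
  Mor :: "'m set"
  Dom :: "'m \<Rightarrow> 'o"
  Cod :: "'m \<Rightarrow> 'o"
  Ident :: "'o \<Rightarrow> 'm"
  Comp :: "'m \<Rightarrow> 'm \<Rightarrow> 'm"  (infixr "\<cdot>\<index>" 75)

definition hom :: "('o, 'm, 'z) cat_scheme \<Rightarrow> 'o \<Rightarrow> 'o \<Rightarrow> 'm set" where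
  "hom V X Y = {f \<in> Mor V. Dom V f = X \<and> Cod V f = Y}"

locale category =
  fixes V :: "('o, 'm, 'z) cat_scheme" (structure)
  assumes Dom_Ob: "f \<in> Mor V \<Longrightarrow> Dom V f \<in> Ob V"
    and Cod_Ob: "f \<in> Mor V \<Longrightarrow> Cod V f \<in> Ob V"
    and Ident_hom: "X \<in> Ob V \<Longrightarrow> Ident V X \<in> hom V X X"
    and Comp_hom: "f \<in> hom V X Y \<Longrightarrow> g \<in> hom V Y Z \<Longrightarrow> g \<cdot> f \<in> hom V X Z"
    and Comp_Ident_right: "f \<in> hom V X Y \<Longrightarrow> f \<cdot> Ident V X = f"
    and Comp_Ident_left: "f \<in> hom V X Y \<Longrightarrow> Ident V Y \<cdot> f = f"
    and Comp_assoc: "f \<in> hom V W X \<Longrightarrow> g \<in> hom V X Y \<Longrightarrow> h \<in> hom V Y Z \<Longrightarrow>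
      (h \<cdot> g) \<cdot> f = h \<cdot> (g \<cdot> f)"

definition opposite :: "('o, 'm, 'z) cat_scheme \<Rightarrow> ('o, 'm) cat" where
  "opposite V = \<lparr>Ob = Ob V, Mor = Mor V, Dom = Cod V, Cod = Dom V, Ident = Ident V,
     Comp = (\<lambda>g f. f \<cdot>\<^bsub>V\<^esub> g)\<rparr>"

record ('o, 'm, 'p, 'n) cfunctor =
  fob :: "'o \<Rightarrow> 'p"
  fmor :: "'m \<Rightarrow> 'n"

definition is_functor ::
  "('o, 'm, 'y) cat_scheme \<Rightarrow> ('p, 'n, 'z) cat_scheme \<Rightarrow> ('o, 'm, 'p, 'n) cfunctor \<Rightarrow> bool" where
  "is_functor J V F \<longleftrightarrow>
     (\<forall>X\<in>Ob J. fob F X \<in> Ob V) \<and>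
     (\<forall>f\<in>Mor J. fmor F f \<in> hom V (fob F (Dom J f)) (fob F (Cod J f))) \<and>
     (\<forall>X\<in>Ob J. fmor F (Ident J X) = Ident V (fob F X)) \<and>
     (\<forall>f\<in>Mor J. \<forall>g\<in>Mor J. Cod J f = Dom J g \<longrightarrow>
        fmor F (g \<cdot>\<^bsub>J\<^esub> f) = fmor F g \<cdot>\<^bsub>V\<^esub> fmor F f)"

definition is_cone ::
  "('i, 'j, 'y) cat_scheme \<Rightarrow> ('o, 'm, 'z) cat_scheme \<Rightarrow> ('i, 'j, 'o, 'm) cfunctor \<Rightarrow>
     'o \<Rightarrow> ('i \<Rightarrow> 'm) \<Rightarrow> bool" where
  "is_cone J V F L p \<longleftrightarrow> L \<in> Ob V \<and> (\<forall>i\<in>Ob J. p i \<in> hom V L (fob F i)) \<and>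
     (\<forall>f\<in>Mor J. fmor F f \<cdot>\<^bsub>V\<^esub> p (Dom J f) = p (Cod J f))"

definition is_limit ::
  "('i, 'j, 'y) cat_scheme \<Rightarrow> ('o, 'm, 'z) cat_scheme \<Rightarrow> ('i, 'j, 'o, 'm) cfunctor \<Rightarrow>
     'o \<Rightarrow> ('i \<Rightarrow> 'm) \<Rightarrow> bool" where
  "is_limit J V F L p \<longleftrightarrow> is_cone J V F L p \<and>
     (\<forall>Z q. is_cone J V F Z q \<longrightarrow> (\<exists>!u. u \<in> hom V Z L \<and> (\<forall>i\<in>Ob J. p i \<cdot>\<^bsub>V\<^esub> u = q i)))"

definition is_cocone ::
  "('i, 'j, 'y) cat_scheme \<Rightarrow> ('o, 'm, 'z) cat_scheme \<Rightarrow> ('i, 'j, 'o, 'm) cfunctor \<Rightarrow>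
     'o \<Rightarrow> ('i \<Rightarrow> 'm) \<Rightarrow> bool" where
  "is_cocone J V F L p \<longleftrightarrow> L \<in> Ob V \<and> (\<forall>i\<in>Ob J. p i \<in> hom V (fob F i) L) \<and>
     (\<forall>f\<in>Mor J. p (Cod J f) \<cdot>\<^bsub>V\<^esub> fmor F f = p (Dom J f))"

definition is_colimit ::
  "('i, 'j, 'y) cat_scheme \<Rightarrow> ('o, 'm, 'z) cat_scheme \<Rightarrow> ('i, 'j, 'o, 'm) cfunctor \<Rightarrow>
     'o \<Rightarrow> ('i \<Rightarrow> 'm) \<Rightarrow> bool" where
  "is_colimit J V F L p \<longleftrightarrow> is_cocone J V F L p \<and>
     (\<forall>Z q. is_cocone J V F Z q \<longrightarrow> (\<exists>!u. u \<in> hom V L Z \<and> (\<forall>i\<in>Ob J. u \<cdot>\<^bsub>V\<^esub> p i = q i)))"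

text \<open>The infinite type \<open>'u\<close> plays the role of the universe: a set is small if its cardinality is
  smaller than that of \<open>'u\<close>.  When \<open>'u\<close> has the cardinality of a Grothendieck universe this is
  the usual smallness up to bijection; when \<open>'u\<close> is countable, small means finite.  Every small
  category is isomorphic to one whose objects and morphisms are elements of \<open>'u\<close>.\<close>

definition small_category :: "('u::infinite, 'u) cat \<Rightarrow> bool" where
  "small_category J \<longleftrightarrow> category J \<and> Ob J \<prec> (UNIV :: 'u set) \<and> Mor J \<prec> (UNIV :: 'u set)"

definition complete_category ::
  "'u::infinite itself \<Rightarrow> ('o, 'm, 'z) cat_scheme \<Rightarrow> bool" where
  "complete_category U V \<longleftrightarrow>
     (\<forall>(J :: ('u, 'u) cat) F. small_category J \<and> is_functor J V F \<longrightarrow> (\<exists>L p. is_limit J V F L p))"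

definition cocomplete_category ::
  "'u::infinite itself \<Rightarrow> ('o, 'm, 'z) cat_scheme \<Rightarrow> bool" where
  "cocomplete_category U V \<longleftrightarrow>
     (\<forall>(J :: ('u, 'u) cat) F. small_category J \<and> is_functor J V F \<longrightarrow> (\<exists>L p. is_colimit J V F L p))"

definition is_coproduct ::
  "('o, 'm, 'z) cat_scheme \<Rightarrow> 'i set \<Rightarrow> ('i \<Rightarrow> 'o) \<Rightarrow> 'o \<Rightarrow> ('i \<Rightarrow> 'm) \<Rightarrow> bool" where
  "is_coproduct V I X Q incl \<longleftrightarrow> Q \<in> Ob V \<and> (\<forall>i\<in>I. incl i \<in> hom V (X i) Q) \<and>
     (\<forall>Z\<in>Ob V. \<forall>z. (\<forall>i\<in>I. z i \<in> hom V (X i) Z) \<longrightarrow>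
        (\<exists>!u. u \<in> hom V Q Z \<and> (\<forall>i\<in>I. u \<cdot>\<^bsub>V\<^esub> incl i = z i)))"

text \<open>Let a group \<open>G\<close> act on the object \<open>X\<close> from the right (\<open>act g : X \<rightarrow> X\<close>) and on the set \<open>H\<close>
  from the left.  \<open>is_balanced_tensor\<close> says that \<open>Q\<close>, with the maps \<open>q h : X \<rightarrow> Q\<close>,
  \<open>x \<mapsto> x \<otimes> h\<close>, is the object \<open>X \<otimes>\<^sub>G H\<close>: the universal object under the \<open>H\<close>-fold copower of \<open>X\<close>
  satisfying \<open>x g \<otimes> h = x \<otimes> g h\<close>.\<close>

definition is_balanced_tensor ::
  "('o, 'm, 'z) cat_scheme \<Rightarrow> 'o \<Rightarrow> 'g set \<Rightarrow> ('g \<Rightarrow> 'm) \<Rightarrow> 'h set \<Rightarrow> ('g \<Rightarrow> 'h \<Rightarrow> 'h) \<Rightarrow>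
     'o \<Rightarrow> ('h \<Rightarrow> 'm) \<Rightarrow> bool" where
  "is_balanced_tensor V X G act H lact Q q \<longleftrightarrow>
     Q \<in> Ob V \<and> (\<forall>h\<in>H. q h \<in> hom V X Q) \<and>
     (\<forall>g\<in>G. \<forall>h\<in>H. q h \<cdot>\<^bsub>V\<^esub> act g = q (lact g h)) \<and>
     (\<forall>Z\<in>Ob V. \<forall>z. (\<forall>h\<in>H. z h \<in> hom V X Z) \<and>
        (\<forall>g\<in>G. \<forall>h\<in>H. z h \<cdot>\<^bsub>V\<^esub> act g = z (lact g h)) \<longrightarrow>
        (\<exists>!u. u \<in> hom V Q Z \<and> (\<forall>h\<in>H. u \<cdot>\<^bsub>V\<^esub> q h = z h)))"


section \<open>Cartesian closed monoidal categories\<close>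

record ('o, 'm) ccat = "('o, 'm) cat" +
  UnitOb :: "'o"  ("\<I>\<index>")
  Tens :: "'o \<Rightarrow> 'o \<Rightarrow> 'o"  (infixr "\<otimes>\<index>" 70)
  Pr1 :: "'o \<Rightarrow> 'o \<Rightarrow> 'm"
  Pr2 :: "'o \<Rightarrow> 'o \<Rightarrow> 'm"

locale cartesian_monoidal_category = category V for V :: "('o, 'm, 'z) ccat_scheme" (structure) +
  assumes UnitOb_Ob: "\<I> \<in> Ob V"
    and UnitOb_terminal: "X \<in> Ob V \<Longrightarrow> \<exists>!f. f \<in> hom V X \<I>"
    and Tens_Ob: "X \<in> Ob V \<Longrightarrow> Y \<in> Ob V \<Longrightarrow> X \<otimes> Y \<in> Ob V"
    and Pr1_hom: "X \<in> Ob V \<Longrightarrow> Y \<in> Ob V \<Longrightarrow> Pr1 V X Y \<in> hom V (X \<otimes> Y) X"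
    and Pr2_hom: "X \<in> Ob V \<Longrightarrow> Y \<in> Ob V \<Longrightarrow> Pr2 V X Y \<in> hom V (X \<otimes> Y) Y"
    and Tens_universal: "f \<in> hom V Z X \<Longrightarrow> g \<in> hom V Z Y \<Longrightarrow>
      \<exists>!h. h \<in> hom V Z (X \<otimes> Y) \<and> Pr1 V X Y \<cdot> h = f \<and> Pr2 V X Y \<cdot> h = g"

definition to_unit :: "('o, 'm, 'z) ccat_scheme \<Rightarrow> 'o \<Rightarrow> 'm" where
  "to_unit V X = (THE f. f \<in> hom V X \<I>\<^bsub>V\<^esub>)"

definition pairing :: "('o, 'm, 'z) ccat_scheme \<Rightarrow> 'm \<Rightarrow> 'm \<Rightarrow> 'm" where
  "pairing V f g = (THE h. h \<in> hom V (Dom V f) (Cod V f \<otimes>\<^bsub>V\<^esub> Cod V g) \<and>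
     Pr1 V (Cod V f) (Cod V g) \<cdot>\<^bsub>V\<^esub> h = f \<and> Pr2 V (Cod V f) (Cod V g) \<cdot>\<^bsub>V\<^esub> h = g)"

definition tens_mor :: "('o, 'm, 'z) ccat_scheme \<Rightarrow> 'm \<Rightarrow> 'm \<Rightarrow> 'm" where
  "tens_mor V f g = pairing V (f \<cdot>\<^bsub>V\<^esub> Pr1 V (Dom V f) (Dom V g)) (g \<cdot>\<^bsub>V\<^esub> Pr2 V (Dom V f) (Dom V g))"

definition closed_category :: "('o, 'm, 'z) ccat_scheme \<Rightarrow> bool" where
  "closed_category V \<longleftrightarrow>
     (\<forall>Y\<in>Ob V. \<forall>Z\<in>Ob V. \<exists>E\<in>Ob V. \<exists>ev \<in> hom V (E \<otimes>\<^bsub>V\<^esub> Y) Z.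
        \<forall>X\<in>Ob V. \<forall>f \<in> hom V (X \<otimes>\<^bsub>V\<^esub> Y) Z.
          \<exists>!h. h \<in> hom V X E \<and> ev \<cdot>\<^bsub>V\<^esub> tens_mor V h (Ident V Y) = f)"

text \<open>Iterated products \<open>X\<^sub>0 \<otimes> (X\<^sub>1 \<otimes> \<dots> \<otimes> (X\<^sub>k\<^sub>-\<^sub>1 \<otimes> \<I>))\<close>, with their projections (indexed from \<open>0\<close>),
  products of morphisms, and tuples of morphisms with common domain \<open>Z\<close>.\<close>

fun tens_list :: "('o, 'm, 'z) ccat_scheme \<Rightarrow> 'o list \<Rightarrow> 'o" where
  "tens_list V [] = \<I>\<^bsub>V\<^esub>"
| "tens_list V (X # Xs) = X \<otimes>\<^bsub>V\<^esub> tens_list V Xs"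

fun tens_mor_list :: "('o, 'm, 'z) ccat_scheme \<Rightarrow> 'm list \<Rightarrow> 'm" where
  "tens_mor_list V [] = Ident V \<I>\<^bsub>V\<^esub>"
| "tens_mor_list V (f # fs) = tens_mor V f (tens_mor_list V fs)"

fun proj_list :: "('o, 'm, 'z) ccat_scheme \<Rightarrow> 'o list \<Rightarrow> nat \<Rightarrow> 'm" where
  "proj_list V [] i = Ident V \<I>\<^bsub>V\<^esub>"
| "proj_list V (X # Xs) 0 = Pr1 V X (tens_list V Xs)"
| "proj_list V (X # Xs) (Suc i) = proj_list V Xs i \<cdot>\<^bsub>V\<^esub> Pr2 V X (tens_list V Xs)"

fun tuple_list :: "('o, 'm, 'z) ccat_scheme \<Rightarrow> 'o \<Rightarrow> 'm list \<Rightarrow> 'm" where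
  "tuple_list V Z [] = to_unit V Z"
| "tuple_list V Z (f # fs) = pairing V f (tuple_list V Z fs)"


section \<open>Symmetric sequences\<close>

text \<open>A based isomorphism of \<open>{0, 1, \<dots>, n}\<close> is a permutation of \<open>{1..n}\<close>, here extended by the
  identity to all of \<open>nat\<close>; it is paired with \<open>n\<close> so that source and target can be recovered.\<close>

definition Sym :: "nat \<Rightarrow> (nat \<Rightarrow> nat) set" where
  "Sym n = {\<sigma>. \<sigma> permutes {1..n}}"

definition Sigma_cat :: "(nat, nat \<times> (nat \<Rightarrow> nat)) cat" where
  "Sigma_cat = \<lparr>Ob = UNIV, Mor = {(n, \<sigma>). \<sigma> \<in> Sym n}, Dom = fst, Cod = fst,
     Ident = (\<lambda>n. (n, id)), Comp = (\<lambda>g f. (fst f, snd g \<circ> snd f))\<rparr>"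

type_synonym ('o, 'm) sseq = "(nat, nat \<times> (nat \<Rightarrow> nat), 'o, 'm) cfunctor"

definition symmetric_sequence :: "('o, 'm, 'z) cat_scheme \<Rightarrow> ('o, 'm) sseq \<Rightarrow> bool" where
  "symmetric_sequence V F \<longleftrightarrow> is_functor (opposite Sigma_cat) V F"

text \<open>The right action of \<open>\<sigma> \<in> Sym n\<close> on \<open>F(n)\<close>; contravariance reads
  \<open>sact F n (\<sigma> \<circ> \<tau>) = sact F n \<tau> \<cdot> sact F n \<sigma>\<close>.\<close>

abbreviation sact :: "('o, 'm) sseq \<Rightarrow> nat \<Rightarrow> (nat \<Rightarrow> nat) \<Rightarrow> 'm" where
  "sact F n \<sigma> \<equiv> fmor F (n, \<sigma>)"


section \<open>Block sums and block permutations\<close>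

text \<open>A list \<open>js = [j\<^sub>1, \<dots>, j\<^sub>k]\<close> cuts \<open>{1..j\<^sub>1 + \<dots> + j\<^sub>k}\<close> into \<open>k\<close> consecutive blocks; the \<open>i\<close>-th block
  (\<open>1 \<le> i \<le> k\<close>) consists of the letters \<open>block_start js i + q\<close> with \<open>1 \<le> q \<le> j\<^sub>i\<close>.\<close>

definition block_start :: "nat list \<Rightarrow> nat \<Rightarrow> nat" where
  "block_start js i = sum_list (take (i - 1) js)"

definition block_of :: "nat list \<Rightarrow> nat \<Rightarrow> nat" where
  "block_of js x = (LEAST i. x \<le> sum_list (take i js))"

text \<open>\<open>\<tau>\<^sub>1 \<oplus> \<dots> \<oplus> \<tau>\<^sub>k\<close>\<close>

definition block_sum :: "nat list \<Rightarrow> (nat \<Rightarrow> nat) list \<Rightarrow> nat \<Rightarrow> nat" where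
  "block_sum js \<tau>s x =
     (if x \<in> {1..sum_list js}
      then let i = block_of js x
           in block_start js i + (\<tau>s ! (i - 1)) (x - block_start js i)
      else x)"

text \<open>The list whose entry in position \<open>p\<close> is the entry of \<open>xs\<close> in position \<open>\<sigma>\<^sup>-\<^sup>1(p)\<close>, positions
  being counted from \<open>1\<close>.\<close>

definition move_list :: "(nat \<Rightarrow> nat) \<Rightarrow> 'a list \<Rightarrow> 'a list" where
  "move_list \<sigma> xs = map (\<lambda>p. xs ! (inv \<sigma> p - 1)) [1..<Suc (length xs)]"

text \<open>\<open>\<sigma>(j\<^sub>1, \<dots>, j\<^sub>k)\<close>, which moves the \<open>i\<close>-th block of \<open>js\<close> in an order preserving way to the
  \<open>\<sigma>(i)\<close>-th block of \<open>move_list \<sigma> js\<close>.\<close>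

definition block_perm :: "(nat \<Rightarrow> nat) \<Rightarrow> nat list \<Rightarrow> nat \<Rightarrow> nat" where
  "block_perm \<sigma> js x =
     (if x \<in> {1..sum_list js}
      then let i = block_of js x
           in block_start (move_list \<sigma> js) (\<sigma> i) + (x - block_start js i)
      else x)"


section \<open>Day convolution\<close>

text \<open>\<open>F(n) \<cong> \<Coprod>\<^bsub>j+k=n\<^esub> (D(j) \<otimes> E(k)) \<otimes>\<^bsub>Sym j \<times> Sym k\<^esub> Sym n\<close> for every \<open>n\<close>, with \<open>Sym n\<close> acting on the right
  through its right multiplication on itself.  Here \<open>T (j, k)\<close> is the \<open>(j, k)\<close>-th summand, with
  structure maps \<open>t (j, k) \<tau>\<close>, and \<open>incl (j, k)\<close> is its inclusion.\<close>

definition is_day_convolution ::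
  "('o, 'm, 'z) ccat_scheme \<Rightarrow> ('o, 'm) sseq \<Rightarrow> ('o, 'm) sseq \<Rightarrow> ('o, 'm) sseq \<Rightarrow> bool" where
  "is_day_convolution V D E F \<longleftrightarrow> symmetric_sequence V F \<and>
     (\<forall>n. \<exists>T t incl.
        (\<forall>j k. j + k = n \<longrightarrow>
           is_balanced_tensor V (fob D j \<otimes>\<^bsub>V\<^esub> fob E k)
             (Sym j \<times> Sym k) (\<lambda>(\<sigma>, \<rho>). tens_mor V (sact D j \<sigma>) (sact E k \<rho>))
             (Sym n) (\<lambda>(\<sigma>, \<rho>) \<tau>. block_sum [j, k] [\<sigma>, \<rho>] \<circ> \<tau>)
             (T (j, k)) (t (j, k))) \<and>
        is_coproduct V {(j, k). j + k = n} T (fob F n) incl \<and>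
        (\<forall>j k. j + k = n \<longrightarrow> (\<forall>\<tau>\<in>Sym n. \<forall>\<sigma>\<in>Sym n.
           sact F n \<sigma> \<cdot>\<^bsub>V\<^esub> (incl (j, k) \<cdot>\<^bsub>V\<^esub> t (j, k) \<tau>) = incl (j, k) \<cdot>\<^bsub>V\<^esub> t (j, k) (\<tau> \<circ> \<sigma>))))"


section \<open>Operads\<close>

text \<open>\<open>gamma P [j\<^sub>1, \<dots>, j\<^sub>k] : P(k) \<otimes> (P(j\<^sub>1) \<otimes> \<dots> \<otimes> P(j\<^sub>k)) \<rightarrow> P(j\<^sub>1 + \<dots> + j\<^sub>k)\<close>.\<close>

record ('o, 'm) operad =
  sseq :: "('o, 'm) sseq"
  opunit :: "'m"
  gamma :: "nat list \<Rightarrow> 'm"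

abbreviation arity :: "('o, 'm) operad \<Rightarrow> nat \<Rightarrow> 'o" where
  "arity P n \<equiv> fob (sseq P) n"

abbreviation tens_arities :: "('o, 'm, 'z) ccat_scheme \<Rightarrow> ('o, 'm) operad \<Rightarrow> nat list \<Rightarrow> 'o" where
  "tens_arities V P js \<equiv> tens_list V (map (arity P) js)"

text \<open>For \<open>iss = [is\<^sub>1, \<dots>, is\<^sub>k]\<close> and \<open>js = map length iss\<close>, the shuffle isomorphism
  \<open>(P(k) \<otimes> \<Otimes>\<^sub>s P(j\<^sub>s)) \<otimes> \<Otimes>\<^bsub>s,q\<^esub> P(i\<^bsub>s,q\<^esub>) \<rightarrow> P(k) \<otimes> \<Otimes>\<^sub>s (P(j\<^sub>s) \<otimes> \<Otimes>\<^sub>q P(i\<^bsub>s,q\<^esub>))\<close>.\<close>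

definition operad_shuffle ::
  "('o, 'm, 'z) ccat_scheme \<Rightarrow> ('o, 'm) operad \<Rightarrow> nat list list \<Rightarrow> 'm" where
  "operad_shuffle V P iss =
     (let js = map length iss;
          A = arity P (length iss); B = tens_arities V P js; D = tens_arities V P (concat iss);
          W = (A \<otimes>\<^bsub>V\<^esub> B) \<otimes>\<^bsub>V\<^esub> D;
          a = Pr1 V A B \<cdot>\<^bsub>V\<^esub> Pr1 V (A \<otimes>\<^bsub>V\<^esub> B) D;
          b = (\<lambda>s. proj_list V (map (arity P) js) s \<cdot>\<^bsub>V\<^esub> Pr2 V A B \<cdot>\<^bsub>V\<^esub> Pr1 V (A \<otimes>\<^bsub>V\<^esub> B) D);
          d = (\<lambda>s q. proj_list V (map (arity P) (concat iss)) (sum_list (take s js) + q)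
                       \<cdot>\<^bsub>V\<^esub> Pr2 V (A \<otimes>\<^bsub>V\<^esub> B) D)
      in pairing V a
           (tuple_list V W
              (map (\<lambda>s. pairing V (b s) (tuple_list V W (map (d s) [0..<js ! s])))
                 [0..<length iss])))"

text \<open>The isomorphism \<open>\<Otimes>\<^sub>i P(j\<^sub>i) \<rightarrow> \<Otimes>\<^sub>p P(j\<^bsub>\<sigma>\<^sup>-\<^sup>1(p)\<^esub>)\<close> permuting the factors.\<close>

definition permute_factors ::
  "('o, 'm, 'z) ccat_scheme \<Rightarrow> ('o, 'm) operad \<Rightarrow> (nat \<Rightarrow> nat) \<Rightarrow> nat list \<Rightarrow> 'm" where
  "permute_factors V P \<sigma> js =
     tuple_list V (tens_arities V P js)
       (move_list \<sigma> (map (proj_list V (map (arity P) js)) [0..<length js]))"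

text \<open>May's axioms: associativity, the two unit laws, and the two equivariance laws
  \<open>\<gamma>(c \<sigma>; d\<^sub>1, \<dots>, d\<^sub>k) = \<gamma>(c; d\<^bsub>\<sigma>\<^sup>-\<^sup>1(1)\<^esub>, \<dots>, d\<^bsub>\<sigma>\<^sup>-\<^sup>1(k)\<^esub>) \<sigma>(j\<^sub>1, \<dots>, j\<^sub>k)\<close> and
  \<open>\<gamma>(c; d\<^sub>1 \<tau>\<^sub>1, \<dots>, d\<^sub>k \<tau>\<^sub>k) = \<gamma>(c; d\<^sub>1, \<dots>, d\<^sub>k) (\<tau>\<^sub>1 \<oplus> \<dots> \<oplus> \<tau>\<^sub>k)\<close>.
  No condition is imposed on \<open>P(0)\<close>.\<close>

locale symmetric_operad = cartesian_monoidal_category V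
  for V :: "('o, 'm, 'z) ccat_scheme" (structure) +
  fixes P :: "('o, 'm) operad"
  assumes sseq: "symmetric_sequence V (sseq P)"
    and opunit_hom: "opunit P \<in> hom V \<I> (arity P 1)"
    and gamma_hom:
      "gamma P js \<in> hom V (arity P (length js) \<otimes> tens_arities V P js) (arity P (sum_list js))"
    and gamma_assoc:
      "gamma P (concat iss)
         \<cdot> tens_mor V (gamma P (map length iss)) (Ident V (tens_arities V P (concat iss))) =
       gamma P (map sum_list iss)
         \<cdot> tens_mor V (Ident V (arity P (length iss))) (tens_mor_list V (map (gamma P) iss))
         \<cdot> operad_shuffle V P iss"
    and gamma_unit_left:
      "gamma P [j] \<cdot> tens_mor V (opunit P) (Ident V (tens_arities V P [j])) =
       Pr1 V (arity P j) \<I> \<cdot> Pr2 V \<I> (tens_arities V P [j])"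
    and gamma_unit_right:
      "gamma P (replicate k 1)
         \<cdot> tens_mor V (Ident V (arity P k)) (tens_mor_list V (replicate k (opunit P))) =
       Pr1 V (arity P k) (tens_list V (replicate k \<I>))"
    and gamma_equivariant_outer:
      "\<sigma> \<in> Sym (length js) \<Longrightarrow>
       gamma P js \<cdot> tens_mor V (sact (sseq P) (length js) \<sigma>) (Ident V (tens_arities V P js)) =
       sact (sseq P) (sum_list js) (block_perm \<sigma> js)
         \<cdot> gamma P (move_list \<sigma> js)
         \<cdot> tens_mor V (Ident V (arity P (length js))) (permute_factors V P \<sigma> js)"
    and gamma_equivariant_inner:
      "length \<tau>s = length js \<Longrightarrow> (\<And>s. s < length js \<Longrightarrow> \<tau>s ! s \<in> Sym (js ! s)) \<Longrightarrow>
       gamma P js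
         \<cdot> tens_mor V (Ident V (arity P (length js)))
             (tens_mor_list V (map2 (sact (sseq P)) js \<tau>s)) =
       sact (sseq P) (sum_list js) (block_sum js \<tau>s) \<cdot> gamma P js"

definition based_operad :: "('o, 'm, 'z) ccat_scheme \<Rightarrow> ('o, 'm) operad \<Rightarrow> 'm \<Rightarrow> bool" where
  "based_operad V P \<eta> \<longleftrightarrow> symmetric_operad V P \<and> \<eta> \<in> hom V \<I>\<^bsub>V\<^esub> (arity P 0)"

definition Comm :: "('o, 'm, 'z) ccat_scheme \<Rightarrow> ('o, 'm) operad" where
  "Comm V = \<lparr>sseq = \<lparr>fob = (\<lambda>n. \<I>\<^bsub>V\<^esub>), fmor = (\<lambda>f. Ident V \<I>\<^bsub>V\<^esub>)\<rparr>,
     opunit = Ident V \<I>\<^bsub>V\<^esub>,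
     gamma = (\<lambda>js. to_unit V (\<I>\<^bsub>V\<^esub> \<otimes>\<^bsub>V\<^esub> tens_list V (map (\<lambda>j. \<I>\<^bsub>V\<^esub>) js)))\<rparr>"

end

theory Submission
  imports Defs
begin

text \<open>The idea is that of the formula \<open>B(n) = \<Coprod>\<^bsub>S \<subseteq> {1..n}\<^esub> C(|S|)\<close>.  An element of \<open>B(n)\<close> is an operation \<open>c\<close> of \<open>C\<close>
whose inputs are labelled by the elements of a subset \<open>S\<close> of \<open>{1..n}\<close>.  The composite of \<open>(S, c)\<close> with
\<open>(S\<^sub>1, c\<^sub>1), \<dots>, (S\<^sub>k, c\<^sub>k)\<close> forgets \<open>c\<^sub>i\<close> for \<open>i \<notin> S\<close>, composes \<open>c\<close> with the remaining \<open>c\<^sub>i\<close> in \<open>C\<close>, and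
labels the result by the union of the copies of the \<open>S\<^sub>i\<close>, \<open>i \<in> S\<close>, in the respective blocks.  Forgetting is
possible because the monoidal structure is Cartesian.  For sets, the operad axioms of \<open>B\<close> are the axioms of
\<open>C\<close> together with bookkeeping about subsets; this is \<open>mask_operad\<close>.

A subset is encoded as a Boolean list, called a mask, and a permutation is studied through its action
\<open>move_list\<close> on lists.  As a permutation is determined by its effect on a single list with distinct entries
(\<open>move_list_inj\<close>), the compatibility of block sums and block permutations with restriction to subsets
(\<open>restrict_perm_block_perm\<close>, \<open>restrict_perm_block_sum\<close>) reduces to the behaviour of \<open>concat\<close>.

The passage from sets to \<open>V\<close> has two ingredients.  First, the morphisms \<open>Z \<rightarrow> C(n)\<close>, for fixed \<open>Z\<close> and
varying \<open>n\<close>, form an operad of sets (\<open>points_set_operad\<close>), hence so do their masked versions.  Second, since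
\<open>V\<close> is closed, products distribute over coproducts (\<open>coproduct_tens\<close>), so a morphism out of a product of
objects \<open>B(n)\<close> can be defined, and an equation between such morphisms can be checked, on the summands.  The
composition of \<open>B\<close> is defined in this way, the map from masked points of \<open>C\<close> to points of \<open>B\<close> is
compatible with all operations (\<open>embed_graft\<close>, \<open>embed_act\<close>), and each axiom of \<open>B\<close> becomes the corresponding
axiom for masked points.

It remains to connect the formula for \<open>B(n)\<close> with the definition of the Day convolution by balanced tensors.
Every \<open>\<tau> \<in> Sym (j + k)\<close> is uniquely a block sum after a permutation that sorts a \<open>j\<close>-element subset to the
front (\<open>factor_through_sorter\<close>).  So a balanced family on \<open>C(j) \<otimes> \<I>\<close> amounts to one morphism out of \<open>C(j)\<close> for
every such subset (\<open>sorted_mask_balanced\<close>, \<open>balanced_determined\<close>).  Read in one direction this constructs the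
Day convolution from finite coproducts; read in the other it exhibits any Day convolution as a sum over
masks, with the expected action of the symmetric groups.\<close>

section \<open>Permutations acting on lists\<close>

lemma Sym_iff: "\<sigma> \<in> Sym n \<longleftrightarrow> \<sigma> permutes {1..n}"
  by (simp add: Sym_def)

lemma id_Sym: "id \<in> Sym n"
  by (simp add: Sym_iff permutes_id)

lemma comp_Sym: "\<sigma> \<in> Sym n \<Longrightarrow> \<tau> \<in> Sym n \<Longrightarrow> \<sigma> \<circ> \<tau> \<in> Sym n"
  by (simp add: Sym_iff permutes_compose)

lemma inv_Sym: "\<sigma> \<in> Sym n \<Longrightarrow> inv \<sigma> \<in> Sym n"
  by (simp add: Sym_iff permutes_inv)

lemma Sym_le: assumes "\<sigma> \<in> Sym n" "i < n" shows "\<sigma> (Suc i) - Suc 0 < n" "0 < \<sigma> (Suc i)"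
proof -
  have "\<sigma> (Suc i) \<in> {1..n}" using assms permutes_in_image[of \<sigma> "{1..n}" "Suc i"] by (simp add: Sym_iff)
  then show "\<sigma> (Suc i) - Suc 0 < n" "0 < \<sigma> (Suc i)" by auto
qed

lemma length_move_list [simp]: "length (move_list \<sigma> xs) = length xs"
  by (simp add: move_list_def del: upt_Suc)

lemma move_list_nth:
  assumes "\<sigma> \<in> Sym (length xs)" "i < length xs"
  shows "move_list \<sigma> xs ! (\<sigma> (Suc i) - Suc 0) = xs ! i"
proof -
  have "inv \<sigma> (\<sigma> (Suc i)) = Suc i"
    using assms(1) by (meson Sym_iff permutes_inverses(2))
  then show ?thesis
    using Sym_le[OF assms] unfolding move_list_def
    by (simp del: upt_Suc)
qed

lemma Sym_surj: assumes "\<sigma> \<in> Sym n" "p < n" obtains i where "i < n" "p = \<sigma> (Suc i) - Suc 0"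
proof -
  have "Suc p \<in> \<sigma> ` {1..n}" using assms by (simp add: Sym_iff permutes_image)
  then obtain x where "x \<in> {1..n}" "Suc p = \<sigma> x" by blast
  then show ?thesis using that[of "x - 1"] by (cases x) auto
qed

lemma move_listI:
  assumes "\<sigma> \<in> Sym (length xs)" "length ys = length xs"
    and "\<And>i. i < length xs \<Longrightarrow> ys ! (\<sigma> (Suc i) - Suc 0) = xs ! i"
  shows "move_list \<sigma> xs = ys"
proof (rule nth_equalityI)
  show "length (move_list \<sigma> xs) = length ys" using assms by simp
  fix p assume "p < length (move_list \<sigma> xs)"
  then obtain i where "i < length xs" "p = \<sigma> (Suc i) - Suc 0" using Sym_surj[OF assms(1)] by auto
  then show "move_list \<sigma> xs ! p = ys ! p" using assms move_list_nth by metis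
qed

lemma map_move_list: "\<sigma> \<in> Sym (length xs) \<Longrightarrow> map f (move_list \<sigma> xs) = move_list \<sigma> (map f xs)"
  by (rule move_listI[symmetric]) (auto simp: Sym_le move_list_nth)

lemma map2_move_list:
  assumes "\<sigma> \<in> Sym (length xs)" "length ys = length xs"
  shows "map2 f (move_list \<sigma> xs) (move_list \<sigma> ys) = move_list \<sigma> (map2 f xs ys)"
  using assms by (intro move_listI[symmetric]) (auto simp: Sym_le move_list_nth)

lemma zip_move_list:
  assumes "\<sigma> \<in> Sym (length xs)" "length ys = length xs"
  shows "zip (move_list \<sigma> xs) (move_list \<sigma> ys) = move_list \<sigma> (zip xs ys)"
  using map2_move_list[OF assms, of Pair] by simp

lemma move_list_comp:
  assumes "\<sigma> \<in> Sym (length xs)" "\<tau> \<in> Sym (length xs)"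
  shows "move_list (\<sigma> \<circ> \<tau>) xs = move_list \<sigma> (move_list \<tau> xs)"
proof (rule move_listI)
  fix i assume i: "i < length xs"
  have "Suc (\<tau> (Suc i) - Suc 0) = \<tau> (Suc i)" using Sym_le(2)[OF assms(2) i] by simp
  then show "move_list \<sigma> (move_list \<tau> xs) ! ((\<sigma> \<circ> \<tau>) (Suc i) - Suc 0) = xs ! i"
    using move_list_nth[of \<sigma> "move_list \<tau> xs" "\<tau> (Suc i) - Suc 0"] move_list_nth[OF assms(2) i]
      Sym_le[OF assms(2) i] assms by simp
qed (use assms comp_Sym in auto)

lemma move_list_id [simp]: "move_list id xs = xs"
  by (rule move_listI) (auto simp: id_Sym)

lemma move_list_inv:
  assumes "\<sigma> \<in> Sym (length xs)"
  shows "move_list \<sigma> (move_list (inv \<sigma>) xs) = xs" "move_list (inv \<sigma>) (move_list \<sigma> xs) = xs"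
proof -
  have "\<sigma> \<circ> inv \<sigma> = id" "inv \<sigma> \<circ> \<sigma> = id"
    using assms by (meson Sym_iff permutes_inv_o)+
  then show "move_list \<sigma> (move_list (inv \<sigma>) xs) = xs" "move_list (inv \<sigma>) (move_list \<sigma> xs) = xs"
    using assms by (metis inv_Sym move_list_comp move_list_id)+
qed

text \<open>Every identity between permutations below is proved by comparing the effect of its two sides on a list
with distinct entries.\<close>

lemma move_list_inj:
  assumes "distinct xs" "\<sigma> \<in> Sym (length xs)" "\<tau> \<in> Sym (length xs)"
    and "move_list \<sigma> xs = move_list \<tau> xs"
  shows "\<sigma> = \<tau>"
proof
  fix x
  show "\<sigma> x = \<tau> x"
  proof (cases "x \<in> {1..length xs}")
    case True
    then obtain i where i: "x = Suc i" "i < length xs" by (cases x) auto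
    let ?p = "\<sigma> x - Suc 0" and ?q = "\<tau> x - Suc 0"
    note b = Sym_le[OF assms(2) i(2)] Sym_le[OF assms(3) i(2)]
    obtain i' where i': "i' < length xs" "?p = \<tau> (Suc i') - Suc 0"
      using Sym_surj[OF assms(3)] b(1) i(1) by metis
    have "xs ! i' = xs ! i"
      using move_list_nth[OF assms(2) i(2)] move_list_nth[OF assms(3) i'(1)] i'(2) i(1) assms(4) by simp
    then have "i' = i" using assms(1) i(2) i'(1) nth_eq_iff_index_eq by blast
    then show ?thesis using i' i b by simp
  next
    case False
    then show ?thesis using assms by (metis Sym_iff permutes_not_in)
  qed
qed

text \<open>Distinct entries of \<open>xs\<close> must go to distinct positions of \<open>ys\<close>, so a function that only transports entries is
injective.  For block sums and block permutations this gives bijectivity from the same computation that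
determines their effect on lists.\<close>

lemma move_list_SymI:
  assumes "distinct xs" "length ys = length xs"
    and "\<And>x. x \<notin> {1..length xs} \<Longrightarrow> f x = x"
    and "\<And>i. i < length xs \<Longrightarrow> f (Suc i) \<in> {1..length xs}"
    and "\<And>i. i < length xs \<Longrightarrow> ys ! (f (Suc i) - Suc 0) = xs ! i"
  shows "f \<in> Sym (length xs)"
proof -
  have "inj_on f {1..length xs}"
  proof (rule inj_onI)
    fix x y assume xy: "x \<in> {1..length xs}" "y \<in> {1..length xs}" "f x = f y"
    then obtain i j where ij: "x = Suc i" "y = Suc j" "i < length xs" "j < length xs"
      by (cases x; cases y) auto
    then have "xs ! i = xs ! j" using assms(5) xy(3) by metis
    then show "x = y" using ij assms(1) nth_eq_iff_index_eq by blast
  qed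
  moreover have "f ` {1..length xs} \<subseteq> {1..length xs}"
  proof
    fix y assume "y \<in> f ` {1..length xs}"
    then obtain i where "i < length xs" "y = f (Suc i)"
      by (auto, metis Suc_le_D Suc_le_eq One_nat_def)
    then show "y \<in> {1..length xs}" using assms(4) by blast
  qed
  ultimately have "bij_betw f {1..length xs} {1..length xs}"
    by (simp add: bij_betw_def endo_inj_surj)
  then show ?thesis unfolding Sym_iff using assms(3) by (intro bij_imp_permutes) auto
qed

lemma move_list_exists:
  assumes "distinct xs" "distinct ys" "set xs = set ys"
  obtains \<sigma> where "\<sigma> \<in> Sym (length xs)" "move_list \<sigma> xs = ys"
proof -
  have len: "length ys = length xs" using assms by (metis distinct_card)
  have "\<exists>p. p < length xs \<and> ys ! p = xs ! i" if "i < length xs" for i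
    using that assms(3) len by (metis in_set_conv_nth)
  then obtain g where g: "\<And>i. i < length xs \<Longrightarrow> g i < length xs \<and> ys ! (g i) = xs ! i" by metis
  define f where "f x = (if x \<in> {1..length xs} then Suc (g (x - 1)) else x)" for x
  have "f \<in> Sym (length xs)"
    using assms(1) len by (rule move_list_SymI) (use g in \<open>auto simp: f_def Suc_le_eq\<close>)
  moreover from this len have "move_list f xs = ys"
    by (rule move_listI) (use g in \<open>auto simp: f_def\<close>)
  ultimately show ?thesis by (rule that)
qed

lemma set_move_list: "\<sigma> \<in> Sym (length xs) \<Longrightarrow> set (move_list \<sigma> xs) = set xs"
proof -
  assume a: "\<sigma> \<in> Sym (length xs)"
  have "set (move_list \<sigma> xs) \<subseteq> set xs" if "\<sigma> \<in> Sym (length xs)" for \<sigma> and xs :: "'a list"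
  proof
    fix x assume "x \<in> set (move_list \<sigma> xs)"
    then obtain p where "p < length xs" "x = move_list \<sigma> xs ! p" by (metis in_set_conv_nth length_move_list)
    then show "x \<in> set xs" using Sym_surj[OF that] move_list_nth[OF that] by (metis nth_mem)
  qed
  from this[OF a] this[OF inv_Sym[OF a, folded length_move_list[of \<sigma> xs]]] show ?thesis
    using move_list_inv[OF a] by simp
qed

lemma distinct_move_list: "\<sigma> \<in> Sym (length xs) \<Longrightarrow> distinct xs \<Longrightarrow> distinct (move_list \<sigma> xs)"
  by (simp add: card_distinct distinct_card set_move_list)

lemma mset_move_list: 
  assumes "\<sigma> \<in> Sym (length xs)" shows "mset (move_list \<sigma> xs) = mset xs"
proof -
  have "mset (move_list \<sigma> [0..<length xs]) = mset [0..<length xs]"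
    by (intro set_eq_iff_mset_eq_distinct[THEN iffD1] distinct_move_list set_move_list) (use assms in auto)
  then have "mset (map ((!) xs) (move_list \<sigma> [0..<length xs])) = mset (map ((!) xs) [0..<length xs])"
    by (metis mset_map)
  then show ?thesis using map_move_list[of \<sigma> "[0..<length xs]" "(!) xs"] assms by (simp add: map_nth)
qed

lemma sum_list_move_list: "\<sigma> \<in> Sym (length xs) \<Longrightarrow> sum_list (move_list \<sigma> xs) = sum_list (xs :: nat list)"
  by (metis mset_move_list sum_mset_sum_list)

section \<open>Block sums and block permutations of concatenated lists\<close>

lemma concat_splitE:
  assumes "length xs = sum_list js"
  obtains xss where "concat xss = xs" "map length xss = js"
  using assms
proof (induction js arbitrary: xs thesis)
  case (Cons j js)
  have "length (drop j xs) = sum_list js" using Cons.prems by simp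
  from Cons.IH[OF _ this] obtain xss where "concat xss = drop j xs" "map length xss = js" by blast
  then show ?case using Cons.prems by (intro Cons.prems(1)[of "take j xs # xss"]) auto
qed auto

lemma block_start_Suc: "block_start js (Suc i) = sum_list (take i js)"
  by (simp add: block_start_def)

lemma sum_list_take_mono: "i \<le> j \<Longrightarrow> sum_list (take i js) \<le> sum_list (take j js)" for js :: "nat list"
  by (metis le_add1 le_Suc_ex sum_list_append take_add)

lemma block_of_eq:
  assumes "i < length js" "q < js ! i"
  shows "block_of js (sum_list (take i js) + Suc q) = Suc i"
  unfolding block_of_def
proof (rule Least_equality)
  show "sum_list (take i js) + Suc q \<le> sum_list (take (Suc i) js)"
    using assms by (simp add: take_Suc_conv_app_nth)
  fix l assume l: "sum_list (take i js) + Suc q \<le> sum_list (take l js)"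
  show "Suc i \<le> l"
  proof (rule ccontr)
    assume "\<not> Suc i \<le> l"
    then have "sum_list (take l js) \<le> sum_list (take i js)" by (intro sum_list_take_mono) simp
    with l show False by simp
  qed
qed

lemma block_position:
  fixes js :: "nat list"
  assumes "p < sum_list js"
  obtains i q where "i < length js" "q < js ! i" "p = sum_list (take i js) + q"
  using assms
proof (induction js arbitrary: p thesis)
  case (Cons j js)
  show ?case
  proof (cases "p < j")
    case True
    then show ?thesis by (intro Cons.prems(1)[of 0 p]) auto
  next
    case False
    then have "p - j < sum_list js" using Cons.prems by simp
    from Cons.IH[OF _ this] obtain i q where "i < length js" "q < js ! i" "p - j = sum_list (take i js) + q" by blast
    then show ?thesis using False by (intro Cons.prems(1)[of "Suc i" q]) auto
  qed
qed auto

lemma block_position_less: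
  fixes js :: "nat list"
  assumes "i < length js" "q < js ! i"
  shows "sum_list (take i js) + q < sum_list js"
proof -
  have "sum_list (take i js) + q < sum_list (take (Suc i) js)"
    using assms by (simp add: take_Suc_conv_app_nth)
  also have "\<dots> \<le> sum_list js"
    using sum_list_take_mono[of "Suc i" "length js" js] assms by simp
  finally show ?thesis .
qed

lemma concat_nth_block:
  assumes "i < length xss" "q < length (xss ! i)"
  shows "concat xss ! (sum_list (take i (map length xss)) + q) = xss ! i ! q"
  using assms
proof (induction xss arbitrary: i)
  case (Cons xs xss)
  then show ?case by (cases i) (auto simp: nth_append)
qed auto

lemma block_sum_eq:
  assumes "i < length js" "q < js ! i"
  shows "block_sum js \<tau>s (Suc (sum_list (take i js) + q)) = sum_list (take i js) + (\<tau>s ! i) (Suc q)"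
  using block_of_eq[OF assms] block_position_less[OF assms]
  by (simp add: block_sum_def block_start_Suc Let_def)

lemma block_perm_eq:
  assumes "i < length js" "q < js ! i"
  shows "block_perm \<sigma> js (Suc (sum_list (take i js) + q)) =
    block_start (move_list \<sigma> js) (\<sigma> (Suc i)) + Suc q"
  using block_of_eq[OF assms] block_position_less[OF assms]
  by (simp add: block_perm_def block_start_Suc Let_def)

text \<open>This lemma and the next contain the index arithmetic of blocks; from then on block sums and block
permutations are handled through their effect on concatenated lists.\<close>

lemma block_sum_nth:
  assumes len: "length \<tau>s = length xss"
    and S: "\<And>i. i < length xss \<Longrightarrow> \<tau>s ! i \<in> Sym (length (xss ! i))"
    and p: "p < length (concat xss)"
  shows "block_sum (map length xss) \<tau>s (Suc p) \<in> {1..length (concat xss)}"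
    and "concat (map2 move_list \<tau>s xss) ! (block_sum (map length xss) \<tau>s (Suc p) - Suc 0) = concat xss ! p"
proof -
  obtain i q where iq: "i < length xss" "q < length (xss ! i)" "p = sum_list (take i (map length xss)) + q"
    using block_position[of p "map length xss"] p by (auto simp: length_concat)
  note b = Sym_le[OF S[OF iq(1)] iq(2)]
  have e: "block_sum (map length xss) \<tau>s (Suc p) = Suc (sum_list (take i (map length xss)) + ((\<tau>s ! i) (Suc q) - Suc 0))"
    using block_sum_eq[of i "map length xss" q \<tau>s] iq b by simp
  show "block_sum (map length xss) \<tau>s (Suc p) \<in> {1..length (concat xss)}"
    using block_position_less[of i "map length xss" "(\<tau>s ! i) (Suc q) - Suc 0"] iq b
    unfolding e by (simp add: length_concat)
  have m: "map length (map2 move_list \<tau>s xss) = map length xss"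
    using len by (intro nth_equalityI) auto
  have "concat (map2 move_list \<tau>s xss) ! (sum_list (take i (map length xss)) + ((\<tau>s ! i) (Suc q) - Suc 0))
      = move_list (\<tau>s ! i) (xss ! i) ! ((\<tau>s ! i) (Suc q) - Suc 0)"
    using concat_nth_block[of i "map2 move_list \<tau>s xss" "(\<tau>s ! i) (Suc q) - Suc 0"] iq b len
    unfolding m by simp
  also have "\<dots> = concat xss ! p"
    using move_list_nth[OF S[OF iq(1)] iq(2)] concat_nth_block[of i xss q] iq by simp
  finally show "concat (map2 move_list \<tau>s xss) ! (block_sum (map length xss) \<tau>s (Suc p) - Suc 0) = concat xss ! p"
    unfolding e by simp
qed

lemma block_perm_nth:
  assumes S: "\<sigma> \<in> Sym (length xss)" and p: "p < length (concat xss)"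
  shows "block_perm \<sigma> (map length xss) (Suc p) \<in> {1..length (concat xss)}"
    and "concat (move_list \<sigma> xss) ! (block_perm \<sigma> (map length xss) (Suc p) - Suc 0) = concat xss ! p"
proof -
  obtain i q where iq: "i < length xss" "q < length (xss ! i)" "p = sum_list (take i (map length xss)) + q"
    using block_position[of p "map length xss"] p by (auto simp: length_concat)
  note b = Sym_le[OF S iq(1)]
  define r where "r = \<sigma> (Suc i) - Suc 0"
  have r: "\<sigma> (Suc i) = Suc r" "r < length xss" using b by (auto simp: r_def)
  have m: "move_list \<sigma> (map length xss) = map length (move_list \<sigma> xss)"
    using S by (simp add: map_move_list)
  have n: "move_list \<sigma> xss ! r = xss ! i" using move_list_nth[OF S iq(1)] by (simp add: r_def)
  have e: "block_perm \<sigma> (map length xss) (Suc p) = Suc (sum_list (take r (map length (move_list \<sigma> xss))) + q)"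
    using block_perm_eq[of i "map length xss" q \<sigma>] iq unfolding m r(1) block_start_Suc by simp
  have "sum_list (map length (move_list \<sigma> xss)) = sum_list (map length xss)"
    using S sum_list_move_list[of \<sigma> "map length xss"] m by simp
  then show "block_perm \<sigma> (map length xss) (Suc p) \<in> {1..length (concat xss)}"
    using block_position_less[of r "map length (move_list \<sigma> xss)" q] iq r n
    unfolding e by (simp add: length_concat)
  show "concat (move_list \<sigma> xss) ! (block_perm \<sigma> (map length xss) (Suc p) - Suc 0) = concat xss ! p"
    unfolding e using concat_nth_block[of r "move_list \<sigma> xss" q] concat_nth_block[of i xss q] r n iq by simp
qed

lemma block_sum_Sym:
  assumes "length \<tau>s = length js" "\<And>i. i < length js \<Longrightarrow> \<tau>s ! i \<in> Sym (js ! i)"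
  shows "block_sum js \<tau>s \<in> Sym (sum_list js)"
proof -
  obtain xss where x: "concat xss = [0..<sum_list js]" "map length xss = js"
    using concat_splitE[of "[0..<sum_list js]" js] by auto
  have l: "length (concat xss) = sum_list js" using x by simp
  have "block_sum js \<tau>s \<in> Sym (length (concat xss))"
  proof (rule move_list_SymI[where ys = "concat (map2 move_list \<tau>s xss)"])
    show "length (concat (map2 move_list \<tau>s xss)) = length (concat xss)"
      using assms(1) x(2) by (auto simp: length_concat intro!: arg_cong[of _ _ sum_list] nth_equalityI)
  qed (use block_sum_nth[of \<tau>s xss] assms x l in \<open>auto simp: block_sum_def\<close>)
  then show ?thesis using l by simp
qed

lemma block_perm_Sym:
  assumes "\<sigma> \<in> Sym (length js)"
  shows "block_perm \<sigma> js \<in> Sym (sum_list js)"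
proof -
  obtain xss where x: "concat xss = [0..<sum_list js]" "map length xss = js"
    using concat_splitE[of "[0..<sum_list js]" js] by auto
  have l: "length (concat xss) = sum_list js" using x by simp
  have "block_perm \<sigma> js \<in> Sym (length (concat xss))"
  proof (rule move_list_SymI[where ys = "concat (move_list \<sigma> xss)"])
    show "length (concat (move_list \<sigma> xss)) = length (concat xss)"
      using assms x(2) by (auto simp: length_concat map_move_list sum_list_move_list)
  qed (use block_perm_nth[of \<sigma> xss] assms x l in \<open>auto simp: block_perm_def\<close>)
  then show ?thesis using l by simp
qed

lemma move_list_block_sum:
  assumes "length \<tau>s = length xss" "\<And>i. i < length xss \<Longrightarrow> \<tau>s ! i \<in> Sym (length (xss ! i))"
  shows "move_list (block_sum (map length xss) \<tau>s) (concat xss) = concat (map2 move_list \<tau>s xss)"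
proof (rule move_listI)
  show "block_sum (map length xss) \<tau>s \<in> Sym (length (concat xss))"
    using block_sum_Sym[of \<tau>s "map length xss"] assms by (simp add: length_concat)
  show "length (concat (map2 move_list \<tau>s xss)) = length (concat xss)"
    using assms(1) by (auto simp: length_concat intro!: arg_cong[of _ _ sum_list] nth_equalityI)
qed (use block_sum_nth[OF assms] in auto)

lemma move_list_block_perm:
  assumes "\<sigma> \<in> Sym (length xss)"
  shows "move_list (block_perm \<sigma> (map length xss)) (concat xss) = concat (move_list \<sigma> xss)"
proof (rule move_listI)
  show "block_perm \<sigma> (map length xss) \<in> Sym (length (concat xss))"
    using block_perm_Sym[of \<sigma> "map length xss"] assms by (simp add: length_concat)
  show "length (concat (move_list \<sigma> xss)) = length (concat xss)"
    using assms by (auto simp: length_concat map_move_list sum_list_move_list)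
qed (use block_perm_nth[OF assms] in auto)

section \<open>Subsets as masks\<close>

text \<open>A subset of \<open>{1..n}\<close> is a mask, that is, a list of \<open>n\<close> Booleans.  Selecting and composing are then list
recursions, and a permutation \<open>\<sigma>\<close> sends a mask to its image by \<open>move_list \<sigma>\<close>.\<close>

definition weight :: "bool list \<Rightarrow> nat" where
  "weight m = length (filter id m)"

definition select :: "bool list \<Rightarrow> 'a list \<Rightarrow> 'a list" where
  "select m xs = map snd (filter fst (zip m xs))"

text \<open>For masks of subsets \<open>S\<close> and \<open>S\<^sub>1, \<dots>, S\<^sub>k\<close>, this is the mask of the union of the copies of \<open>S\<^sub>i\<close> in the
\<open>i\<close>-th block, for \<open>i \<in> S\<close>.\<close>

definition mask_comp :: "bool list \<Rightarrow> bool list list \<Rightarrow> bool list" where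
  "mask_comp m ms = concat (map2 (\<lambda>b. map ((\<and>) b)) m ms)"

lemma weight_simps [simp]: "weight [] = 0" "weight (b # m) = (if b then Suc (weight m) else weight m)"
  by (simp_all add: weight_def)

lemma weight_append [simp]: "weight (m @ m') = weight m + weight m'"
  by (simp add: weight_def)

lemma weight_replicate [simp]: "weight (replicate n True) = n" "weight (replicate n False) = 0"
  by (simp_all add: weight_def)

lemma weight_Not: "weight m + weight (map Not m) = length m"
  by (induction m) auto

lemma select_simps [simp]:
  "select [] xs = []" "select m [] = []"
  "select (b # m) (x # xs) = (if b then x # select m xs else select m xs)"
  by (simp_all add: select_def)

lemma length_select [simp]: "length m = length xs \<Longrightarrow> length (select m xs) = weight m"
  by (induction m xs rule: list_induct2) auto

lemma map_select: "map f (select m xs) = select m (map f xs)"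
  by (induction m xs rule: list_induct2') auto

lemma map2_select: "length xs = length m \<Longrightarrow> length ys = length m \<Longrightarrow>
    map2 f (select m xs) (select m ys) = select m (map2 f xs ys)"
  by (induction m arbitrary: xs ys) (auto simp: length_Suc_conv)

lemma select_append [simp]: "length m = length xs \<Longrightarrow>
    select (m @ m') (xs @ ys) = select m xs @ select m' ys"
  by (induction m xs rule: list_induct2) auto

lemma select_replicate [simp]:
  "length xs = n \<Longrightarrow> select (replicate n True) xs = xs"
  "select (replicate n False) xs = []"
  by (induction xs arbitrary: n) (auto simp: select_def set_zip intro!: filter_False)

lemma set_select: "set (select m xs) \<subseteq> set xs"
  by (auto simp: select_def dest: set_zip_rightD)

lemma distinct_select: "distinct xs \<Longrightarrow> distinct (select m xs)"
  by (induction m xs rule: list_induct2') (use set_select in fastforce)+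

lemma length_mask_comp: "length m = length ms \<Longrightarrow> length (mask_comp m ms) = sum_list (map length ms)"
  by (induction m ms rule: list_induct2) (auto simp: mask_comp_def)

lemma mask_comp_Nil [simp]: "mask_comp [] ms = []"
  by (simp add: mask_comp_def)

lemma mask_comp_Cons [simp]:
  "mask_comp (b # m) (m' # ms) = map ((\<and>) b) m' @ mask_comp m ms"
  by (simp add: mask_comp_def)

lemma map_and [simp]: "map ((\<and>) True) m = m" "map ((\<and>) False) m = replicate (length m) False"
  by (induction m) auto

lemma weight_mask_comp:
  "length m = length ms \<Longrightarrow> weight (mask_comp m ms) = sum_list (select m (map weight ms))"
  by (induction m ms rule: list_induct2) auto

lemma select_mask_comp:
  "length m = length ms \<Longrightarrow> map length ms = map length xss \<Longrightarrow>
   select (mask_comp m ms) (concat xss) = concat (select m (map2 select ms xss))"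
proof (induction m ms arbitrary: xss rule: list_induct2)
  case (Cons b m m' ms)
  then show ?case by (cases xss; cases b) auto
qed auto

lemma mask_comp_append: "length m = length ms \<Longrightarrow>
    mask_comp (m @ m') (ms @ ms') = mask_comp m ms @ mask_comp m' ms'"
  by (simp add: mask_comp_def)

lemma mask_comp_False: "length ms = n \<Longrightarrow> 
   mask_comp (replicate n False) ms = replicate (sum_list (map length ms)) False"
  by (induction ms arbitrary: n) (auto simp: replicate_add)

lemma mask_comp_assoc:
  "length m = length ms \<Longrightarrow> map length ms = map length mss \<Longrightarrow>
   mask_comp (mask_comp m ms) (concat mss) = mask_comp m (map2 mask_comp ms mss)"
proof (induction m ms arbitrary: mss rule: list_induct2)
  case (Cons b m m' ms)
  then obtain ms0 mss0 where "mss = ms0 # mss0" by (cases mss) auto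
  with Cons show ?case
    by (cases b) (auto simp: mask_comp_append mask_comp_False length_mask_comp)
qed auto

lemma mask_comp_unit: "length m = k \<Longrightarrow> mask_comp m (replicate k [True]) = m"
  by (induction m arbitrary: k) auto

text \<open>The permutation that \<open>\<sigma>\<close> induces from a subset to its image, when the elements of both are numbered in
increasing order.  It is defined by its effect on the list of elements; \<open>move_list_restrict_perm\<close> extends
this to every list.\<close>

definition restrict_perm :: "(nat \<Rightarrow> nat) \<Rightarrow> bool list \<Rightarrow> nat \<Rightarrow> nat" where
  "restrict_perm \<sigma> m = (THE \<rho>. \<rho> \<in> Sym (weight m) \<and>
     move_list \<rho> (select m [0..<length m]) = select (move_list \<sigma> m) (move_list \<sigma> [0..<length m]))"

lemma select_move_list_set:
  assumes "\<sigma> \<in> Sym (length m)" "length xs = length m"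
  shows "set (select (move_list \<sigma> m) (move_list \<sigma> xs)) = set (select m xs)"
  using assms by (simp add: select_def zip_move_list set_move_list)

lemma restrict_perm_props:
  assumes "\<sigma> \<in> Sym (length m)"
  shows "restrict_perm \<sigma> m \<in> Sym (weight m) \<and>
    move_list (restrict_perm \<sigma> m) (select m [0..<length m]) =
      select (move_list \<sigma> m) (move_list \<sigma> [0..<length m])"
proof -
  let ?xs = "select m [0..<length m]"
  let ?ys = "select (move_list \<sigma> m) (move_list \<sigma> [0..<length m])"
  have d: "distinct ?xs" "distinct ?ys" "set ?xs = set ?ys"
    using assms by (simp_all add: distinct_select distinct_move_list select_move_list_set)
  from move_list_exists[OF this] obtain \<rho> where \<rho>: "\<rho> \<in> Sym (weight m)" "move_list \<rho> ?xs = ?ys" by auto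
  have "\<exists>!\<rho>. \<rho> \<in> Sym (weight m) \<and> move_list \<rho> ?xs = ?ys"
  proof (rule ex1I)
    show "\<rho> \<in> Sym (weight m) \<and> move_list \<rho> ?xs = ?ys" using \<rho> by simp
    show "\<rho>' = \<rho>" if "\<rho>' \<in> Sym (weight m) \<and> move_list \<rho>' ?xs = ?ys" for \<rho>'
      using that \<rho> d(1) by (intro move_list_inj[of ?xs]) auto
  qed
  from theI'[OF this] show ?thesis unfolding restrict_perm_def .
qed

lemma restrict_perm_Sym: "\<sigma> \<in> Sym (length m) \<Longrightarrow> restrict_perm \<sigma> m \<in> Sym (weight m)"
  by (simp add: restrict_perm_props)

lemma move_list_restrict_perm:
  assumes "\<sigma> \<in> Sym (length m)" "length xs = length m"
  shows "move_list (restrict_perm \<sigma> m) (select m xs) = select (move_list \<sigma> m) (move_list \<sigma> xs)"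
proof -
  have xs: "map ((!) xs) [0..<length m] = xs" unfolding assms(2)[symmetric] by (rule map_nth)
  have "map ((!) xs) (move_list (restrict_perm \<sigma> m) (select m [0..<length m])) =
     map ((!) xs) (select (move_list \<sigma> m) (move_list \<sigma> [0..<length m]))"
    using restrict_perm_props[OF assms(1)] by simp
  then show ?thesis
    using assms restrict_perm_Sym[OF assms(1)] by (simp add: map_move_list map_select xs)
qed

lemma restrict_permI:
  assumes "\<sigma> \<in> Sym (length m)" "\<rho> \<in> Sym (weight m)" "distinct xs" "length xs = length m"
    and "move_list \<rho> (select m xs) = select (move_list \<sigma> m) (move_list \<sigma> xs)"
  shows "restrict_perm \<sigma> m = \<rho>"
  using assms by (intro move_list_inj[of "select m xs"])
    (auto simp: distinct_select restrict_perm_Sym move_list_restrict_perm)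

lemma weight_move_list: "\<sigma> \<in> Sym (length m) \<Longrightarrow> weight (move_list \<sigma> m) = weight m"
  unfolding weight_def by (metis mset_filter mset_move_list size_mset)

lemma restrict_perm_comp:
  assumes "\<sigma> \<in> Sym (length m)" "\<tau> \<in> Sym (length m)"
  shows "restrict_perm (\<sigma> \<circ> \<tau>) m = restrict_perm \<sigma> (move_list \<tau> m) \<circ> restrict_perm \<tau> m"
proof (rule restrict_permI[where xs = "[0..<length m]"])
  let ?xs = "[0..<length m]"
  have r: "restrict_perm \<sigma> (move_list \<tau> m) \<in> Sym (weight m)" "restrict_perm \<tau> m \<in> Sym (weight m)"
    using restrict_perm_Sym[of \<sigma> "move_list \<tau> m"] restrict_perm_Sym[of \<tau> m] assms weight_move_list[of \<tau> m]
    by simp_all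
  then show "restrict_perm \<sigma> (move_list \<tau> m) \<circ> restrict_perm \<tau> m \<in> Sym (weight m)" by (rule comp_Sym)
  show "move_list (restrict_perm \<sigma> (move_list \<tau> m) \<circ> restrict_perm \<tau> m) (select m ?xs) =
    select (move_list (\<sigma> \<circ> \<tau>) m) (move_list (\<sigma> \<circ> \<tau>) ?xs)"
    using assms r by (simp add: move_list_comp move_list_restrict_perm)
qed (use assms comp_Sym in auto)

lemma mask_comp_block_perm:
  assumes "\<sigma> \<in> Sym (length m)" "length ms = length m"
  shows "move_list (block_perm \<sigma> (map length ms)) (mask_comp m ms) =
    mask_comp (move_list \<sigma> m) (move_list \<sigma> ms)"
proof -
  let ?xss = "map2 (\<lambda>b. map ((\<and>) b)) m ms"
  have l: "map length ?xss = map length ms" using assms(2) by (intro nth_equalityI) auto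
  show ?thesis
    using move_list_block_perm[of \<sigma> ?xss] assms unfolding l
    by (simp add: mask_comp_def map2_move_list)
qed

lemma mask_comp_block_sum:
  assumes "length ms = length m" "length \<tau>s = length m"
    "\<And>i. i < length m \<Longrightarrow> \<tau>s ! i \<in> Sym (length (ms ! i))"
  shows "move_list (block_sum (map length ms) \<tau>s) (mask_comp m ms) =
    mask_comp m (map2 move_list \<tau>s ms)"
proof -
  let ?xss = "map2 (\<lambda>b. map ((\<and>) b)) m ms"
  have l: "map length ?xss = map length ms" using assms by (intro nth_equalityI) auto
  have "map2 move_list \<tau>s ?xss = map2 (\<lambda>b. map ((\<and>) b)) m (map2 move_list \<tau>s ms)"
    using assms by (intro nth_equalityI) (auto simp: map_move_list)
  then show ?thesis
    using move_list_block_sum[of \<tau>s ?xss] assms unfolding l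
    by (simp add: mask_comp_def)
qed

text \<open>Selecting from a concatenation is concatenating selections, so on a concatenated list with distinct
entries both sides move the selected sublists as whole blocks.\<close>

lemma restrict_perm_block_perm:
  assumes \<sigma>: "\<sigma> \<in> Sym (length m)" and l: "length ms = length m"
  shows "restrict_perm (block_perm \<sigma> (map length ms)) (mask_comp m ms) =
    block_perm (restrict_perm \<sigma> m) (select m (map weight ms))"
proof -
  \<comment> \<open>The test list is cut into blocks of the same lengths as the masks \<open>ms\<close>.\<close>
  obtain xss where x: "concat xss = [0..<sum_list (map length ms)]" "map length xss = map length ms"
    using concat_splitE[of "[0..<sum_list (map length ms)]" "map length ms"] by auto
  have lx: "length xss = length ms" using x(2) by (metis length_map)
  have bp: "block_perm \<sigma> (map length ms) \<in> Sym (sum_list (map length ms))"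
    by (rule block_perm_Sym) (use assms in simp)
  let ?ss = "map2 select ms xss"
  have w: "map length ?ss = map weight ms"
    using x(2) lx by (intro nth_equalityI) (auto, metis length_select nth_map)
  have ws: "map length (select m ?ss) = select m (map weight ms)" unfolding map_select w ..
  show ?thesis
  proof (rule restrict_permI[where xs = "concat xss"])
    show "block_perm \<sigma> (map length ms) \<in> Sym (length (mask_comp m ms))"
      using bp l by (simp add: length_mask_comp)
    show "block_perm (restrict_perm \<sigma> m) (select m (map weight ms)) \<in> Sym (weight (mask_comp m ms))"
      using block_perm_Sym[of "restrict_perm \<sigma> m" "select m (map weight ms)"] assms
      by (simp add: weight_mask_comp restrict_perm_Sym)
    show "distinct (concat xss)" "length (concat xss) = length (mask_comp m ms)"
      using l by (simp_all add: x length_mask_comp)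
    have "move_list (block_perm (restrict_perm \<sigma> m) (select m (map weight ms))) (select (mask_comp m ms) (concat xss))
       = concat (move_list (restrict_perm \<sigma> m) (select m ?ss))"
      using move_list_block_perm[of "restrict_perm \<sigma> m" "select m ?ss"] assms lx select_mask_comp[of m ms xss] x(2)
      unfolding ws by (simp add: restrict_perm_Sym)
    also have "\<dots> = concat (select (move_list \<sigma> m) (map2 select (move_list \<sigma> ms) (move_list \<sigma> xss)))"
      using assms lx by (simp add: move_list_restrict_perm map2_move_list)
    also have "\<dots> = select (mask_comp (move_list \<sigma> m) (move_list \<sigma> ms)) (concat (move_list \<sigma> xss))"
      using assms lx x(2) by (subst select_mask_comp) (auto simp: map_move_list)
    also have "\<dots> = select (move_list (block_perm \<sigma> (map length ms)) (mask_comp m ms))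
        (move_list (block_perm \<sigma> (map length ms)) (concat xss))"
      using move_list_block_perm[of \<sigma> xss] assms lx unfolding x(2)
      by (simp add: mask_comp_block_perm)
    finally show "move_list (block_perm (restrict_perm \<sigma> m) (select m (map weight ms))) (select (mask_comp m ms) (concat xss))
      = select (move_list (block_perm \<sigma> (map length ms)) (mask_comp m ms))
        (move_list (block_perm \<sigma> (map length ms)) (concat xss))" .
  qed
qed

text \<open>Here both sides permute inside the selected sublists.\<close>

lemma restrict_perm_block_sum:
  assumes l: "length ms = length m" "length \<tau>s = length m"
    and \<tau>: "\<And>i. i < length m \<Longrightarrow> \<tau>s ! i \<in> Sym (length (ms ! i))"
  shows "restrict_perm (block_sum (map length ms) \<tau>s) (mask_comp m ms) =
    block_sum (select m (map weight ms)) (select m (map2 restrict_perm \<tau>s ms))"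
proof -
  obtain xss where x: "concat xss = [0..<sum_list (map length ms)]" "map length xss = map length ms"
    using concat_splitE[of "[0..<sum_list (map length ms)]" "map length ms"] by auto
  have lx: "length xss = length ms" using x(2) by (metis length_map)
  have xi: "length (xss ! i) = length (ms ! i)" if "i < length m" for i
    using x(2) that l lx by (metis nth_map)
  have bs: "block_sum (map length ms) \<tau>s \<in> Sym (sum_list (map length ms))"
    by (rule block_sum_Sym) (use assms in auto)
  let ?ss = "map2 select ms xss" and ?rs = "map2 restrict_perm \<tau>s ms"
  have w: "map length ?ss = map weight ms"
    using lx l xi by (intro nth_equalityI) auto
  have ws: "map length (select m ?ss) = select m (map weight ms)" unfolding map_select w ..
  have all: "\<forall>(r, s) \<in> set (zip (select m ?rs) (select m ?ss)). r \<in> Sym (length s)"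
  proof -
    have z: "zip (select m ?rs) (select m ?ss) = select m (zip ?rs ?ss)"
      using map2_select[of ?rs m ?ss Pair] l lx by simp
    have b: "\<forall>(r, s) \<in> set (zip ?rs ?ss). r \<in> Sym (length s)"
    proof
      fix p assume "p \<in> set (zip ?rs ?ss)"
      then obtain i where i: "i < length (zip ?rs ?ss)" "p = zip ?rs ?ss ! i" by (metis in_set_conv_nth)
      then have "p = (restrict_perm (\<tau>s ! i) (ms ! i), select (ms ! i) (xss ! i))" "i < length m"
        using l lx by auto
      then show "case p of (r, s) \<Rightarrow> r \<in> Sym (length s)"
        using restrict_perm_Sym[OF \<tau>] xi[of i] by simp
    qed
    show ?thesis unfolding z
      by (rule ballI, rule bspec[OF b]) (erule subsetD[OF set_select])
  qed
  have ri: "select m ?rs ! i \<in> Sym (length (select m ?ss ! i))" if "i < weight m" for i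
  proof -
    have len: "i < length (select m ?rs)" "i < length (select m ?ss)" using that l lx by (subst length_select; simp)+
    then have "zip (select m ?rs) (select m ?ss) ! i \<in> set (zip (select m ?rs) (select m ?ss))"
      by (intro nth_mem) (simp only: length_zip min_less_iff_conj)
    with all show ?thesis unfolding nth_zip[OF len] by blast
  qed
  have ri': "select m ?rs ! i \<in> Sym (select m (map weight ms) ! i)" if "i < weight m" for i
  proof -
    have "i < length (select m ?ss)" using that l lx by (subst length_select) simp_all
    then show ?thesis using ri[OF that] by (simp only: ws[symmetric] nth_map)
  qed
  show ?thesis
  proof (rule restrict_permI[where xs = "concat xss"])
    show "block_sum (map length ms) \<tau>s \<in> Sym (length (mask_comp m ms))"
      using bs l by (simp add: length_mask_comp)
    show "block_sum (select m (map weight ms)) (select m ?rs) \<in> Sym (weight (mask_comp m ms))"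
      using block_sum_Sym[of "select m ?rs" "select m (map weight ms)"] l ri'
      by (simp add: weight_mask_comp)
    show "distinct (concat xss)" "length (concat xss) = length (mask_comp m ms)"
      using l by (simp_all add: x length_mask_comp)
    have "move_list (block_sum (select m (map weight ms)) (select m ?rs)) (select (mask_comp m ms) (concat xss))
       = concat (map2 move_list (select m ?rs) (select m ?ss))"
      using move_list_block_sum[of "select m ?rs" "select m ?ss"] l lx select_mask_comp[of m ms xss] x(2) ri
      unfolding ws by simp
    also have "map2 move_list (select m ?rs) (select m ?ss) = select m (map2 move_list ?rs ?ss)"
      using l lx by (subst map2_select) auto
    also have "map2 move_list ?rs ?ss = map2 select (map2 move_list \<tau>s ms) (map2 move_list \<tau>s xss)"
      using l lx xi \<tau> by (intro nth_equalityI) (auto simp: move_list_restrict_perm)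
    also have "concat (select m \<dots>) = select (mask_comp m (map2 move_list \<tau>s ms)) (concat (map2 move_list \<tau>s xss))"
      using l lx xi by (subst select_mask_comp) (auto intro!: nth_equalityI)
    also have "\<dots> = select (move_list (block_sum (map length ms) \<tau>s) (mask_comp m ms))
        (move_list (block_sum (map length ms) \<tau>s) (concat xss))"
      using move_list_block_sum[of \<tau>s xss] l lx xi \<tau> unfolding x(2)
      by (simp add: mask_comp_block_sum)
    finally show "move_list (block_sum (select m (map weight ms)) (select m ?rs)) (select (mask_comp m ms) (concat xss))
       = select (move_list (block_sum (map length ms) \<tau>s) (mask_comp m ms))
        (move_list (block_sum (map length ms) \<tau>s) (concat xss))" .
  qed
qed

section \<open>Sorting permutations\<close>

text \<open>The mask of the subset \<open>{1..j}\<close> of \<open>{1..j + k}\<close>.\<close>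

definition std_mask :: "nat \<Rightarrow> nat \<Rightarrow> bool list" where
  "std_mask j k = replicate j True @ replicate k False"

lemma std_mask_simps [simp]: "length (std_mask j k) = j + k" "weight (std_mask j k) = j"
  by (simp_all add: std_mask_def)

lemma select_std_mask: "length xs = j + k \<Longrightarrow> select (std_mask j k) xs = take j xs"
proof -
  assume l: "length xs = j + k"
  have "select (replicate j True @ replicate k False) (take j xs @ drop j xs) = take j xs"
    using l by (subst select_append) auto
  then show ?thesis by (simp add: std_mask_def)
qed

lemma move_list_block_sum2:
  assumes "\<sigma> \<in> Sym j" "\<rho> \<in> Sym k" "length xs = j" "length ys = k"
  shows "move_list (block_sum [j, k] [\<sigma>, \<rho>]) (xs @ ys) = move_list \<sigma> xs @ move_list \<rho> ys"
proof -
  have "[\<sigma>, \<rho>] ! i \<in> Sym (length ([xs, ys] ! i))" if "i < length [xs, ys]" for i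
    using that assms by (cases i) auto
  then have "move_list (block_sum (map length [xs, ys]) [\<sigma>, \<rho>]) (concat [xs, ys]) = concat (map2 move_list [\<sigma>, \<rho>] [xs, ys])"
    by (intro move_list_block_sum) simp_all
  then show ?thesis using assms by simp
qed

lemma block_sum2_Sym: "\<sigma> \<in> Sym j \<Longrightarrow> \<rho> \<in> Sym k \<Longrightarrow> block_sum [j, k] [\<sigma>, \<rho>] \<in> Sym (j + k)"
proof -
  assume "\<sigma> \<in> Sym j" "\<rho> \<in> Sym k"
  then have "[\<sigma>, \<rho>] ! i \<in> Sym ([j, k] ! i)" if "i < length [j, k]" for i
    using that by (cases i) auto
  then have "block_sum [j, k] [\<sigma>, \<rho>] \<in> Sym (sum_list [j, k])" by (intro block_sum_Sym) simp_all
  then show ?thesis by simp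
qed

lemma move_list_replicate: "\<sigma> \<in> Sym n \<Longrightarrow> move_list \<sigma> (replicate n b) = replicate n b"
  by (rule move_listI) (auto simp: Sym_le)

lemma move_list_block_sum_std_mask:
  assumes "\<sigma> \<in> Sym j" "\<rho> \<in> Sym k"
  shows "move_list (block_sum [j, k] [\<sigma>, \<rho>]) (std_mask j k) = std_mask j k"
  using move_list_block_sum2[OF assms, of "replicate j True" "replicate k False"] assms
  by (simp add: std_mask_def move_list_replicate)

lemma restrict_perm_block_sum_std_mask:
  assumes "\<sigma> \<in> Sym j" "\<rho> \<in> Sym k"
  shows "restrict_perm (block_sum [j, k] [\<sigma>, \<rho>]) (std_mask j k) = \<sigma>"
proof (rule restrict_permI[where xs = "[0..<j] @ [j..<j + k]"])
  show "move_list \<sigma> (select (std_mask j k) ([0..<j] @ [j..<j + k])) =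
    select (move_list (block_sum [j, k] [\<sigma>, \<rho>]) (std_mask j k)) (move_list (block_sum [j, k] [\<sigma>, \<rho>]) ([0..<j] @ [j..<j + k]))"
    unfolding move_list_block_sum_std_mask[OF assms]
    by (subst move_list_block_sum2[OF assms]) (simp_all add: select_std_mask)
qed (use assms block_sum2_Sym in auto)

text \<open>The shuffle that moves a subset to the front and its complement to the back, keeping the order within
both.\<close>

definition sorter :: "bool list \<Rightarrow> nat \<Rightarrow> nat" where
  "sorter m = (SOME \<tau>. \<tau> \<in> Sym (length m) \<and>
     move_list \<tau> [0..<length m] = select m [0..<length m] @ select (map Not m) [0..<length m])"

lemma set_select_Un: "length m = length xs \<Longrightarrow> set (select m xs) \<union> set (select (map Not m) xs) = set xs"
  by (induction m xs rule: list_induct2) auto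

lemma set_select_Int: "length m = length xs \<Longrightarrow> distinct xs \<Longrightarrow> set (select m xs) \<inter> set (select (map Not m) xs) = {}"
proof (induction m xs rule: list_induct2)
  case (Cons b m x xs)
  then show ?case using set_select[of m xs] set_select[of "map Not m" xs] by (cases b) auto
qed auto

lemma sorter_props:
  "sorter m \<in> Sym (length m) \<and>
     move_list (sorter m) [0..<length m] = select m [0..<length m] @ select (map Not m) [0..<length m]"
proof -
  let ?ys = "select m [0..<length m] @ select (map Not m) [0..<length m]"
  have "distinct ?ys" "set [0..<length m] = set ?ys"
    using set_select_Int[of m "[0..<length m]"] set_select_Un[of m "[0..<length m]"] by (auto simp: distinct_select)
  then obtain \<tau> where "\<tau> \<in> Sym (length [0..<length m])" "move_list \<tau> [0..<length m] = ?ys"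
    by (rule move_list_exists[OF distinct_upt])
  then have "\<exists>\<tau>. \<tau> \<in> Sym (length m) \<and> move_list \<tau> [0..<length m] = ?ys" by auto
  from someI_ex[OF this] show ?thesis unfolding sorter_def .
qed

lemma sorter_Sym: "sorter m \<in> Sym (length m)"
  using sorter_props by blast

lemma move_list_sorter:
  assumes "length xs = length m"
  shows "move_list (sorter m) xs = select m xs @ select (map Not m) xs"
proof -
  have xs: "map ((!) xs) [0..<length m] = xs" unfolding assms[symmetric] by (rule map_nth)
  have "map ((!) xs) (move_list (sorter m) [0..<length m]) =
      map ((!) xs) (select m [0..<length m] @ select (map Not m) [0..<length m])"
    using sorter_props by simp
  then show ?thesis using sorter_Sym by (simp add: map_move_list map_select xs)
qed

lemma select_self: "select m m = replicate (weight m) True" "select (map Not m) m = replicate (weight (map Not m)) False"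
  by (induction m) auto

lemma move_list_sorter_self: "move_list (sorter m) m = std_mask (weight m) (weight (map Not m))"
  using move_list_sorter[of m m] by (simp add: select_self std_mask_def)

lemma restrict_perm_sorter: "restrict_perm (sorter m) m = id"
proof (rule restrict_permI[where xs = "[0..<length m]"])
  show "move_list id (select m [0..<length m]) = select (move_list (sorter m) m) (move_list (sorter m) [0..<length m])"
    unfolding move_list_sorter_self by (subst select_std_mask) (simp_all add: weight_Not move_list_sorter)
qed (auto simp: sorter_Sym id_Sym)

lemma map_Not_move_list: "\<tau> \<in> Sym (length m) \<Longrightarrow> move_list \<tau> (map Not m) = map Not (move_list \<tau> m)"
  by (simp add: map_move_list)

text \<open>A permutation that moves a given subset to the front differs from the sorting one only by permutations of
the front and of the back, namely the ones it induces on the subset and on its complement.\<close>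

lemma factor_through_sorter:
  assumes \<tau>: "\<tau> \<in> Sym (length m)" and m: "move_list \<tau> m = std_mask j k" "length m = j + k"
  shows "block_sum [j, k] [restrict_perm \<tau> m, restrict_perm \<tau> (map Not m)] \<circ> sorter m = \<tau>"
    and "restrict_perm \<tau> m \<in> Sym j" "restrict_perm \<tau> (map Not m) \<in> Sym k"
    and "weight m = j" "weight (map Not m) = k"
proof -
  show w: "weight m = j" using weight_move_list[OF \<tau>] m by simp
  then show w': "weight (map Not m) = k" using weight_Not[of m] m by simp
  show r: "restrict_perm \<tau> m \<in> Sym j" "restrict_perm \<tau> (map Not m) \<in> Sym k"
    using restrict_perm_Sym[OF \<tau>] restrict_perm_Sym[of \<tau> "map Not m"] \<tau> w w' by simp_all
  let ?b = "block_sum [j, k] [restrict_perm \<tau> m, restrict_perm \<tau> (map Not m)]"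
  let ?xs = "[0..<length m]"
  have b: "?b \<in> Sym (length m)" using block_sum2_Sym[OF r] m by simp
  have "move_list (?b \<circ> sorter m) ?xs = move_list ?b (select m ?xs @ select (map Not m) ?xs)"
    using b sorter_Sym by (simp add: move_list_comp move_list_sorter)
  also have "\<dots> = move_list (restrict_perm \<tau> m) (select m ?xs) @ move_list (restrict_perm \<tau> (map Not m)) (select (map Not m) ?xs)"
    by (rule move_list_block_sum2[OF r]) (simp_all add: w w')
  also have "\<dots> = select (std_mask j k) (move_list \<tau> ?xs) @ select (map Not (std_mask j k)) (move_list \<tau> ?xs)"
    using \<tau> m by (simp add: move_list_restrict_perm map_Not_move_list)
  also have "\<dots> = move_list \<tau> ?xs"
  proof -
    have "select (map Not (std_mask j k)) (take j (move_list \<tau> ?xs) @ drop j (move_list \<tau> ?xs)) = drop j (move_list \<tau> ?xs)"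
      using m unfolding std_mask_def map_append by (subst select_append) auto
    then show ?thesis using m by (simp add: select_std_mask)
  qed
  finally show "?b \<circ> sorter m = \<tau>"
    using b \<tau> sorter_Sym by (intro move_list_inj[of ?xs]) (auto intro: comp_Sym)
qed

text \<open>The subset that \<open>\<tau>\<close> moves to the front; the cosets of \<open>Sym j \<times> Sym k\<close> in \<open>Sym (j + k)\<close> correspond to these
subsets.\<close>

definition sorted_mask :: "nat \<Rightarrow> nat \<Rightarrow> (nat \<Rightarrow> nat) \<Rightarrow> bool list" where
  "sorted_mask j k \<tau> = move_list (inv \<tau>) (std_mask j k)"

lemma sorted_mask:
  assumes "\<tau> \<in> Sym (j + k)"
  shows "length (sorted_mask j k \<tau>) = j + k" "move_list \<tau> (sorted_mask j k \<tau>) = std_mask j k"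
    "weight (sorted_mask j k \<tau>) = j"
proof -
  have \<tau>: "\<tau> \<in> Sym (length (std_mask j k))" using assms by simp
  show "length (sorted_mask j k \<tau>) = j + k" "move_list \<tau> (sorted_mask j k \<tau>) = std_mask j k"
    using move_list_inv[OF \<tau>] by (simp_all add: sorted_mask_def)
  show "weight (sorted_mask j k \<tau>) = j"
    using weight_move_list[OF inv_Sym[OF \<tau>]] by (simp add: sorted_mask_def)
qed

lemma sorted_mask_eqI: "\<tau> \<in> Sym (length m) \<Longrightarrow> move_list \<tau> m = std_mask j k \<Longrightarrow> sorted_mask j k \<tau> = m"
  by (metis move_list_inv(2) sorted_mask_def)

section \<open>Operads of sets and masked elements\<close>

text \<open>May's axioms for an operad of sets.  The operations of all arities are collected in one set \<open>E\<close>, and \<open>ar\<close>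
gives their arity, so that the operations to be inserted into \<open>x\<close> form a plain list.\<close>

locale set_operad =
  fixes E :: "'e set" and ar :: "'e \<Rightarrow> nat" and one :: 'e
    and graft :: "'e \<Rightarrow> 'e list \<Rightarrow> 'e" and act :: "(nat \<Rightarrow> nat) \<Rightarrow> 'e \<Rightarrow> 'e"
  assumes one_closed: "one \<in> E" and ar_one: "ar one = 1"
    and graft_closed: "x \<in> E \<Longrightarrow> set ys \<subseteq> E \<Longrightarrow> length ys = ar x \<Longrightarrow> graft x ys \<in> E"
    and ar_graft: "x \<in> E \<Longrightarrow> set ys \<subseteq> E \<Longrightarrow> length ys = ar x \<Longrightarrow> ar (graft x ys) = sum_list (map ar ys)"
    and act_closed: "x \<in> E \<Longrightarrow> \<sigma> \<in> Sym (ar x) \<Longrightarrow> act \<sigma> x \<in> E"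
    and ar_act: "x \<in> E \<Longrightarrow> \<sigma> \<in> Sym (ar x) \<Longrightarrow> ar (act \<sigma> x) = ar x"
    and graft_assoc: "x \<in> E \<Longrightarrow> set ys \<subseteq> E \<Longrightarrow> set (concat zss) \<subseteq> E \<Longrightarrow> length ys = ar x \<Longrightarrow>
      map length zss = map ar ys \<Longrightarrow> graft (graft x ys) (concat zss) = graft x (map2 graft ys zss)"
    and graft_one_left: "x \<in> E \<Longrightarrow> graft one [x] = x"
    and graft_one_right: "x \<in> E \<Longrightarrow> graft x (replicate (ar x) one) = x"
    and graft_act_outer: "x \<in> E \<Longrightarrow> set ys \<subseteq> E \<Longrightarrow> length ys = ar x \<Longrightarrow> \<sigma> \<in> Sym (ar x) \<Longrightarrow>
      graft (act \<sigma> x) ys = act (block_perm \<sigma> (map ar ys)) (graft x (move_list \<sigma> ys))"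
    and graft_act_inner: "x \<in> E \<Longrightarrow> set ys \<subseteq> E \<Longrightarrow> length ys = ar x \<Longrightarrow> length \<tau>s = length ys \<Longrightarrow>
      (\<And>i. i < length ys \<Longrightarrow> \<tau>s ! i \<in> Sym (ar (ys ! i))) \<Longrightarrow>
      graft x (map2 act \<tau>s ys) = act (block_sum (map ar ys) \<tau>s) (graft x ys)"
begin

text \<open>The operations of the Day convolution with the commutativity operad: an operation whose inputs correspond
to the elements of a subset.\<close>

definition mask_set :: "(bool list \<times> 'e) set" where
  "mask_set = {p. snd p \<in> E \<and> ar (snd p) = weight (fst p)}"

definition mask_ar :: "bool list \<times> 'e \<Rightarrow> nat" where
  "mask_ar p = length (fst p)"

definition mask_one :: "bool list \<times> 'e" where
  "mask_one = ([True], one)"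

text \<open>Operations inserted at a place outside the subset of \<open>p\<close> are forgotten.\<close>

definition mask_graft :: "bool list \<times> 'e \<Rightarrow> (bool list \<times> 'e) list \<Rightarrow> bool list \<times> 'e" where
  "mask_graft p qs = (mask_comp (fst p) (map fst qs), graft (snd p) (select (fst p) (map snd qs)))"

text \<open>The action is from the right, so it replaces a subset by its preimage.\<close>

definition mask_act :: "(nat \<Rightarrow> nat) \<Rightarrow> bool list \<times> 'e \<Rightarrow> bool list \<times> 'e" where
  "mask_act \<sigma> p = (let m = move_list (inv \<sigma>) (fst p) in (m, act (restrict_perm \<sigma> m) (snd p)))"

lemma mask_act_move:
  "\<sigma> \<in> Sym (length m) \<Longrightarrow> mask_act \<sigma> (move_list \<sigma> m, x) = (m, act (restrict_perm \<sigma> m) x)"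
  by (simp add: mask_act_def move_list_inv)

lemma mask_select:
  assumes "length qs = length m" "set qs \<subseteq> mask_set"
  shows "set (select m (map snd qs)) \<subseteq> E"
    and "map ar (select m (map snd qs)) = select m (map weight (map fst qs))"
proof -
  show "set (select m (map snd qs)) \<subseteq> E"
    using set_select[of m "map snd qs"] assms(2) by (auto simp: mask_set_def)
  have "map ar (map snd qs) = map weight (map fst qs)"
    using assms(2) by (auto simp: mask_set_def)
  then show "map ar (select m (map snd qs)) = select m (map weight (map fst qs))"
    by (simp only: map_select)
qed

text \<open>Both sides insert exactly those operations of \<open>rss\<close> that are selected in \<open>qs\<close> inside a block selected in
\<open>p\<close>; on them the associativity of the given operad applies.\<close>

lemma mask_graft_assoc:
  assumes p: "p \<in> mask_set" and qs: "set qs \<subseteq> mask_set" and rss: "set (concat rss) \<subseteq> mask_set"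
    and l: "length qs = mask_ar p" and lr: "map length rss = map mask_ar qs"
  shows "mask_graft (mask_graft p qs) (concat rss) = mask_graft p (map2 mask_graft qs rss)"
proof -
  obtain m x where px: "p = (m, x)" by (cases p)
  define ms ys where "ms = map fst qs" and "ys = map snd qs"
  define mss yss where "mss = map (map fst) rss" and "yss = map (map snd) rss"
  have x: "x \<in> E" "ar x = weight m" using p px by (auto simp: mask_set_def)
  have len: "length ms = length m" "length ys = length m" "length mss = length m" "length yss = length m"
    using l map_eq_imp_length_eq[OF lr] by (auto simp: px mask_ar_def ms_def ys_def mss_def yss_def)
  have lms: "map length ms = map length mss" "map length ms = map length yss"
    using lr by (simp_all add: ms_def mss_def yss_def mask_ar_def comp_def)
  have c: "map fst (concat rss) = concat mss" "map snd (concat rss) = concat yss"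
    by (simp_all add: mss_def yss_def map_concat)
  let ?zss = "select m (map2 select ms yss)"
  have sz: "select (mask_comp m ms) (concat yss) = concat ?zss"
    by (rule select_mask_comp) (use len lms in auto)
  have "graft (graft x (select m ys)) (concat ?zss) = graft x (map2 graft (select m ys) ?zss)"
  proof (rule graft_assoc)
    show "x \<in> E" by fact
    show "set (select m ys) \<subseteq> E" unfolding ys_def by (rule mask_select[OF _ qs]) (use l in \<open>simp add: px mask_ar_def\<close>)
    show "set (concat ?zss) \<subseteq> E"
    proof -
      have "set (concat yss) \<subseteq> E" unfolding c(2)[symmetric] using rss by (auto simp: mask_set_def)
      then show ?thesis using set_select[of "mask_comp m ms" "concat yss"] unfolding sz by (rule order_trans[rotated])
    qed
    show "length (select m ys) = ar x" using len x by simp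
    have "map length (map2 select ms yss) = map weight ms"
    proof (rule nth_equalityI)
      fix i assume "i < length (map length (map2 select ms yss))"
      then have i: "i < length m" using len by simp
      then have "length (ms ! i) = length (yss ! i)" using lms(2) len by (metis nth_map)
      then show "map length (map2 select ms yss) ! i = map weight ms ! i" using i len by simp
    qed (use len in simp)
    then show "map length ?zss = map ar (select m ys)"
      using mask_select(2)[OF _ qs, of m] l by (simp add: map_select px mask_ar_def ms_def ys_def)
  qed
  also have "map2 graft (select m ys) ?zss = select m (map2 graft ys (map2 select ms yss))"
    using len by (intro map2_select) auto
  also have "map2 graft ys (map2 select ms yss) = map snd (map2 mask_graft qs rss)"
    by (rule nth_equalityI) (auto simp: ys_def ms_def yss_def mask_graft_def)
  finally have 2: "graft (graft x (select m ys)) (select (mask_comp m ms) (concat yss)) =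
      graft x (select m (map snd (map2 mask_graft qs rss)))" unfolding sz .
  have "map fst (map2 mask_graft qs rss) = map2 mask_comp ms mss"
    by (rule nth_equalityI) (auto simp: ms_def mss_def mask_graft_def)
  then have 1: "mask_comp (mask_comp m ms) (concat mss) = mask_comp m (map fst (map2 mask_graft qs rss))"
    using mask_comp_assoc[of m ms mss] len lms by simp
  show ?thesis using 1 2 unfolding mask_graft_def px c
    by (simp add: ms_def ys_def c del: map_concat)
qed

text \<open>The given operad is equivariant with respect to the permutation induced on the selected inputs, and
\<open>restrict_perm_block_perm\<close> says that restriction to subsets turns block permutations into block permutations.\<close>

lemma mask_graft_act_outer:
  assumes p: "p \<in> mask_set" and qs: "set qs \<subseteq> mask_set"
    and l: "length qs = mask_ar p" and \<sigma>: "\<sigma> \<in> Sym (mask_ar p)"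
  shows "mask_graft (mask_act \<sigma> p) qs = mask_act (block_perm \<sigma> (map mask_ar qs)) (mask_graft p (move_list \<sigma> qs))"
proof -
  obtain m x where m: "p = (move_list \<sigma> m, x)" "length m = mask_ar p"
    using move_list_inv(1)[of \<sigma> "fst p"] \<sigma> by (metis length_move_list mask_ar_def prod.collapse)
  define ms ys where "ms = map fst qs" and "ys = map snd qs"
  have \<sigma>m: "\<sigma> \<in> Sym (length m)" using \<sigma> m(2) by simp
  have len: "length ms = length m" "length ys = length m" using l m(2) by (simp_all add: ms_def ys_def)
  have x: "x \<in> E" "ar x = weight m" using p m weight_move_list[OF \<sigma>m] by (auto simp: mask_set_def)
  have mar: "map mask_ar qs = map length ms" by (simp add: ms_def mask_ar_def)
  have bp: "block_perm \<sigma> (map length ms) \<in> Sym (length (mask_comp m ms))"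
    using block_perm_Sym[of \<sigma> "map length ms"] \<sigma>m len by (simp add: length_mask_comp)
  have lq: "length qs = length m" using l m by simp
  have mv: "map fst (move_list \<sigma> qs) = move_list \<sigma> ms" "map snd (move_list \<sigma> qs) = move_list \<sigma> ys"
    unfolding ms_def ys_def by (rule map_move_list, use \<sigma>m lq in simp)+
  have "mask_graft (mask_act \<sigma> p) qs = (mask_comp m ms, graft (act (restrict_perm \<sigma> m) x) (select m ys))"
    using \<sigma>m by (simp add: m(1) mask_act_move mask_graft_def ms_def ys_def)
  also have "graft (act (restrict_perm \<sigma> m) x) (select m ys) =
      act (block_perm (restrict_perm \<sigma> m) (select m (map weight ms))) (graft x (move_list (restrict_perm \<sigma> m) (select m ys)))"
    using graft_act_outer[of x "select m ys" "restrict_perm \<sigma> m"] mask_select[OF lq qs] x len restrict_perm_Sym[OF \<sigma>m]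
    by (simp add: ms_def ys_def)
  also have "move_list (restrict_perm \<sigma> m) (select m ys) = select (move_list \<sigma> m) (move_list \<sigma> ys)"
    by (rule move_list_restrict_perm) (use \<sigma>m len in auto)
  also have "block_perm (restrict_perm \<sigma> m) (select m (map weight ms)) =
      restrict_perm (block_perm \<sigma> (map length ms)) (mask_comp m ms)"
    by (rule restrict_perm_block_perm[symmetric]) (use \<sigma>m len in auto)
  finally show ?thesis
    using mask_act_move[OF bp] mask_comp_block_perm[OF \<sigma>m len(1)]
    by (simp add: mask_graft_def m(1) mv mar)
qed

lemma mask_graft_act_inner:
  assumes p: "p \<in> mask_set" and qs: "set qs \<subseteq> mask_set"
    and l: "length qs = mask_ar p" "length \<tau>s = length qs"
    and \<tau>: "\<And>i. i < length qs \<Longrightarrow> \<tau>s ! i \<in> Sym (mask_ar (qs ! i))"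
  shows "mask_graft p (map2 mask_act \<tau>s qs) = mask_act (block_sum (map mask_ar qs) \<tau>s) (mask_graft p qs)"
proof -
  obtain m x where px: "p = (m, x)" by (cases p)
  have x: "x \<in> E" "ar x = weight m" using p px by (auto simp: mask_set_def)
  define ms ys where "ms = map2 (\<lambda>\<tau>. move_list (inv \<tau>)) \<tau>s (map fst qs)" and "ys = map snd qs"
  have lq: "length qs = length m" using l by (simp add: px mask_ar_def)
  have len: "length ms = length m" "length ys = length m" "length \<tau>s = length m"
    using l lq by (simp_all add: ms_def ys_def)
  have lms: "map mask_ar qs = map length ms"
    using l by (intro nth_equalityI) (auto simp: ms_def mask_ar_def)
  have \<tau>m: "\<tau>s ! i \<in> Sym (length (ms ! i))" if "i < length m" for i
    using \<tau>[of i] that lq l by (simp add: ms_def mask_ar_def)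
  have mv: "map fst qs = map2 move_list \<tau>s ms"
    using \<tau> l by (intro nth_equalityI) (auto simp: ms_def mask_ar_def move_list_inv)
  let ?rs = "map2 restrict_perm \<tau>s ms"
  have ma: "map2 mask_act \<tau>s qs = zip ms (map2 act ?rs ys)"
    using l by (intro nth_equalityI) (auto simp: ms_def ys_def mask_act_def Let_def)
  have w: "map weight (map fst qs) = map weight ms"
    using \<tau>m len lq unfolding mv by (intro nth_equalityI) (auto simp: weight_move_list)
  have bs: "block_sum (map length ms) \<tau>s \<in> Sym (length (mask_comp m ms))"
    using block_sum_Sym[of \<tau>s "map length ms"] \<tau>m len by (simp add: length_mask_comp)
  have "mask_graft p (map2 mask_act \<tau>s qs) = (mask_comp m ms, graft x (select m (map2 act ?rs ys)))"
    using len by (simp add: mask_graft_def px ma)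
  also have "select m (map2 act ?rs ys) = map2 act (select m ?rs) (select m ys)"
    by (rule map2_select[symmetric]) (use len in auto)
  also have "graft x \<dots> = act (block_sum (select m (map weight ms)) (select m ?rs)) (graft x (select m ys))"
  proof -
    have ri: "select m ?rs ! i \<in> Sym (ar (select m ys ! i))" if "i < length (select m ys)" for i
    proof -
      have z: "zip (select m ?rs) (select m ys) = select m (zip ?rs ys)"
        using map2_select[of ?rs m ys Pair] len by simp
      have li: "i < length (select m ?rs)" "i < length (select m ys)" using that len by simp_all
      have "(select m ?rs ! i, select m ys ! i) \<in> set (zip (select m ?rs) (select m ys))"
        using nth_zip[OF li] li by (metis length_zip min_less_iff_conj nth_mem)
      then have "(select m ?rs ! i, select m ys ! i) \<in> set (zip ?rs ys)" unfolding z using set_select by (rule subsetD[rotated])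
      then obtain k where k: "k < length (zip ?rs ys)" "zip ?rs ys ! k = (select m ?rs ! i, select m ys ! i)"
        by (metis in_set_conv_nth)
      then have "select m ?rs ! i = restrict_perm (\<tau>s ! k) (ms ! k)" "select m ys ! i = snd (qs ! k)" "k < length m"
        using len lq by (auto simp: ys_def)
      moreover have "ar (snd (qs ! k)) = weight (ms ! k)"
      proof -
        have "qs ! k \<in> mask_set" using qs \<open>k < length m\<close> lq by (metis nth_mem subsetD)
        then have "ar (snd (qs ! k)) = weight (fst (qs ! k))" by (simp add: mask_set_def)
        also have "\<dots> = map weight (map fst qs) ! k" using \<open>k < length m\<close> lq by simp
        also have "\<dots> = weight (ms ! k)" unfolding w using \<open>k < length m\<close> len by simp
        finally show ?thesis .
      qed
      ultimately show ?thesis using restrict_perm_Sym[OF \<tau>m] by simp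
    qed
    show ?thesis
      using graft_act_inner[of x "select m ys" "select m ?rs"] mask_select[OF lq qs] x len ri w
      by (simp add: ys_def)
  qed
  also have "block_sum (select m (map weight ms)) (select m ?rs) = restrict_perm (block_sum (map length ms) \<tau>s) (mask_comp m ms)"
    by (rule restrict_perm_block_sum[symmetric]) (use \<tau>m len in auto)
  finally show ?thesis
    using mask_act_move[OF bs] mask_comp_block_sum[of ms m \<tau>s] \<tau>m len
    by (simp add: mask_graft_def px mv lms ys_def)
qed

theorem mask_operad: "set_operad mask_set mask_ar mask_one mask_graft mask_act"
proof
  show "mask_one \<in> mask_set" "mask_ar mask_one = 1"
    by (simp_all add: mask_one_def mask_set_def mask_ar_def one_closed ar_one)
  fix p qs assume p: "p \<in> mask_set" and qs: "set qs \<subseteq> mask_set" and l: "length qs = mask_ar p"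
  have lp: "length (fst p) = length (map fst qs)" "length qs = length (fst p)" using l by (simp_all add: mask_ar_def)
  have "map mask_ar qs = map length (map fst qs)" by (simp add: mask_ar_def)
  then show "mask_ar (mask_graft p qs) = sum_list (map mask_ar qs)"
    using length_mask_comp[OF lp(1)] by (simp add: mask_graft_def mask_ar_def del: map_map)
  show "mask_graft p qs \<in> mask_set"
  proof -
    let ?ys = "select (fst p) (map snd qs)"
    have x: "snd p \<in> E" "ar (snd p) = weight (fst p)" using p by (simp_all add: mask_set_def)
    have "length ?ys = ar (snd p)" using lp x by simp
    note y = x(1) mask_select(1)[OF lp(2) qs] this
    show ?thesis
      using graft_closed[OF y] ar_graft[OF y] mask_select(2)[OF lp(2) qs] weight_mask_comp[OF lp(1)]
      by (simp only: mask_set_def mask_graft_def mem_Collect_eq fst_conv snd_conv simp_thms)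
  qed
next
  fix p \<sigma> assume p: "p \<in> mask_set" and \<sigma>: "\<sigma> \<in> Sym (mask_ar p)"
  obtain m x where m: "p = (move_list \<sigma> m, x)" "length m = mask_ar p"
    using move_list_inv(1)[of \<sigma> "fst p"] \<sigma> by (metis length_move_list mask_ar_def prod.collapse)
  have \<sigma>m: "\<sigma> \<in> Sym (length m)" using \<sigma> m(2) by simp
  show "mask_act \<sigma> p \<in> mask_set" "mask_ar (mask_act \<sigma> p) = mask_ar p"
    using p restrict_perm_Sym[OF \<sigma>m] act_closed ar_act
    by (auto simp: m(1) mask_act_move[OF \<sigma>m] mask_set_def weight_move_list[OF \<sigma>m] mask_ar_def)
next
  fix p assume p: "p \<in> mask_set"
  show "mask_graft mask_one [p] = p"
    using p by (simp add: mask_graft_def mask_one_def graft_one_left mask_set_def)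
  have "select m (replicate k one) = replicate (weight m) one" if "length m = k" for m k
    using that by (induction m arbitrary: k) auto
  then show "mask_graft p (replicate (mask_ar p) mask_one) = p"
    using p graft_one_right[of "snd p"] mask_comp_unit[of "fst p"]
    by (simp add: mask_graft_def mask_one_def mask_set_def mask_ar_def)
qed (rule mask_graft_assoc mask_graft_act_outer mask_graft_act_inner; assumption)+

end

section \<open>Coproducts and products\<close>

context category
begin

lemma hom_Ob: "f \<in> hom V X Y \<Longrightarrow> X \<in> Ob V" "f \<in> hom V X Y \<Longrightarrow> Y \<in> Ob V"
  by (auto simp: hom_def Dom_Ob Cod_Ob)

lemma coproduct_hom: "is_coproduct V I X Q \<iota> \<Longrightarrow> i \<in> I \<Longrightarrow> \<iota> i \<in> hom V (X i) Q"
  by (simp add: is_coproduct_def)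

lemma coproduct_eqI:
  assumes "is_coproduct V I X Q \<iota>" "f \<in> hom V Q Y" "g \<in> hom V Q Y"
    and "\<And>i. i \<in> I \<Longrightarrow> f \<cdot> \<iota> i = g \<cdot> \<iota> i"
  shows "f = g"
proof -
  have "\<forall>i\<in>I. f \<cdot> \<iota> i \<in> hom V (X i) Y"
    using assms(1,2) Comp_hom coproduct_hom by metis
  then have "\<exists>!u. u \<in> hom V Q Y \<and> (\<forall>i\<in>I. u \<cdot> \<iota> i = f \<cdot> \<iota> i)"
    using assms(1) hom_Ob(2)[OF assms(2)] unfolding is_coproduct_def by simp
  then obtain w where "\<And>u. u \<in> hom V Q Y \<and> (\<forall>i\<in>I. u \<cdot> \<iota> i = f \<cdot> \<iota> i) \<Longrightarrow> u = w" by blast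
  from this[of f] this[of g] show ?thesis using assms(2-4) by simp
qed

lemma coproduct_cong:
  "is_coproduct V I X Q \<iota> \<Longrightarrow> (\<And>i. i \<in> I \<Longrightarrow> X i = X' i) \<Longrightarrow> (\<And>i. i \<in> I \<Longrightarrow> \<iota> i = \<iota>' i) \<Longrightarrow>
   is_coproduct V I X' Q \<iota>'"
  unfolding is_coproduct_def by (simp cong: ball_cong)

lemma coproduct_exists:
  assumes "is_coproduct V I X Q \<iota>" "Y \<in> Ob V" "\<And>i. i \<in> I \<Longrightarrow> z i \<in> hom V (X i) Y"
  obtains u where "u \<in> hom V Q Y" "\<And>i. i \<in> I \<Longrightarrow> u \<cdot> \<iota> i = z i"
proof -
  have "\<exists>!u. u \<in> hom V Q Y \<and> (\<forall>i\<in>I. u \<cdot> \<iota> i = z i)"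
    using assms unfolding is_coproduct_def by blast
  then show ?thesis using that by blast
qed

lemma is_coproductI:
  assumes "Q \<in> Ob V" "\<And>i. i \<in> I \<Longrightarrow> \<iota> i \<in> hom V (X i) Q"
    and "\<And>Z z. Z \<in> Ob V \<Longrightarrow> (\<And>i. i \<in> I \<Longrightarrow> z i \<in> hom V (X i) Z) \<Longrightarrow>
      \<exists>u \<in> hom V Q Z. \<forall>i\<in>I. u \<cdot> \<iota> i = z i"
    and "\<And>Z u v. u \<in> hom V Q Z \<Longrightarrow> v \<in> hom V Q Z \<Longrightarrow> (\<And>i. i \<in> I \<Longrightarrow> u \<cdot> \<iota> i = v \<cdot> \<iota> i) \<Longrightarrow> u = v"
  shows "is_coproduct V I X Q \<iota>"
  unfolding is_coproduct_def
proof (intro conjI ballI allI impI)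
  fix Z z assume "Z \<in> Ob V" "\<forall>i\<in>I. z i \<in> hom V (X i) Z"
  then obtain u where "u \<in> hom V Q Z" "\<forall>i\<in>I. u \<cdot> \<iota> i = z i" using assms(3) by metis
  then show "\<exists>!u. u \<in> hom V Q Z \<and> (\<forall>i\<in>I. u \<cdot> \<iota> i = z i)"
    by (intro ex1I[of _ u]) (auto intro: assms(4))
qed (use assms in auto)

text \<open>Yoneda's lemma allows one to compare morphisms on the summands by their effect on generalized elements
\<open>c : Z \<rightarrow> X i\<close>.\<close>

lemma coproduct_elements_eqI:
  assumes "is_coproduct V I X Q \<iota>" "f \<in> hom V Q Y" "g \<in> hom V Q Y"
    and "\<And>i Z c. i \<in> I \<Longrightarrow> c \<in> hom V Z (X i) \<Longrightarrow> f \<cdot> (\<iota> i \<cdot> c) = g \<cdot> (\<iota> i \<cdot> c)"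
  shows "f = g"
proof (rule coproduct_eqI[OF assms(1-3)])
  fix i assume i: "i \<in> I"
  note h = coproduct_hom[OF assms(1) i]
  from assms(4)[OF i Ident_hom[OF hom_Ob(1)[OF h]]] show "f \<cdot> \<iota> i = g \<cdot> \<iota> i"
    by (simp add: Comp_Ident_right[OF h])
qed

text \<open>A coproduct is a colimit over a discrete category.  A finite index set can be renamed into the universe
because an infinite type has finite subsets of every cardinality.\<close>

lemma finite_coproduct_exists:
  fixes I :: "'i set"
  assumes coc: "cocomplete_category TYPE('u::infinite) V" and fin: "finite I"
    and X: "\<And>i. i \<in> I \<Longrightarrow> X i \<in> Ob V"
  obtains Q \<iota> where "is_coproduct V I X Q \<iota>"
proof -
  obtain A :: "'u set" where A: "finite A" "card A = card I"
    using infinite_arbitrarily_large[OF infinite_UNIV] by metis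
  then obtain e where e: "bij_betw e I A" using fin by (metis finite_same_card_bij)
  define d where "d = inv_into I e"
  have de: "d (e i) = i" if "i \<in> I" for i using that e by (simp add: d_def bij_betw_inv_into_left)
  have eA: "e i \<in> A" if "i \<in> I" for i using that e bij_betwE by metis
  have dA: "d a \<in> I" if "a \<in> A" for a
    using that e unfolding d_def by (metis bij_betw_imp_surj_on inv_into_into)
  have ed: "e (d a) = a" if "a \<in> A" for a
    using that e by (simp add: d_def bij_betw_inv_into_right)
  define J :: "('u, 'u) cat" where
    "J = \<lparr>Ob = A, Mor = A, Dom = (\<lambda>a. a), Cod = (\<lambda>a. a), Ident = (\<lambda>a. a), Comp = (\<lambda>b a. a)\<rparr>"
  define F where "F = \<lparr>fob = (\<lambda>a. X (d a)), fmor = (\<lambda>a. Ident V (X (d a)))\<rparr>"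
  have "category J" by unfold_locales (auto simp: J_def hom_def)
  moreover have "A \<prec> (UNIV :: 'u set)" using A(1) infinite_UNIV by (rule finite_lesspoll_infinite[rotated])
  ultimately have "small_category J" by (simp add: small_category_def J_def)
  moreover have "is_functor J V F"
    using X dA by (auto simp: is_functor_def J_def F_def Ident_hom Comp_Ident_left[OF Ident_hom])
  ultimately obtain Q p where "is_colimit J V F Q p"
    using coc unfolding cocomplete_category_def by blast
  then have Q: "is_cocone J V F Q p"
    and univ: "\<And>Z q. is_cocone J V F Z q \<Longrightarrow> \<exists>!u. u \<in> hom V Q Z \<and> (\<forall>a\<in>A. u \<cdot> p a = q a)"
    by (simp_all add: is_colimit_def J_def)
  have cocone: "is_cocone J V F Z q \<longleftrightarrow> Z \<in> Ob V \<and> (\<forall>a\<in>A. q a \<in> hom V (X (d a)) Z)" for Z q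
    by (auto simp: is_cocone_def J_def F_def intro: Comp_Ident_right)
  have "is_coproduct V I X Q (\<lambda>i. p (e i))"
  proof (rule is_coproductI)
    show "Q \<in> Ob V" using Q cocone by blast
    show "p (e i) \<in> hom V (X i) Q" if "i \<in> I" for i using Q that cocone eA de by metis
    fix Z
    {
      fix z assume "Z \<in> Ob V" and z: "\<And>i. i \<in> I \<Longrightarrow> z i \<in> hom V (X i) Z"
      then have "is_cocone J V F Z (\<lambda>a. z (d a))" using cocone dA by blast
      from univ[OF this] show "\<exists>u\<in>hom V Q Z. \<forall>i\<in>I. u \<cdot> p (e i) = z i" using eA de by metis
    next
      fix u v assume uv: "u \<in> hom V Q Z" "v \<in> hom V Q Z" "\<And>i. i \<in> I \<Longrightarrow> u \<cdot> p (e i) = v \<cdot> p (e i)"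
      have "is_cocone J V F Z (\<lambda>a. u \<cdot> p a)"
        unfolding cocone using uv(1) hom_Ob Q[unfolded cocone] Comp_hom by metis
      from univ[OF this] uv show "u = v" using dA ed by metis
    }
  qed
  then show ?thesis by (rule that)
qed

end

context cartesian_monoidal_category
begin

lemma to_unit_hom: "X \<in> Ob V \<Longrightarrow> to_unit V X \<in> hom V X \<I>"
  unfolding to_unit_def by (rule theI'[OF UnitOb_terminal])

lemma to_unit_unique: "f \<in> hom V X \<I> \<Longrightarrow> f = to_unit V X"
  using UnitOb_terminal to_unit_hom hom_Ob by metis

lemma pairing_props:
  assumes "f \<in> hom V Z X" "g \<in> hom V Z Y"
  shows "pairing V f g \<in> hom V Z (X \<otimes> Y) \<and> Pr1 V X Y \<cdot> pairing V f g = f \<and> Pr2 V X Y \<cdot> pairing V f g = g"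
proof -
  have "Dom V f = Z" "Cod V f = X" "Cod V g = Y" using assms by (auto simp: hom_def)
  then show ?thesis unfolding pairing_def using theI'[OF Tens_universal[OF assms]] by simp
qed

lemma pairing_hom: "f \<in> hom V Z X \<Longrightarrow> g \<in> hom V Z Y \<Longrightarrow> pairing V f g \<in> hom V Z (X \<otimes> Y)"
  and Pr1_pairing: "f \<in> hom V Z X \<Longrightarrow> g \<in> hom V Z Y \<Longrightarrow> Pr1 V X Y \<cdot> pairing V f g = f"
  and Pr2_pairing: "f \<in> hom V Z X \<Longrightarrow> g \<in> hom V Z Y \<Longrightarrow> Pr2 V X Y \<cdot> pairing V f g = g"
  using pairing_props by blast+

lemma tens_eqI:
  assumes "h \<in> hom V Z (X \<otimes> Y)" "k \<in> hom V Z (X \<otimes> Y)" "X \<in> Ob V" "Y \<in> Ob V"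
    and "Pr1 V X Y \<cdot> h = Pr1 V X Y \<cdot> k" "Pr2 V X Y \<cdot> h = Pr2 V X Y \<cdot> k"
  shows "h = k"
  using Tens_universal[OF Comp_hom[OF assms(1) Pr1_hom[OF assms(3,4)]] Comp_hom[OF assms(1) Pr2_hom[OF assms(3,4)]]]
    assms by metis

lemma pairing_eta:
  assumes "h \<in> hom V Z (X \<otimes> Y)" "X \<in> Ob V" "Y \<in> Ob V"
  obtains f g where "f \<in> hom V Z X" "g \<in> hom V Z Y" "h = pairing V f g"
proof -
  have f: "Pr1 V X Y \<cdot> h \<in> hom V Z X" "Pr2 V X Y \<cdot> h \<in> hom V Z Y"
    using assms Comp_hom Pr1_hom Pr2_hom by blast+
  moreover have "h = pairing V (Pr1 V X Y \<cdot> h) (Pr2 V X Y \<cdot> h)"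
    using f by (intro tens_eqI[OF assms(1) _ assms(2,3)]) (simp_all add: pairing_hom Pr1_pairing Pr2_pairing)
  ultimately show ?thesis using that by blast
qed

lemma pairing_comp:
  assumes "f \<in> hom V Z X" "g \<in> hom V Z Y" "u \<in> hom V W Z"
  shows "pairing V f g \<cdot> u = pairing V (f \<cdot> u) (g \<cdot> u)"
proof (rule tens_eqI)
  show o: "X \<in> Ob V" "Y \<in> Ob V" using assms hom_Ob by blast+
  have fu: "f \<cdot> u \<in> hom V W X" "g \<cdot> u \<in> hom V W Y" using assms Comp_hom by blast+
  show "pairing V f g \<cdot> u \<in> hom V W (X \<otimes> Y)" "pairing V (f \<cdot> u) (g \<cdot> u) \<in> hom V W (X \<otimes> Y)"
    using assms fu by (auto intro: Comp_hom pairing_hom)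
  show "Pr1 V X Y \<cdot> (pairing V f g \<cdot> u) = Pr1 V X Y \<cdot> pairing V (f \<cdot> u) (g \<cdot> u)"
    "Pr2 V X Y \<cdot> (pairing V f g \<cdot> u) = Pr2 V X Y \<cdot> pairing V (f \<cdot> u) (g \<cdot> u)"
    using assms fu pairing_hom[OF assms(1,2)]
    by (simp_all add: Pr1_pairing Pr2_pairing
        Comp_assoc[OF assms(3) pairing_hom[OF assms(1,2)] Pr1_hom[OF o], symmetric]
        Comp_assoc[OF assms(3) pairing_hom[OF assms(1,2)] Pr2_hom[OF o], symmetric])
qed

lemma tens_mor_hom:
  assumes "f \<in> hom V X X'" "g \<in> hom V Y Y'"
  shows "tens_mor V f g \<in> hom V (X \<otimes> Y) (X' \<otimes> Y')"
proof -
  have "Dom V f = X" "Dom V g = Y" using assms by (auto simp: hom_def)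
  moreover have "X \<in> Ob V" "Y \<in> Ob V" using assms hom_Ob by blast+
  ultimately show ?thesis
    using Comp_hom[OF Pr1_hom assms(1)] Comp_hom[OF Pr2_hom assms(2)] by (simp add: tens_mor_def pairing_hom)
qed

lemma tens_mor_pairing:
  assumes "f \<in> hom V X X'" "g \<in> hom V Y Y'" "a \<in> hom V Z X" "b \<in> hom V Z Y"
  shows "tens_mor V f g \<cdot> pairing V a b = pairing V (f \<cdot> a) (g \<cdot> b)"
proof -
  have d: "Dom V f = X" "Dom V g = Y" using assms by (auto simp: hom_def)
  have o: "X \<in> Ob V" "Y \<in> Ob V" using assms hom_Ob by blast+
  note p = pairing_hom[OF assms(3,4)]
  show ?thesis
    using pairing_comp[OF Comp_hom[OF Pr1_hom[OF o] assms(1)] Comp_hom[OF Pr2_hom[OF o] assms(2)] p]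
      Comp_assoc[OF p Pr1_hom[OF o] assms(1)] Comp_assoc[OF p Pr2_hom[OF o] assms(2)] assms
    by (simp add: tens_mor_def d Pr1_pairing Pr2_pairing)
qed

text \<open>Yoneda's lemma once more: the generic element is the identity, a pair of projections.\<close>

lemma tens_elements_eqI:
  assumes "f \<in> hom V (X \<otimes> Y) W" "g \<in> hom V (X \<otimes> Y) W" "X \<in> Ob V" "Y \<in> Ob V"
    and "\<And>Z a b. a \<in> hom V Z X \<Longrightarrow> b \<in> hom V Z Y \<Longrightarrow> f \<cdot> pairing V a b = g \<cdot> pairing V a b"
  shows "f = g"
proof -
  obtain a b where ab: "a \<in> hom V (X \<otimes> Y) X" "b \<in> hom V (X \<otimes> Y) Y" "Ident V (X \<otimes> Y) = pairing V a b"
    using pairing_eta[OF Ident_hom[OF Tens_Ob[OF assms(3,4)]] assms(3,4)] by metis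
  then show ?thesis using assms Comp_Ident_right by metis
qed

lemma tens_mor_comp:
  assumes "f' \<in> hom V X X'" "g' \<in> hom V Y Y'" "f \<in> hom V X' X''" "g \<in> hom V Y' Y''"
  shows "tens_mor V f g \<cdot> tens_mor V f' g' = tens_mor V (f \<cdot> f') (g \<cdot> g')"
proof (rule tens_elements_eqI)
  show o: "X \<in> Ob V" "Y \<in> Ob V" using assms hom_Ob by blast+
  note h = tens_mor_hom[OF assms(1,2)] tens_mor_hom[OF assms(3,4)] Comp_hom[OF assms(1,3)] Comp_hom[OF assms(2,4)]
  show "tens_mor V f g \<cdot> tens_mor V f' g' \<in> hom V (X \<otimes> Y) (X'' \<otimes> Y'')"
    "tens_mor V (f \<cdot> f') (g \<cdot> g') \<in> hom V (X \<otimes> Y) (X'' \<otimes> Y'')"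
    using h by (auto intro: Comp_hom tens_mor_hom)
  fix Z a b assume ab: "a \<in> hom V Z X" "b \<in> hom V Z Y"
  show "(tens_mor V f g \<cdot> tens_mor V f' g') \<cdot> pairing V a b = tens_mor V (f \<cdot> f') (g \<cdot> g') \<cdot> pairing V a b"
    unfolding Comp_assoc[OF pairing_hom[OF ab] h(1,2)] tens_mor_pairing[OF assms(1,2) ab]
      tens_mor_pairing[OF h(3,4) ab]
      tens_mor_pairing[OF assms(3,4) Comp_hom[OF ab(1) assms(1)] Comp_hom[OF ab(2) assms(2)]]
      Comp_assoc[OF ab(1) assms(1,3)] Comp_assoc[OF ab(2) assms(2,4)] ..
qed

lemma tens_list_Ob: "set Xs \<subseteq> Ob V \<Longrightarrow> tens_list V Xs \<in> Ob V"
  by (induction Xs) (auto simp: UnitOb_Ob Tens_Ob)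

abbreviation elements :: "'o \<Rightarrow> 'm list \<Rightarrow> 'o list \<Rightarrow> bool" where
  "elements Z fs Xs \<equiv> list_all2 (\<lambda>f X. f \<in> hom V Z X) fs Xs"

lemma tuple_list_hom: "elements Z fs Xs \<Longrightarrow> Z \<in> Ob V \<Longrightarrow> tuple_list V Z fs \<in> hom V Z (tens_list V Xs)"
  by (induction fs Xs rule: list_all2_induct) (auto simp: to_unit_hom pairing_hom)

lemma elements_Ob: "elements Z fs Xs \<Longrightarrow> set Xs \<subseteq> Ob V"
  by (induction fs Xs rule: list_all2_induct) (auto dest: hom_Ob)

abbreviation tuple_of :: "'o \<Rightarrow> (nat \<times> 'm) list \<Rightarrow> 'm" where
  "tuple_of Z ys \<equiv> tuple_list V Z (map snd ys)"

lemma proj_list_hom: "set Xs \<subseteq> Ob V \<Longrightarrow> i < length Xs \<Longrightarrow> proj_list V Xs i \<in> hom V (tens_list V Xs) (Xs ! i)"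
proof (induction Xs arbitrary: i)
  case (Cons X Xs)
  then have "X \<in> Ob V" "tens_list V Xs \<in> Ob V" by (auto intro: tens_list_Ob)
  with Cons show ?case by (cases i) (auto intro: Pr1_hom Pr2_hom Comp_hom)
qed simp

lemma proj_list_tuple:
  "elements Z fs Xs \<Longrightarrow> Z \<in> Ob V \<Longrightarrow> i < length Xs \<Longrightarrow> proj_list V Xs i \<cdot> tuple_list V Z fs = fs ! i"
proof (induction fs Xs arbitrary: i rule: list_all2_induct)
  case (Cons f fs X Xs)
  have t: "tuple_list V Z fs \<in> hom V Z (tens_list V Xs)" using Cons tuple_list_hom by blast
  have o: "X \<in> Ob V" "tens_list V Xs \<in> Ob V" "set Xs \<subseteq> Ob V" using Cons t hom_Ob elements_Ob by blast+
  show ?case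
  proof (cases i)
    case 0
    then show ?thesis using Cons t by (simp add: Pr1_pairing)
  next
    case (Suc i')
    then show ?thesis
      using Cons t Comp_assoc[OF pairing_hom[OF Cons(1) t] Pr2_hom[OF o(1,2)] proj_list_hom[OF o(3)]]
      by (simp add: Pr2_pairing)
  qed
qed simp

lemma tuple_list_comp:
  "elements Z fs Xs \<Longrightarrow> u \<in> hom V W Z \<Longrightarrow> tuple_list V Z fs \<cdot> u = tuple_list V W (map (\<lambda>f. f \<cdot> u) fs)"
proof (induction fs Xs rule: list_all2_induct)
  case Nil
  then show ?case by (auto intro!: to_unit_unique Comp_hom to_unit_hom dest: hom_Ob)
next
  case (Cons f fs X Xs)
  then have "Z \<in> Ob V" by (auto dest: hom_Ob)
  with Cons pairing_comp[OF Cons(1) tuple_list_hom[OF Cons(2)] Cons(4)] show ?case by simp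
qed

lemma tuple_list_eta:
  assumes "h \<in> hom V Z (tens_list V Xs)" "set Xs \<subseteq> Ob V"
  obtains fs where "elements Z fs Xs" "h = tuple_list V Z fs"
  using assms
proof (induction Xs arbitrary: h thesis)
  case Nil
  then show ?case by (auto intro: Nil.prems(1)[of "[]"] to_unit_unique)
next
  case (Cons X Xs)
  have "h \<in> hom V Z (X \<otimes> tens_list V Xs)" "X \<in> Ob V" "tens_list V Xs \<in> Ob V"
    using Cons.prems tens_list_Ob by auto
  from pairing_eta[OF this] obtain f g where
    fg: "f \<in> hom V Z X" "g \<in> hom V Z (tens_list V Xs)" "h = pairing V f g" .
  obtain fs where "elements Z fs Xs" "g = tuple_list V Z fs" by (rule Cons.IH[OF _ fg(2)]) (use Cons.prems in auto)
  with fg show ?case by (intro Cons.prems(1)[of "f # fs"]) auto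
qed

lemma tens_mor_list_hom:
  "list_all2 (\<lambda>f (X, Y). f \<in> hom V X Y) fs (zip Xs Ys) \<Longrightarrow> length Xs = length Ys \<Longrightarrow>
   tens_mor_list V fs \<in> hom V (tens_list V Xs) (tens_list V Ys)"
proof (induction fs arbitrary: Xs Ys)
  case Nil
  then show ?case by (auto simp: Ident_hom UnitOb_Ob)
next
  case (Cons f fs)
  then obtain X Xs' Y Ys' where "Xs = X # Xs'" "Ys = Y # Ys'" by (cases Xs; cases Ys) auto
  with Cons show ?case by (auto intro!: tens_mor_hom)
qed

lemma tens_mor_list_tuple:
  assumes "list_all2 (\<lambda>f (X, Y). f \<in> hom V X Y) fs (zip Xs Ys)" "length Xs = length Ys"
    and "elements Z es Xs" "Z \<in> Ob V"
  shows "tens_mor_list V fs \<cdot> tuple_list V Z es = tuple_list V Z (map2 (\<lambda>f e. f \<cdot> e) fs es)"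
  using assms(1-3)
proof (induction fs arbitrary: Xs Ys es)
  case Nil
  then show ?case using assms(4) by (auto simp: Comp_Ident_left[OF to_unit_hom])
next
  case (Cons f fs)
  then obtain X Xs' Y Ys' where XY: "Xs = X # Xs'" "Ys = Y # Ys'" by (cases Xs; cases Ys) auto
  with Cons(4) obtain e es' where es: "es = e # es'" by (cases es) auto
  have "tuple_list V Z es' \<in> hom V Z (tens_list V Xs')" using Cons(4) XY es assms(4) by (auto intro: tuple_list_hom)
  moreover have "tens_mor_list V fs \<in> hom V (tens_list V Xs') (tens_list V Ys')"
    using Cons XY by (auto intro: tens_mor_list_hom)
  ultimately show ?case using Cons XY es
    by (auto simp: tens_mor_pairing)
qed

section \<open>Distributivity\<close>

text \<open>The functor \<open>- \<otimes> W\<close> preserves coproducts because it has a right adjoint: a family on the summands is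
transposed, extended to \<open>Q\<close>, and transposed back.\<close>

lemma coproduct_tens_right:
  assumes closed: "closed_category V" and Q: "is_coproduct V I X Q \<iota>" and W: "W \<in> Ob V"
  shows "is_coproduct V I (\<lambda>i. X i \<otimes> W) (Q \<otimes> W) (\<lambda>i. tens_mor V (\<iota> i) (Ident V W))"
proof (rule is_coproductI)
  note \<iota> = coproduct_hom[OF Q] and iW = Ident_hom[OF W]
  have QOb: "Q \<in> Ob V" using Q by (simp add: is_coproduct_def)
  then show "Q \<otimes> W \<in> Ob V" using W by (rule Tens_Ob)
  show inc: "tens_mor V (\<iota> i) (Ident V W) \<in> hom V (X i \<otimes> W) (Q \<otimes> W)" if "i \<in> I" for i
    by (rule tens_mor_hom[OF \<iota>[OF that] iW])
  have curry: "\<exists>E\<in>Ob V. \<exists>ev \<in> hom V (E \<otimes> W) Z. \<forall>X\<in>Ob V. \<forall>f \<in> hom V (X \<otimes> W) Z.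
      \<exists>!h. h \<in> hom V X E \<and> ev \<cdot> tens_mor V h (Ident V W) = f" if "Z \<in> Ob V" for Z
    using closed W that unfolding closed_category_def by blast
  have split: "(ev \<cdot> tens_mor V h (Ident V W)) \<cdot> tens_mor V (\<iota> i) (Ident V W) =
      ev \<cdot> tens_mor V (h \<cdot> \<iota> i) (Ident V W)"
    if "i \<in> I" "h \<in> hom V Q E" "ev \<in> hom V (E \<otimes> W) Z" for i h E ev Z
    using Comp_assoc[OF inc[OF that(1)] tens_mor_hom[OF that(2) iW] that(3)]
      tens_mor_comp[OF \<iota>[OF that(1)] iW that(2) iW] Comp_Ident_left[OF iW] by simp
  fix Z
  {
    fix z assume Z: "Z \<in> Ob V" and z: "\<And>i. i \<in> I \<Longrightarrow> z i \<in> hom V (X i \<otimes> W) Z"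
    obtain E ev where E: "E \<in> Ob V" "ev \<in> hom V (E \<otimes> W) Z"
      and h: "\<And>X f. X \<in> Ob V \<Longrightarrow> f \<in> hom V (X \<otimes> W) Z \<Longrightarrow>
        \<exists>!h. h \<in> hom V X E \<and> ev \<cdot> tens_mor V h (Ident V W) = f"
      using curry[OF Z] by blast
    have "\<forall>i\<in>I. \<exists>h. h \<in> hom V (X i) E \<and> ev \<cdot> tens_mor V h (Ident V W) = z i"
      using h z \<iota> hom_Ob(1) by metis
    then obtain k where k: "\<And>i. i \<in> I \<Longrightarrow> k i \<in> hom V (X i) E \<and> ev \<cdot> tens_mor V (k i) (Ident V W) = z i"
      by metis
    obtain u where u: "u \<in> hom V Q E" "\<And>i. i \<in> I \<Longrightarrow> u \<cdot> \<iota> i = k i"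
      using coproduct_exists[OF Q E(1)] k by metis
    show "\<exists>u\<in>hom V (Q \<otimes> W) Z. \<forall>i\<in>I. u \<cdot> tens_mor V (\<iota> i) (Ident V W) = z i"
    proof (intro bexI ballI)
      show "ev \<cdot> tens_mor V u (Ident V W) \<in> hom V (Q \<otimes> W) Z"
        using Comp_hom[OF tens_mor_hom[OF u(1) iW] E(2)] .
      show "(ev \<cdot> tens_mor V u (Ident V W)) \<cdot> tens_mor V (\<iota> i) (Ident V W) = z i" if "i \<in> I" for i
        using split[OF that u(1) E(2)] u(2)[OF that] k[OF that] by simp
    qed
  next
    fix u v assume u: "u \<in> hom V (Q \<otimes> W) Z" and v: "v \<in> hom V (Q \<otimes> W) Z"
      and uv: "\<And>i. i \<in> I \<Longrightarrow> u \<cdot> tens_mor V (\<iota> i) (Ident V W) = v \<cdot> tens_mor V (\<iota> i) (Ident V W)"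
    obtain E ev where E: "E \<in> Ob V" "ev \<in> hom V (E \<otimes> W) Z"
      and h: "\<And>X f. X \<in> Ob V \<Longrightarrow> f \<in> hom V (X \<otimes> W) Z \<Longrightarrow>
        \<exists>!h. h \<in> hom V X E \<and> ev \<cdot> tens_mor V h (Ident V W) = f"
      using curry[OF hom_Ob(2)[OF u]] by blast
    obtain a where a: "a \<in> hom V Q E" "ev \<cdot> tens_mor V a (Ident V W) = u" using h[OF QOb u] by blast
    obtain b where b: "b \<in> hom V Q E" "ev \<cdot> tens_mor V b (Ident V W) = v" using h[OF QOb v] by blast
    have "a = b"
    proof (rule coproduct_eqI[OF Q a(1) b(1)])
      fix i assume i: "i \<in> I"
      have eq: "ev \<cdot> tens_mor V (a \<cdot> \<iota> i) (Ident V W) = ev \<cdot> tens_mor V (b \<cdot> \<iota> i) (Ident V W)"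
        using uv[OF i] split[OF i a(1) E(2)] split[OF i b(1) E(2)] a(2) b(2) by simp
      have ai: "a \<cdot> \<iota> i \<in> hom V (X i) E" "b \<cdot> \<iota> i \<in> hom V (X i) E" using Comp_hom \<iota>[OF i] a(1) b(1) by blast+
      have "ev \<cdot> tens_mor V (a \<cdot> \<iota> i) (Ident V W) \<in> hom V (X i \<otimes> W) Z"
        using Comp_hom[OF tens_mor_hom[OF ai(1) iW] E(2)] .
      from h[OF hom_Ob(1)[OF \<iota>[OF i]] this] show "a \<cdot> \<iota> i = b \<cdot> \<iota> i"
        using ai eq by metis
    qed
    then show "u = v" using a b by simp
  }
qed

text \<open>This transports a coproduct along isomorphisms of all objects involved; it serves to exchange the two
factors of a product.\<close>

lemma coproduct_reindex_iso:
  assumes Q: "is_coproduct V I X Q \<iota>"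
    and s: "s \<in> hom V Q Q'" "s' \<in> hom V Q' Q" "s \<cdot> s' = Ident V Q'"
    and t: "\<And>i. i \<in> I \<Longrightarrow> t i \<in> hom V (X' i) (X i)" "\<And>i. i \<in> I \<Longrightarrow> t' i \<in> hom V (X i) (X' i)"
      "\<And>i. i \<in> I \<Longrightarrow> t' i \<cdot> t i = Ident V (X' i)"
    and \<iota>': "\<And>i. i \<in> I \<Longrightarrow> \<iota>' i \<in> hom V (X' i) Q'" "\<And>i. i \<in> I \<Longrightarrow> s' \<cdot> \<iota>' i = \<iota> i \<cdot> t i"
      "\<And>i. i \<in> I \<Longrightarrow> s \<cdot> \<iota> i = \<iota>' i \<cdot> t' i"
  shows "is_coproduct V I X' Q' \<iota>'"
proof (rule is_coproductI)
  note \<iota> = coproduct_hom[OF Q]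
  show "Q' \<in> Ob V" using s hom_Ob by blast
  show "\<And>i. i \<in> I \<Longrightarrow> \<iota>' i \<in> hom V (X' i) Q'" by (rule \<iota>')
  fix Z
  {
    fix z assume Z: "Z \<in> Ob V" and z: "\<And>i. i \<in> I \<Longrightarrow> z i \<in> hom V (X' i) Z"
    then have zt: "z i \<cdot> t' i \<in> hom V (X i) Z" if "i \<in> I" for i using t(2) that Comp_hom by blast
    then obtain u where u: "u \<in> hom V Q Z" "\<And>i. i \<in> I \<Longrightarrow> u \<cdot> \<iota> i = z i \<cdot> t' i"
      using coproduct_exists[OF Q Z, of "\<lambda>i. z i \<cdot> t' i"] by blast
    show "\<exists>u\<in>hom V Q' Z. \<forall>i\<in>I. u \<cdot> \<iota>' i = z i"
    proof (intro bexI ballI)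
      show "u \<cdot> s' \<in> hom V Q' Z" using Comp_hom s u by blast
      fix i assume i: "i \<in> I"
      have "(u \<cdot> s') \<cdot> \<iota>' i = u \<cdot> (s' \<cdot> \<iota>' i)" by (rule Comp_assoc[OF \<iota>'(1)[OF i] s(2) u(1)])
      also have "\<dots> = (u \<cdot> \<iota> i) \<cdot> t i" using \<iota>'(2)[OF i] Comp_assoc[OF t(1)[OF i] \<iota>[OF i] u(1)] by simp
      also have "\<dots> = z i \<cdot> (t' i \<cdot> t i)" using u(2)[OF i] Comp_assoc[OF t(1)[OF i] t(2)[OF i] z[OF i]] by simp
      finally show "(u \<cdot> s') \<cdot> \<iota>' i = z i" using t(3)[OF i] Comp_Ident_right[OF z[OF i]] by simp
    qed
  next
    fix u v assume uv: "u \<in> hom V Q' Z" "v \<in> hom V Q' Z" "\<And>i. i \<in> I \<Longrightarrow> u \<cdot> \<iota>' i = v \<cdot> \<iota>' i"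
    have "u \<cdot> s = v \<cdot> s"
    proof (rule coproduct_eqI[OF Q])
      show "u \<cdot> s \<in> hom V Q Z" "v \<cdot> s \<in> hom V Q Z" using uv s Comp_hom by blast+
      fix i assume i: "i \<in> I"
      have "(w \<cdot> s) \<cdot> \<iota> i = (w \<cdot> \<iota>' i) \<cdot> t' i" if "w \<in> hom V Q' Z" for w
        using Comp_assoc[OF \<iota>[OF i] s(1) that] \<iota>'(3)[OF i] Comp_assoc[OF t(2)[OF i] \<iota>'(1)[OF i] that] by simp
      then show "(u \<cdot> s) \<cdot> \<iota> i = (v \<cdot> s) \<cdot> \<iota> i" using uv i by metis
    qed
    then have "(u \<cdot> s) \<cdot> s' = (v \<cdot> s) \<cdot> s'" by simp
    then show "u = v" using Comp_assoc[OF s(2,1)] uv(1,2) s(3) Comp_Ident_right by metis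
  }
qed

definition swap :: "'o \<Rightarrow> 'o \<Rightarrow> 'm" where
  "swap X Y = pairing V (Pr2 V X Y) (Pr1 V X Y)"

lemma swap_hom: "X \<in> Ob V \<Longrightarrow> Y \<in> Ob V \<Longrightarrow> swap X Y \<in> hom V (X \<otimes> Y) (Y \<otimes> X)"
  by (simp add: swap_def pairing_hom Pr1_hom Pr2_hom)

lemma swap_pairing:
  assumes "a \<in> hom V Z X" "b \<in> hom V Z Y"
  shows "swap X Y \<cdot> pairing V a b = pairing V b a"
proof -
  have "X \<in> Ob V" "Y \<in> Ob V" using assms hom_Ob by blast+
  then show ?thesis
    using pairing_comp[OF Pr2_hom Pr1_hom pairing_hom[OF assms]] assms by (simp add: swap_def Pr1_pairing Pr2_pairing)
qed

lemma swap_swap: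
  assumes "X \<in> Ob V" "Y \<in> Ob V" shows "swap Y X \<cdot> swap X Y = Ident V (X \<otimes> Y)"
proof (rule tens_elements_eqI[OF _ _ assms])
  note h = swap_hom[OF assms] swap_hom[OF assms(2,1)]
  show "swap Y X \<cdot> swap X Y \<in> hom V (X \<otimes> Y) (X \<otimes> Y)" by (rule Comp_hom[OF h])
  show "Ident V (X \<otimes> Y) \<in> hom V (X \<otimes> Y) (X \<otimes> Y)" using assms by (intro Ident_hom Tens_Ob)
  fix Z a b assume ab: "a \<in> hom V Z X" "b \<in> hom V Z Y"
  then show "(swap Y X \<cdot> swap X Y) \<cdot> pairing V a b = Ident V (X \<otimes> Y) \<cdot> pairing V a b"
    by (simp add: Comp_assoc[OF pairing_hom[OF ab] h] swap_pairing Comp_Ident_left[OF pairing_hom[OF ab]])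
qed

lemma swap_natural:
  assumes "f \<in> hom V X X'" "g \<in> hom V Y Y'"
  shows "swap X' Y' \<cdot> tens_mor V f g = tens_mor V g f \<cdot> swap X Y"
proof (rule tens_elements_eqI)
  show o: "X \<in> Ob V" "Y \<in> Ob V" using assms hom_Ob by blast+
  have o': "X' \<in> Ob V" "Y' \<in> Ob V" using assms hom_Ob by blast+
  note h = tens_mor_hom[OF assms] swap_hom[OF o'] swap_hom[OF o] tens_mor_hom[OF assms(2,1)]
  show "swap X' Y' \<cdot> tens_mor V f g \<in> hom V (X \<otimes> Y) (Y' \<otimes> X')" by (rule Comp_hom[OF h(1,2)])
  show "tens_mor V g f \<cdot> swap X Y \<in> hom V (X \<otimes> Y) (Y' \<otimes> X')" by (rule Comp_hom[OF h(3,4)])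
  fix Z a b assume ab: "a \<in> hom V Z X" "b \<in> hom V Z Y"
  then show "(swap X' Y' \<cdot> tens_mor V f g) \<cdot> pairing V a b = (tens_mor V g f \<cdot> swap X Y) \<cdot> pairing V a b"
    using Comp_assoc[OF pairing_hom[OF ab] h(1,2)] Comp_assoc[OF pairing_hom[OF ab] h(3,4)] assms
    by (simp add: swap_pairing[of _ Z] tens_mor_pairing[of _ _ _ _ _ _ _ Z] Comp_hom[of _ Z])
qed

lemma coproduct_tens_left:
  assumes closed: "closed_category V" and Q: "is_coproduct V I X Q \<iota>" and W: "W \<in> Ob V"
  shows "is_coproduct V I (\<lambda>i. W \<otimes> X i) (W \<otimes> Q) (\<lambda>i. tens_mor V (Ident V W) (\<iota> i))"
proof -
  have o: "Q \<in> Ob V" "i \<in> I \<Longrightarrow> X i \<in> Ob V" for i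
    using Q hom_Ob(1)[OF coproduct_hom[OF Q]] by (auto simp: is_coproduct_def)
  show ?thesis
    by (rule coproduct_reindex_iso[OF coproduct_tens_right[OF assms], where s = "swap Q W" and s' = "swap W Q"
          and t = "\<lambda>i. swap W (X i)" and t' = "\<lambda>i. swap (X i) W"])
      (use o W coproduct_hom[OF Q] in \<open>auto intro: swap_hom swap_swap tens_mor_hom Ident_hom swap_natural\<close>)
qed

lemma coproduct_tens:
  assumes closed: "closed_category V"
    and Q: "is_coproduct V I X Q \<iota>" and R: "is_coproduct V J Y R \<kappa>"
  shows "is_coproduct V (I \<times> J) (\<lambda>(i, j). X i \<otimes> Y j) (Q \<otimes> R) (\<lambda>(i, j). tens_mor V (\<iota> i) (\<kappa> j))"
proof (rule is_coproductI)
  note \<iota> = coproduct_hom[OF Q] and \<kappa> = coproduct_hom[OF R]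
  have o: "Q \<in> Ob V" "R \<in> Ob V" "\<And>i. i \<in> I \<Longrightarrow> X i \<in> Ob V"
    using Q R hom_Ob(1)[OF \<iota>] by (auto simp: is_coproduct_def)
  note QR = coproduct_tens_right[OF closed Q o(2)]
  note XR = coproduct_tens_left[OF closed R o(3)]
  show "Q \<otimes> R \<in> Ob V" using o by (simp add: Tens_Ob)
  show "(case p of (i, j) \<Rightarrow> tens_mor V (\<iota> i) (\<kappa> j)) \<in> hom V (case p of (i, j) \<Rightarrow> X i \<otimes> Y j) (Q \<otimes> R)"
    if "p \<in> I \<times> J" for p using that \<iota> \<kappa> by (auto intro: tens_mor_hom)
  have factor: "(u \<cdot> tens_mor V (\<iota> i) (Ident V R)) \<cdot> tens_mor V (Ident V (X i)) (\<kappa> j) = u \<cdot> tens_mor V (\<iota> i) (\<kappa> j)"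
    if "u \<in> hom V (Q \<otimes> R) Z" "i \<in> I" "j \<in> J" for u Z i j
    using Comp_assoc[OF coproduct_hom[OF XR] coproduct_hom[OF QR] that(1)] that o
      tens_mor_comp[OF Ident_hom \<kappa> \<iota> Ident_hom] Comp_Ident_right[OF \<iota>] Comp_Ident_left[OF \<kappa>] by simp
  fix Z
  {
    fix z assume Z: "Z \<in> Ob V" and z: "\<And>p. p \<in> I \<times> J \<Longrightarrow> z p \<in> hom V (case p of (i, j) \<Rightarrow> X i \<otimes> Y j) Z"
    have "\<forall>i\<in>I. \<exists>v. v \<in> hom V (X i \<otimes> R) Z \<and> (\<forall>j\<in>J. v \<cdot> tens_mor V (Ident V (X i)) (\<kappa> j) = z (i, j))"
    proof
      fix i assume i: "i \<in> I"
      have "z (i, j) \<in> hom V (X i \<otimes> Y j) Z" if "j \<in> J" for j using z[of "(i, j)"] i that by simp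
      then show "\<exists>v. v \<in> hom V (X i \<otimes> R) Z \<and> (\<forall>j\<in>J. v \<cdot> tens_mor V (Ident V (X i)) (\<kappa> j) = z (i, j))"
        using coproduct_exists[OF XR[OF i] Z, of "\<lambda>j. z (i, j)"] by metis
    qed
    then obtain v where v: "\<And>i. i \<in> I \<Longrightarrow> v i \<in> hom V (X i \<otimes> R) Z"
      "\<And>i j. i \<in> I \<Longrightarrow> j \<in> J \<Longrightarrow> v i \<cdot> tens_mor V (Ident V (X i)) (\<kappa> j) = z (i, j)" by metis
    obtain u where u: "u \<in> hom V (Q \<otimes> R) Z" "\<And>i. i \<in> I \<Longrightarrow> u \<cdot> tens_mor V (\<iota> i) (Ident V R) = v i"
      using coproduct_exists[OF QR Z, of v] v(1) by blast
    show "\<exists>u\<in>hom V (Q \<otimes> R) Z. \<forall>p\<in>I \<times> J. u \<cdot> (case p of (i, j) \<Rightarrow> tens_mor V (\<iota> i) (\<kappa> j)) = z p"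
      using u(1)
    proof (rule bexI[rotated], clarify)
      fix i j assume "i \<in> I" "j \<in> J"
      then show "u \<cdot> tens_mor V (\<iota> i) (\<kappa> j) = z (i, j)" using factor[OF u(1)] u(2) v(2) by metis
    qed
  next
    fix u v assume u: "u \<in> hom V (Q \<otimes> R) Z" and v: "v \<in> hom V (Q \<otimes> R) Z"
      and uv: "\<And>p. p \<in> I \<times> J \<Longrightarrow> u \<cdot> (case p of (i, j) \<Rightarrow> tens_mor V (\<iota> i) (\<kappa> j)) =
        v \<cdot> (case p of (i, j) \<Rightarrow> tens_mor V (\<iota> i) (\<kappa> j))"
    show "u = v"
    proof (rule coproduct_eqI[OF QR u v])
      fix i assume i: "i \<in> I"
      show "u \<cdot> tens_mor V (\<iota> i) (Ident V R) = v \<cdot> tens_mor V (\<iota> i) (Ident V R)"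
      proof (rule coproduct_eqI[OF XR[OF i]])
        show "u \<cdot> tens_mor V (\<iota> i) (Ident V R) \<in> hom V (X i \<otimes> R) Z" "v \<cdot> tens_mor V (\<iota> i) (Ident V R) \<in> hom V (X i \<otimes> R) Z"
          using Comp_hom coproduct_hom[OF QR i] u v by blast+
      qed (use factor[OF u i] factor[OF v i] uv i in force)
    qed
  }
qed

lemma coproduct_reindex:
  assumes Q: "is_coproduct V I X Q \<iota>" and f: "bij_betw f K I"
  shows "is_coproduct V K (\<lambda>k. X (f k)) Q (\<lambda>k. \<iota> (f k))"
proof (rule is_coproductI)
  note \<iota> = coproduct_hom[OF Q]
  have fK: "k \<in> K \<Longrightarrow> f k \<in> I" for k using f bij_betwE by metis
  have g: "i \<in> I \<Longrightarrow> inv_into K f i \<in> K \<and> f (inv_into K f i) = i" for i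
    using f by (metis bij_betw_inv_into_right bij_betw_imp_surj_on inv_into_into)
  have gf: "k \<in> K \<Longrightarrow> inv_into K f (f k) = k" for k using f by (metis bij_betw_inv_into_left)
  show "Q \<in> Ob V" using Q by (simp add: is_coproduct_def)
  show "\<iota> (f k) \<in> hom V (X (f k)) Q" if "k \<in> K" for k using \<iota> fK that by blast
  fix Z
  {
    fix z assume Z: "Z \<in> Ob V" and z: "\<And>k. k \<in> K \<Longrightarrow> z k \<in> hom V (X (f k)) Z"
    have "z (inv_into K f i) \<in> hom V (X i) Z" if "i \<in> I" for i using z g[OF that] by metis
    then obtain u where "u \<in> hom V Q Z" "\<And>i. i \<in> I \<Longrightarrow> u \<cdot> \<iota> i = z (inv_into K f i)"
      using coproduct_exists[OF Q Z, of "\<lambda>i. z (inv_into K f i)"] by blast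
    then show "\<exists>u\<in>hom V Q Z. \<forall>k\<in>K. u \<cdot> \<iota> (f k) = z k" using fK gf by metis
  next
    fix u v assume "u \<in> hom V Q Z" "v \<in> hom V Q Z" "\<And>k. k \<in> K \<Longrightarrow> u \<cdot> \<iota> (f k) = v \<cdot> \<iota> (f k)"
    then show "u = v" using coproduct_eqI[OF Q] g by metis
  }
qed

lemma coproduct_tens_list:
  assumes closed: "closed_category V"
    and Q: "\<And>j. j \<in> set js \<Longrightarrow> is_coproduct V {s. P s j} X (Q j) \<iota>"
  shows "is_coproduct V {ss. list_all2 P ss js} (\<lambda>ss. tens_list V (map X ss)) (tens_list V (map Q js))
    (\<lambda>ss. tens_mor_list V (map \<iota> ss))"
  using Q
proof (induction js)
  case Nil
  have "is_coproduct V {[]} (\<lambda>ss. tens_list V (map X ss)) \<I> (\<lambda>ss. tens_mor_list V (map \<iota> ss))"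
    by (rule is_coproductI) (auto simp: UnitOb_Ob Ident_hom Comp_Ident_right)
  then show ?case by simp
next
  case (Cons j js)
  then have "is_coproduct V {ss. list_all2 P ss js} (\<lambda>ss. tens_list V (map X ss)) (tens_list V (map Q js))
    (\<lambda>ss. tens_mor_list V (map \<iota> ss))" by simp
  from coproduct_tens[OF closed Cons.prems[of j] this]
  have c: "is_coproduct V ({s. P s j} \<times> {ss. list_all2 P ss js}) (\<lambda>(s, ss). X s \<otimes> tens_list V (map X ss))
    (Q j \<otimes> tens_list V (map Q js)) (\<lambda>(s, ss). tens_mor V (\<iota> s) (tens_mor_list V (map \<iota> ss)))" by simp
  have b: "bij_betw (\<lambda>ss. (hd ss, tl ss)) {ss. list_all2 P ss (j # js)} ({s. P s j} \<times> {ss. list_all2 P ss js})"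
    by (rule bij_betw_byWitness[where f' = "\<lambda>(s, ss). s # ss"]) (auto simp: list_all2_Cons2)
  show ?case
    unfolding list.map tens_list.simps
    by (rule coproduct_cong[OF coproduct_reindex[OF c b]]) (auto simp: list_all2_Cons2)
qed

end

section \<open>Generalized points of an operad\<close>

context category
begin

lemma symmetric_sequence_Ob: "symmetric_sequence V F \<Longrightarrow> fob F n \<in> Ob V"
  by (simp add: symmetric_sequence_def is_functor_def opposite_def Sigma_cat_def)

lemma sact_hom: "symmetric_sequence V F \<Longrightarrow> \<sigma> \<in> Sym n \<Longrightarrow> sact F n \<sigma> \<in> hom V (fob F n) (fob F n)"
  by (auto simp: symmetric_sequence_def is_functor_def opposite_def Sigma_cat_def)

lemma sact_id: "symmetric_sequence V F \<Longrightarrow> sact F n id = Ident V (fob F n)"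
  by (auto simp: symmetric_sequence_def is_functor_def opposite_def Sigma_cat_def)

lemma sact_comp: "symmetric_sequence V F \<Longrightarrow> \<sigma> \<in> Sym n \<Longrightarrow> \<tau> \<in> Sym n \<Longrightarrow>
    sact F n (\<sigma> \<circ> \<tau>) = sact F n \<tau> \<cdot> sact F n \<sigma>"
  unfolding symmetric_sequence_def is_functor_def opposite_def Sigma_cat_def by force

end

text \<open>The data of an operad, without the equations.  Evaluating the two sides of an axiom on generalized
elements is the same computation for an operad whose axioms are known and for one whose axioms are to be
proved.\<close>

locale operad_data = cartesian_monoidal_category V
  for V :: "('o, 'm, 'z) ccat_scheme" (structure) +
  fixes P :: "('o, 'm) operad"
  assumes sseq: "symmetric_sequence V (sseq P)"
    and opunit_hom: "opunit P \<in> hom V \<I> (arity P 1)"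
    and gamma_hom:
      "gamma P js \<in> hom V (arity P (length js) \<otimes> tens_arities V P js) (arity P (sum_list js))"

sublocale symmetric_operad \<subseteq> operad_data
  by unfold_locales (rule sseq opunit_hom gamma_hom)+

context operad_data
begin

text \<open>Generalized elements of the objects \<open>P(n)\<close>.  Each is paired with its arity, which the morphism alone does
not determine, since \<open>P\<close> may have the same object in different arities.\<close>

definition points :: "'o \<Rightarrow> (nat \<times> 'm) set" where
  "points Z = {x. snd x \<in> hom V Z (arity P (fst x))}"

definition point_one :: "'o \<Rightarrow> nat \<times> 'm" where
  "point_one Z = (1, opunit P \<cdot> to_unit V Z)"

definition point_graft :: "'o \<Rightarrow> nat \<times> 'm \<Rightarrow> (nat \<times> 'm) list \<Rightarrow> nat \<times> 'm" where
  "point_graft Z x ys = (sum_list (map fst ys),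
     gamma P (map fst ys) \<cdot> pairing V (snd x) (tuple_of Z ys))"

definition point_act :: "(nat \<Rightarrow> nat) \<Rightarrow> nat \<times> 'm \<Rightarrow> nat \<times> 'm" where
  "point_act \<sigma> x = (fst x, sact (sseq P) (fst x) \<sigma> \<cdot> snd x)"

lemma arity_Ob: "arity P n \<in> Ob V"
  by (rule symmetric_sequence_Ob[OF sseq])

lemma arities_Ob: "set (map (arity P) js) \<subseteq> Ob V"
  using arity_Ob by auto

lemma tens_arities_Ob: "tens_arities V P js \<in> Ob V"
  by (rule tens_list_Ob[OF arities_Ob])

lemma points_elements:
  "set ys \<subseteq> points Z \<Longrightarrow> elements Z (map snd ys) (map (arity P) (map fst ys))"
  by (induction ys) (auto simp: points_def)

lemma points_tuple_hom:
  "set ys \<subseteq> points Z \<Longrightarrow> Z \<in> Ob V \<Longrightarrow> tuple_of Z ys \<in> hom V Z (tens_arities V P (map fst ys))"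
  by (rule tuple_list_hom[OF points_elements])

lemma point_hom: "x \<in> points Z \<Longrightarrow> snd x \<in> hom V Z (arity P (fst x))"
  by (simp add: points_def)

lemma point_pairing_hom:
  assumes "x \<in> points Z" "set ys \<subseteq> points Z" "length ys = fst x" "Z \<in> Ob V"
  shows "pairing V (snd x) (tuple_of Z ys)
    \<in> hom V Z (arity P (length (map fst ys)) \<otimes> tens_arities V P (map fst ys))"
  using assms points_tuple_hom point_hom pairing_hom by fastforce

lemma point_one_closed: "Z \<in> Ob V \<Longrightarrow> point_one Z \<in> points Z"
  using Comp_hom[OF to_unit_hom opunit_hom] by (simp add: points_def point_one_def)

lemma point_graft_closed:
  assumes "x \<in> points Z" "set ys \<subseteq> points Z" "length ys = fst x" "Z \<in> Ob V"
  shows "point_graft Z x ys \<in> points Z"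
  using Comp_hom[OF point_pairing_hom[OF assms] gamma_hom] by (simp add: points_def point_graft_def)

lemma point_act_closed:
  assumes "x \<in> points Z" "\<sigma> \<in> Sym (fst x)"
  shows "point_act \<sigma> x \<in> points Z"
  using Comp_hom[OF point_hom[OF assms(1)] sact_hom[OF sseq assms(2)]] by (simp add: points_def point_act_def)

text \<open>All left-hand sides of the operad axioms have the form \<open>gamma P js \<cdot> (f \<otimes> g)\<close>.\<close>

lemma gamma_point:
  assumes "x \<in> points Z" "set ys \<subseteq> points Z" "length ys = fst x"
    and f: "f \<in> hom V X (arity P (length ys))" and g: "g \<in> hom V Y (tens_arities V P (map fst ys))"
    and a: "a \<in> hom V Z X" and b: "b \<in> hom V Z Y"
    and fa: "f \<cdot> a = snd x" and gb: "g \<cdot> b = tuple_of Z ys"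
  shows "(gamma P (map fst ys) \<cdot> tens_mor V f g) \<cdot> pairing V a b = snd (point_graft Z x ys)"
proof -
  have "tens_mor V f g \<in> hom V (X \<otimes> Y) (arity P (length (map fst ys)) \<otimes> tens_arities V P (map fst ys))"
    using f g by (simp add: tens_mor_hom)
  from Comp_assoc[OF pairing_hom[OF a b] this gamma_hom] show ?thesis
    by (simp add: tens_mor_pairing[OF f g a b] fa gb point_graft_def)
qed

text \<open>This and the following evaluations show that the two sides of every operad axiom, applied to a tuple of
points, are the two sides of the corresponding axiom for operads of sets.\<close>

lemma eval_assoc_left:
  assumes Z: "Z \<in> Ob V" and x: "x \<in> points Z" and ys: "set ys \<subseteq> points Z"
    and zss: "set (concat zss) \<subseteq> points Z"
    and l: "length ys = fst x" "map length zss = map fst ys" and iss: "iss = map (map fst) zss"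
  shows "(gamma P (concat iss) \<cdot> tens_mor V (gamma P (map length iss)) (Ident V (tens_arities V P (concat iss))))
      \<cdot> pairing V (pairing V (snd x) (tuple_of Z ys)) (tuple_of Z (concat zss)) =
    snd (point_graft Z (point_graft Z x ys) (concat zss))"
proof -
  have c: "concat iss = map fst (concat zss)" and js: "map length iss = map fst ys"
    using l by (simp_all add: iss map_concat comp_def)
  have ll: "length (concat zss) = fst (point_graft Z x ys)"
    using l by (simp add: point_graft_def length_concat)
  show ?thesis unfolding c js
  proof (rule gamma_point[OF point_graft_closed[OF x ys l(1) Z] zss ll])
    show "gamma P (map fst ys) \<in> hom V (arity P (length ys) \<otimes> tens_arities V P (map fst ys)) (arity P (length (concat zss)))"
      using gamma_hom[of "map fst ys"] l by (simp add: length_concat)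
    show "Ident V (tens_arities V P (map fst (concat zss))) \<in>
        hom V (tens_arities V P (map fst (concat zss))) (tens_arities V P (map fst (concat zss)))"
      by (rule Ident_hom[OF tens_arities_Ob])
    show "pairing V (snd x) (tuple_of Z ys) \<in> hom V Z (arity P (length ys) \<otimes> tens_arities V P (map fst ys))"
      using point_pairing_hom[OF x ys l(1) Z] by simp
    show t: "tuple_of Z (concat zss) \<in> hom V Z (tens_arities V P (map fst (concat zss)))"
      by (rule points_tuple_hom[OF zss Z])
    show "Ident V (tens_arities V P (map fst (concat zss))) \<cdot> tuple_of Z (concat zss) = tuple_of Z (concat zss)"
      by (rule Comp_Ident_left[OF t])
    show "gamma P (map fst ys) \<cdot> pairing V (snd x) (tuple_of Z ys) = snd (point_graft Z x ys)"
      by (simp add: point_graft_def)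
  qed
qed

text \<open>On points the shuffle isomorphism only regroups: every \<open>y\<close> is paired with the list of points that are to be
inserted into it.\<close>

lemma operad_shuffle_points:
  fixes iss :: "nat list list"
  defines "W \<equiv> (arity P (length iss) \<otimes> tens_arities V P (map length iss)) \<otimes> tens_arities V P (concat iss)"
  shows "operad_shuffle V P iss \<in>
      hom V W (arity P (length iss) \<otimes> tens_list V (map2 (\<lambda>j is. arity P j \<otimes> tens_arities V P is) (map length iss) iss))"
    and "\<And>Z x ys zss. Z \<in> Ob V \<Longrightarrow> x \<in> points Z \<Longrightarrow> set ys \<subseteq> points Z \<Longrightarrow> set (concat zss) \<subseteq> points Z \<Longrightarrow>
      length ys = fst x \<Longrightarrow> map length zss = map fst ys \<Longrightarrow> iss = map (map fst) zss \<Longrightarrow>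
      operad_shuffle V P iss \<cdot> pairing V (pairing V (snd x) (tuple_of Z ys)) (tuple_of Z (concat zss)) =
      pairing V (snd x) (tuple_list V Z (map2 (\<lambda>y zs. pairing V (snd y) (tuple_of Z zs)) ys zss))"
proof -
  define js where "js = map length iss"
  let ?k = "length iss"
  have lj: "length js = ?k" by (simp add: js_def)
  let ?A = "arity P ?k" and ?B = "tens_arities V P js" and ?D = "tens_arities V P (concat iss)"
  have o: "?A \<in> Ob V" "?B \<in> Ob V" "?D \<in> Ob V" "?A \<otimes> ?B \<in> Ob V"
    using arity_Ob tens_arities_Ob Tens_Ob by auto
  have W: "W = (?A \<otimes> ?B) \<otimes> ?D" by (simp add: W_def js_def)
  then have WO: "W \<in> Ob V" using o Tens_Ob by simp
  define pr where "pr = Pr1 V (?A \<otimes> ?B) ?D"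
  define a where "a = Pr1 V ?A ?B \<cdot> pr"
  define b where "b s = proj_list V (map (arity P) js) s \<cdot> Pr2 V ?A ?B \<cdot> pr" for s
  define d where "d s q = proj_list V (map (arity P) (concat iss)) (sum_list (take s js) + q) \<cdot> Pr2 V (?A \<otimes> ?B) ?D" for s q
  define T where "T s = pairing V (b s) (tuple_list V W (map (d s) [0..<js ! s]))" for s
  have sh: "operad_shuffle V P iss = pairing V a (tuple_list V W (map T [0..<?k]))"
    unfolding operad_shuffle_def Let_def T_def d_def b_def a_def pr_def W_def js_def ..
  have prh: "pr \<in> hom V W (?A \<otimes> ?B)" unfolding pr_def W by (rule Pr1_hom[OF o(4,3)])
  have p2h: "Pr2 V (?A \<otimes> ?B) ?D \<in> hom V W ?D" unfolding W by (rule Pr2_hom[OF o(4,3)])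
  have ah: "a \<in> hom V W ?A" unfolding a_def by (rule Comp_hom[OF prh Pr1_hom[OF o(1,2)]])
  have pj: "proj_list V (map (arity P) js) s \<in> hom V ?B (arity P (js ! s))" if "s < ?k" for s
    using proj_list_hom[OF arities_Ob, of s js] that lj by simp
  have bh: "b s \<in> hom V W (arity P (js ! s))" if "s < ?k" for s
    unfolding b_def by (rule Comp_hom[OF Comp_hom[OF prh Pr2_hom[OF o(1,2)]] pj[OF that]])
  have ix: "sum_list (take s js) + q < length (concat iss)" "concat iss ! (sum_list (take s js) + q) = iss ! s ! q"
    if "s < ?k" "q < js ! s" for s q
    using block_position_less[of s js q] concat_nth_block[of s iss q] that lj
    by (auto simp: length_concat js_def)
  have pd: "proj_list V (map (arity P) (concat iss)) (sum_list (take s js) + q) \<in> hom V ?D (arity P (iss ! s ! q))"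
    if "s < ?k" "q < js ! s" for s q
    using proj_list_hom[OF arities_Ob, of "sum_list (take s js) + q" "concat iss"] ix[OF that] by (simp del: map_concat)
  have dh: "d s q \<in> hom V W (arity P (iss ! s ! q))" if "s < ?k" "q < js ! s" for s q
    unfolding d_def by (rule Comp_hom[OF p2h pd[OF that]])
  have del: "elements W (map (d s) [0..<js ! s]) (map (arity P) (iss ! s))" if "s < ?k" for s
    using dh[OF that] that by (auto simp: list_all2_conv_all_nth js_def)
  have Th: "T s \<in> hom V W (arity P (js ! s) \<otimes> tens_arities V P (iss ! s))" if "s < ?k" for s
    unfolding T_def by (rule pairing_hom[OF bh[OF that] tuple_list_hom[OF del[OF that] WO]])
  have Tel: "elements W (map T [0..<?k]) (map2 (\<lambda>j is. arity P j \<otimes> tens_arities V P is) js iss)"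
    using Th lj by (auto simp: list_all2_conv_all_nth)
  show "operad_shuffle V P iss \<in>
      hom V W (?A \<otimes> tens_list V (map2 (\<lambda>j is. arity P j \<otimes> tens_arities V P is) (map length iss) iss))"
    unfolding sh js_def[symmetric] by (rule pairing_hom[OF ah tuple_list_hom[OF Tel WO]])
  fix Z x ys zss
  assume Z: "Z \<in> Ob V" and x: "x \<in> points Z" and ys: "set ys \<subseteq> points Z"
    and zss: "set (concat zss) \<subseteq> points Z"
    and l: "length ys = fst x" "map length zss = map fst ys" and iss: "iss = map (map fst) zss"
  have js: "js = map fst ys" and len: "length ys = ?k" "length zss = ?k" "length js = ?k" "fst x = ?k"
    using l map_eq_imp_length_eq[OF l(2)] by (simp_all add: js_def iss comp_def)
  have c: "concat iss = map fst (concat zss)" by (simp add: iss map_concat)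
  let ?t = "tuple_of Z ys" and ?u = "tuple_of Z (concat zss)"
  let ?E = "pairing V (pairing V (snd x) ?t) ?u"
  have xh: "snd x \<in> hom V Z ?A" using point_hom[OF x] len by simp
  have th: "?t \<in> hom V Z ?B" using points_tuple_hom[OF ys Z] js by simp
  have uh: "?u \<in> hom V Z ?D" using points_tuple_hom[OF zss Z] unfolding c .
  have Eh: "?E \<in> hom V Z W" unfolding W by (rule pairing_hom[OF pairing_hom[OF xh th] uh])
  have prE: "pr \<cdot> ?E = pairing V (snd x) ?t" unfolding pr_def by (rule Pr1_pairing[OF pairing_hom[OF xh th] uh])
  have aE: "a \<cdot> ?E = snd x"
    unfolding a_def Comp_assoc[OF Eh prh Pr1_hom[OF o(1,2)]] prE by (rule Pr1_pairing[OF xh th])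
  have bE: "b s \<cdot> ?E = snd (ys ! s)" if "s < ?k" for s
  proof -
    have "b s \<cdot> ?E = proj_list V (map (arity P) js) s \<cdot> ?t"
      unfolding b_def Comp_assoc[OF Eh Comp_hom[OF prh Pr2_hom[OF o(1,2)]] pj[OF that]]
        Comp_assoc[OF Eh prh Pr2_hom[OF o(1,2)]] prE Pr2_pairing[OF xh th] ..
    also have "\<dots> = map snd ys ! s"
      using proj_list_tuple[OF points_elements[OF ys] Z, of s] that len unfolding js by simp
    finally show ?thesis using that len by simp
  qed
  have dE: "d s q \<cdot> ?E = snd (zss ! s ! q)" if "s < ?k" "q < js ! s" for s q
  proof -
    have "d s q \<cdot> ?E = proj_list V (map (arity P) (concat iss)) (sum_list (take s js) + q) \<cdot> ?u"
      unfolding d_def Comp_assoc[OF Eh p2h pd[OF that]] Pr2_pairing[OF pairing_hom[OF xh th] uh] ..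
    also have "\<dots> = map snd (concat zss) ! (sum_list (take s js) + q)"
      unfolding c by (rule proj_list_tuple[OF points_elements[OF zss] Z]) (use ix[OF that] in \<open>simp add: c del: map_concat\<close>)
    also have "\<dots> = snd (zss ! s ! q)"
    proof -
      have jz: "js = map length zss" by (simp add: js_def iss comp_def)
      have s: "s < length zss" using that(1) len(2) by (simp only:)
      then have "q < length (zss ! s)" using that(2) by (simp add: jz)
      from concat_nth_block[OF s this] have "concat zss ! (sum_list (take s js) + q) = zss ! s ! q"
        unfolding jz .
      moreover have "sum_list (take s js) + q < length (concat zss)"
        using ix(1)[OF that] unfolding c by (simp only: length_map)
      ultimately show ?thesis by (simp only: nth_map)
    qed
    finally show ?thesis .
  qed
  have TE: "T s \<cdot> ?E = pairing V (snd (ys ! s)) (tuple_of Z (zss ! s))" if "s < ?k" for s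
  proof -
    have "map (\<lambda>f. f \<cdot> ?E) (map (d s) [0..<js ! s]) = map snd (zss ! s)"
      using dE[OF that] that by (intro nth_equalityI) (auto simp: js_def iss)
    then show ?thesis
      unfolding T_def pairing_comp[OF bh[OF that] tuple_list_hom[OF del[OF that] WO] Eh]
        tuple_list_comp[OF del[OF that] Eh] bE[OF that] by simp
  qed
  have "map (\<lambda>f. f \<cdot> ?E) (map T [0..<?k]) =
      map2 (\<lambda>y zs. pairing V (snd y) (tuple_of Z zs)) ys zss"
    using TE len by (intro nth_equalityI) auto
  then show "operad_shuffle V P iss \<cdot> ?E =
      pairing V (snd x) (tuple_list V Z (map2 (\<lambda>y zs. pairing V (snd y) (tuple_of Z zs)) ys zss))"
    unfolding sh pairing_comp[OF ah tuple_list_hom[OF Tel WO] Eh] tuple_list_comp[OF Tel Eh] aE by simp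
qed

lemma eval_assoc_right:
  assumes Z: "Z \<in> Ob V" and x: "x \<in> points Z" and ys: "set ys \<subseteq> points Z"
    and zss: "set (concat zss) \<subseteq> points Z"
    and l: "length ys = fst x" "map length zss = map fst ys" and iss: "iss = map (map fst) zss"
  shows "(gamma P (map sum_list iss) \<cdot> tens_mor V (Ident V (arity P (length iss))) (tens_mor_list V (map (gamma P) iss))
        \<cdot> operad_shuffle V P iss)
      \<cdot> pairing V (pairing V (snd x) (tuple_of Z ys)) (tuple_of Z (concat zss)) =
    snd (point_graft Z x (map2 (point_graft Z) ys zss))"
proof -
  note sh = operad_shuffle_points(1)[of iss] operad_shuffle_points(2)[OF assms]
  let ?E = "pairing V (pairing V (snd x) (tuple_of Z ys)) (tuple_of Z (concat zss))"
  let ?k = "length iss"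
  have len: "length ys = ?k" "length zss = ?k" "fst x = ?k"
    using l map_eq_imp_length_eq[OF l(2)] by (auto simp: iss)
  have js: "map length iss = map fst ys" using l by (simp add: iss comp_def)
  have c: "concat iss = map fst (concat zss)" by (simp add: iss map_concat)
  have fy: "fst (ys ! i) = length (zss ! i)" if "i < ?k" for i
    using l(2) that len by (metis nth_map)
  have zi: "set (zss ! i) \<subseteq> points Z" if "i < ?k" for i
    using zss that len by (metis UN_subset_iff nth_mem set_concat)
  have yi: "ys ! i \<in> points Z" if "i < ?k" for i
    using ys that len by (metis nth_mem subsetD)
  let ?L = "map2 (\<lambda>j is. arity P j \<otimes> tens_arities V P is) (map length iss) iss"
  let ?R = "map (arity P) (map sum_list iss)"
  let ?ws = "map2 (\<lambda>y zs. pairing V (snd y) (tuple_of Z zs)) ys zss"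
  have gl: "list_all2 (\<lambda>f (X, Y). f \<in> hom V X Y) (map (gamma P) iss) (zip ?L ?R)"
    using gamma_hom by (auto simp: list_all2_conv_all_nth)
  have gh: "tens_mor_list V (map (gamma P) iss) \<in> hom V (tens_list V ?L) (tens_list V ?R)"
    by (rule tens_mor_list_hom[OF gl]) simp
  have wl: "elements Z ?ws ?L"
  proof (rule list_all2_all_nthI)
    show "length ?ws = length ?L" using len by simp
    fix i assume "i < length ?ws"
    then have i: "i < ?k" using len by simp
    have "i < length zss" using i len(2) by (simp only:)
    then have "iss ! i = map fst (zss ! i)" unfolding iss by (rule nth_map)
    then show "?ws ! i \<in> hom V Z (?L ! i)"
      using point_pairing_hom[OF yi[OF i] zi[OF i] fy[OF i, symmetric] Z] i len by simp
  qed
  have Eh: "?E \<in> hom V Z ((arity P ?k \<otimes> tens_arities V P (map length iss)) \<otimes> tens_arities V P (concat iss))"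
    using pairing_hom[OF point_pairing_hom[OF x ys l(1) Z] points_tuple_hom[OF zss Z]] len
    unfolding js c by simp
  have yz: "length ys = length zss" using len(1,2) by (simp only:)
  have sg: "map fst (map2 (point_graft Z) ys zss) = map sum_list iss"
    using yz by (intro nth_equalityI) (auto simp: iss point_graft_def)
  have th: "tens_mor V (Ident V (arity P ?k)) (tens_mor_list V (map (gamma P) iss))
      \<in> hom V (arity P ?k \<otimes> tens_list V ?L) (arity P ?k \<otimes> tens_list V ?R)"
    by (rule tens_mor_hom[OF Ident_hom[OF arity_Ob] gh])
  have gg: "gamma P (map sum_list iss) \<in> hom V (arity P ?k \<otimes> tens_list V ?R) (arity P (sum_list (map sum_list iss)))"
    using gamma_hom[of "map sum_list iss"] by simp
  have xh: "snd x \<in> hom V Z (arity P ?k)" using point_hom[OF x] len by simp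
  have "map2 (\<cdot>) (map (gamma P) iss) ?ws = map snd (map2 (point_graft Z) ys zss)"
    using yz by (intro nth_equalityI) (auto simp: iss point_graft_def)
  then have "tens_mor_list V (map (gamma P) iss) \<cdot> tuple_list V Z ?ws = tuple_of Z (map2 (point_graft Z) ys zss)"
    using tens_mor_list_tuple[OF gl _ wl Z] by simp
  then have "tens_mor V (Ident V (arity P ?k)) (tens_mor_list V (map (gamma P) iss)) \<cdot> pairing V (snd x) (tuple_list V Z ?ws)
     = pairing V (snd x) (tuple_of Z (map2 (point_graft Z) ys zss))"
    unfolding tens_mor_pairing[OF Ident_hom[OF arity_Ob] gh xh tuple_list_hom[OF wl Z]] Comp_Ident_left[OF xh] by simp
  then show ?thesis
    unfolding Comp_assoc[OF Eh Comp_hom[OF sh(1) th] gg] Comp_assoc[OF Eh sh(1) th] sh(2)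
    by (simp only: point_graft_def[of Z x] sg snd_conv)
qed

lemma eval_unit_left:
  assumes Z: "Z \<in> Ob V" and x: "x \<in> points Z" and j: "j = fst x"
  shows "(gamma P [j] \<cdot> tens_mor V (opunit P) (Ident V (tens_arities V P [j]))) \<cdot> pairing V (to_unit V Z) (tuple_list V Z [snd x])
      = snd (point_graft Z (point_one Z) [x])"
    and "(Pr1 V (arity P j) \<I> \<cdot> Pr2 V \<I> (tens_arities V P [j])) \<cdot> pairing V (to_unit V Z) (tuple_list V Z [snd x]) = snd x"
proof -
  have xs: "set [x] \<subseteq> points Z" using x by simp
  have th: "tuple_list V Z [snd x] \<in> hom V Z (tens_arities V P [j])" using points_tuple_hom[OF xs Z] j by simp
  have oh: "opunit P \<in> hom V \<I> (arity P (length [x]))" using opunit_hom by simp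
  have lx: "length [x] = fst (point_one Z)" by (simp add: point_one_def)
  have ih: "Ident V (tens_arities V P [j]) \<in> hom V (tens_arities V P [j]) (tens_arities V P (map fst [x]))"
    using Ident_hom[OF tens_arities_Ob, of "[j]"] j by simp
  have o1: "opunit P \<cdot> to_unit V Z = snd (point_one Z)" by (simp add: point_one_def)
  have i1: "Ident V (tens_arities V P [j]) \<cdot> tuple_list V Z [snd x] = tuple_of Z [x]"
    using Comp_Ident_left[OF th] by simp
  show "(gamma P [j] \<cdot> tens_mor V (opunit P) (Ident V (tens_arities V P [j]))) \<cdot> pairing V (to_unit V Z) (tuple_list V Z [snd x])
      = snd (point_graft Z (point_one Z) [x])"
    using gamma_point[OF point_one_closed[OF Z] xs lx oh ih to_unit_hom[OF Z] th o1 i1] j by simp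
  have xh: "snd x \<in> hom V Z (arity P j)" using point_hom[OF x] j by simp
  have t1: "tens_arities V P [j] = arity P j \<otimes> \<I>" by simp
  show "(Pr1 V (arity P j) \<I> \<cdot> Pr2 V \<I> (tens_arities V P [j])) \<cdot> pairing V (to_unit V Z) (tuple_list V Z [snd x]) = snd x"
    unfolding Comp_assoc[OF pairing_hom[OF to_unit_hom[OF Z] th] Pr2_hom[OF UnitOb_Ob tens_arities_Ob]
        Pr1_hom[OF arity_Ob UnitOb_Ob, of j, folded t1]] Pr2_pairing[OF to_unit_hom[OF Z] th]
    using Pr1_pairing[OF xh to_unit_hom[OF Z]] by simp
qed

lemma eval_unit_right:
  assumes Z: "Z \<in> Ob V" and x: "x \<in> points Z" and k: "k = fst x"
  shows "(gamma P (replicate k 1) \<cdot> tens_mor V (Ident V (arity P k)) (tens_mor_list V (replicate k (opunit P))))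
        \<cdot> pairing V (snd x) (tuple_list V Z (replicate k (to_unit V Z)))
      = snd (point_graft Z x (replicate k (point_one Z)))"
    and "Pr1 V (arity P k) (tens_list V (replicate k \<I>)) \<cdot> pairing V (snd x) (tuple_list V Z (replicate k (to_unit V Z))) = snd x"
proof -
  let ?ys = "replicate k (point_one Z)"
  have ys: "set ?ys \<subseteq> points Z" using point_one_closed[OF Z] by auto
  have f1: "map fst ?ys = replicate k 1" by (simp add: point_one_def)
  have ul: "elements Z (replicate k (to_unit V Z)) (replicate k \<I>)"
    using to_unit_hom[OF Z] by (simp add: list_all2_conv_all_nth)
  note uh = tuple_list_hom[OF ul Z]
  have ol: "list_all2 (\<lambda>f (X, Y). f \<in> hom V X Y) (replicate k (opunit P)) (zip (replicate k \<I>) (replicate k (arity P 1)))"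
    using opunit_hom by (simp add: list_all2_conv_all_nth)
  have oh: "tens_mor_list V (replicate k (opunit P)) \<in> hom V (tens_list V (replicate k \<I>)) (tens_arities V P (map fst ?ys))"
    using tens_mor_list_hom[OF ol] unfolding f1 by simp
  have o1: "tens_mor_list V (replicate k (opunit P)) \<cdot> tuple_list V Z (replicate k (to_unit V Z)) = tuple_of Z ?ys"
    using tens_mor_list_tuple[OF ol _ ul Z] by (simp add: point_one_def zip_replicate)
  have xh: "snd x \<in> hom V Z (arity P k)" using point_hom[OF x] k by simp
  have ih: "Ident V (arity P k) \<in> hom V (arity P k) (arity P (length ?ys))" using Ident_hom[OF arity_Ob] by simp
  show "(gamma P (replicate k 1) \<cdot> tens_mor V (Ident V (arity P k)) (tens_mor_list V (replicate k (opunit P))))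
        \<cdot> pairing V (snd x) (tuple_list V Z (replicate k (to_unit V Z)))
      = snd (point_graft Z x ?ys)"
    using gamma_point[OF x ys _ ih oh xh uh Comp_Ident_left[OF xh] o1] k unfolding f1 by simp
  show "Pr1 V (arity P k) (tens_list V (replicate k \<I>)) \<cdot> pairing V (snd x) (tuple_list V Z (replicate k (to_unit V Z))) = snd x"
    by (rule Pr1_pairing[OF xh uh])
qed

lemma eval_outer_left:
  assumes Z: "Z \<in> Ob V" and x: "x \<in> points Z" and ys: "set ys \<subseteq> points Z" and l: "length ys = fst x"
    and js: "js = map fst ys" and \<sigma>: "\<sigma> \<in> Sym (length js)"
  shows "(gamma P js \<cdot> tens_mor V (sact (sseq P) (length js) \<sigma>) (Ident V (tens_arities V P js)))
      \<cdot> pairing V (snd x) (tuple_of Z ys) = snd (point_graft Z (point_act \<sigma> x) ys)"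
  unfolding js
proof (rule gamma_point[OF point_act_closed[OF x] ys])
  have len: "length js = fst x" using js l by simp
  show "\<sigma> \<in> Sym (fst x)" "length ys = fst (point_act \<sigma> x)" using \<sigma> len l by (simp_all add: point_act_def)
  show "sact (sseq P) (length (map fst ys)) \<sigma> \<in> hom V (arity P (fst x)) (arity P (length ys))"
    using sact_hom[OF sseq \<sigma>] len l by simp
  show "Ident V (tens_arities V P (map fst ys)) \<in> hom V (tens_arities V P (map fst ys)) (tens_arities V P (map fst ys))"
    by (rule Ident_hom[OF tens_arities_Ob])
  show "snd x \<in> hom V Z (arity P (fst x))" by (rule point_hom[OF x])
  show t: "tuple_of Z ys \<in> hom V Z (tens_arities V P (map fst ys))" by (rule points_tuple_hom[OF ys Z])
  show "Ident V (tens_arities V P (map fst ys)) \<cdot> tuple_of Z ys = tuple_of Z ys"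
    by (rule Comp_Ident_left[OF t])
  show "sact (sseq P) (length (map fst ys)) \<sigma> \<cdot> snd x = snd (point_act \<sigma> x)"
    using l by (simp add: point_act_def)
qed

lemma permute_factors_points:
  assumes \<sigma>: "\<sigma> \<in> Sym (length js)"
  shows "permute_factors V P \<sigma> js \<in> hom V (tens_arities V P js) (tens_arities V P (move_list \<sigma> js))"
    and "\<And>Z ys. Z \<in> Ob V \<Longrightarrow> set ys \<subseteq> points Z \<Longrightarrow> js = map fst ys \<Longrightarrow>
      permute_factors V P \<sigma> js \<cdot> tuple_of Z ys = tuple_of Z (move_list \<sigma> ys)"
proof -
  let ?T = "tens_arities V P js" and ?ps = "map (proj_list V (map (arity P) js)) [0..<length js]"
  have "elements ?T ?ps (map (arity P) js)"
    using proj_list_hom[OF arities_Ob, of _ js] by (auto simp: list_all2_conv_all_nth)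
  moreover have "zip (move_list \<sigma> ?ps) (move_list \<sigma> (map (arity P) js)) = move_list \<sigma> (zip ?ps (map (arity P) js))"
    by (rule zip_move_list) (use \<sigma> in auto)
  moreover have "set (move_list \<sigma> (zip ?ps (map (arity P) js))) = set (zip ?ps (map (arity P) js))"
    by (rule set_move_list) (use \<sigma> in auto)
  ultimately have el: "elements ?T (move_list \<sigma> ?ps) (map (arity P) (move_list \<sigma> js))"
    using \<sigma> by (simp add: list_all2_iff map_move_list)
  show "permute_factors V P \<sigma> js \<in> hom V ?T (tens_arities V P (move_list \<sigma> js))"
    unfolding permute_factors_def by (rule tuple_list_hom[OF el tens_arities_Ob])
  fix Z ys assume Z: "Z \<in> Ob V" and ys: "set ys \<subseteq> points Z" and js: "js = map fst ys"
  have \<sigma>y: "\<sigma> \<in> Sym (length ys)" using \<sigma> js by simp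
  have th: "tuple_of Z ys \<in> hom V Z ?T" using points_tuple_hom[OF ys Z] js by simp
  have "map (\<lambda>f. f \<cdot> tuple_of Z ys) ?ps = map snd ys"
    using proj_list_tuple[OF points_elements[OF ys] Z] js by (intro nth_equalityI) auto
  then have "map (\<lambda>f. f \<cdot> tuple_of Z ys) (move_list \<sigma> ?ps) = map snd (move_list \<sigma> ys)"
    using \<sigma> \<sigma>y by (simp add: map_move_list del: map_map)
  then show "permute_factors V P \<sigma> js \<cdot> tuple_of Z ys = tuple_of Z (move_list \<sigma> ys)"
    unfolding permute_factors_def tuple_list_comp[OF el th] by simp
qed

lemma eval_outer_right:
  assumes Z: "Z \<in> Ob V" and x: "x \<in> points Z" and ys: "set ys \<subseteq> points Z" and l: "length ys = fst x"
    and js: "js = map fst ys" and \<sigma>: "\<sigma> \<in> Sym (length js)"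
  shows "(sact (sseq P) (sum_list js) (block_perm \<sigma> js) \<cdot> gamma P (move_list \<sigma> js)
        \<cdot> tens_mor V (Ident V (arity P (length js))) (permute_factors V P \<sigma> js))
      \<cdot> pairing V (snd x) (tuple_of Z ys) =
    snd (point_act (block_perm \<sigma> js) (point_graft Z x (move_list \<sigma> ys)))"
proof -
  note pf = permute_factors_points(1)[OF \<sigma>] permute_factors_points(2)[OF \<sigma> Z ys js]
  have \<sigma>y: "\<sigma> \<in> Sym (length ys)" using \<sigma> js by simp
  have len: "length js = fst x" using js l by simp
  have mj: "map fst (move_list \<sigma> ys) = move_list \<sigma> js" using \<sigma>y js by (simp add: map_move_list)
  have my: "set (move_list \<sigma> ys) \<subseteq> points Z" using ys set_move_list[OF \<sigma>y] by simp
  have sm: "sum_list (move_list \<sigma> js) = sum_list js" by (rule sum_list_move_list[OF \<sigma>])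
  have ph: "pairing V (snd x) (tuple_of Z ys) \<in> hom V Z (arity P (length js) \<otimes> tens_arities V P js)"
    using point_pairing_hom[OF x ys l Z] js by simp
  have th: "tens_mor V (Ident V (arity P (length js))) (permute_factors V P \<sigma> js) \<in>
      hom V (arity P (length js) \<otimes> tens_arities V P js) (arity P (length (move_list \<sigma> js)) \<otimes> tens_arities V P (move_list \<sigma> js))"
    using tens_mor_hom[OF Ident_hom[OF arity_Ob] pf(1)] by simp
  note gh = gamma_hom[of "move_list \<sigma> js", unfolded sm]
  have xh: "snd x \<in> hom V Z (arity P (length js))" using point_hom[OF x] len by simp
  have "(gamma P (move_list \<sigma> js) \<cdot> tens_mor V (Ident V (arity P (length js))) (permute_factors V P \<sigma> js))
      \<cdot> pairing V (snd x) (tuple_of Z ys) = snd (point_graft Z x (move_list \<sigma> ys))"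
  proof (unfold mj[symmetric], rule gamma_point[OF x my _ _ _ xh])
    show "length (move_list \<sigma> ys) = fst x" using l by simp
    show "Ident V (arity P (length js)) \<in> hom V (arity P (length js)) (arity P (length (move_list \<sigma> ys)))"
      using Ident_hom[OF arity_Ob] l len by simp
    show "permute_factors V P \<sigma> js \<in> hom V (tens_arities V P js) (tens_arities V P (map fst (move_list \<sigma> ys)))"
      using pf(1) mj by simp
    show "tuple_of Z ys \<in> hom V Z (tens_arities V P js)" using points_tuple_hom[OF ys Z] js by simp
    show "Ident V (arity P (length js)) \<cdot> snd x = snd x" by (rule Comp_Ident_left[OF xh])
  qed (rule pf(2))
  moreover have "fst (point_graft Z x (move_list \<sigma> ys)) = sum_list js" by (simp add: point_graft_def mj sm)
  ultimately show ?thesis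
    unfolding Comp_assoc[OF ph Comp_hom[OF th gh] sact_hom[OF sseq block_perm_Sym[OF \<sigma>]]]
    by (simp add: point_act_def)
qed

lemma eval_inner_left:
  assumes Z: "Z \<in> Ob V" and x: "x \<in> points Z" and ys: "set ys \<subseteq> points Z" and l: "length ys = fst x"
    and js: "js = map fst ys" and \<tau>: "length \<tau>s = length js" "\<And>s. s < length js \<Longrightarrow> \<tau>s ! s \<in> Sym (js ! s)"
  shows "(gamma P js \<cdot> tens_mor V (Ident V (arity P (length js))) (tens_mor_list V (map2 (sact (sseq P)) js \<tau>s)))
      \<cdot> pairing V (snd x) (tuple_of Z ys) = snd (point_graft Z x (map2 point_act \<tau>s ys))"
proof -
  let ?ys = "map2 point_act \<tau>s ys"
  have len: "length js = fst x" "length ys = length \<tau>s" using js l \<tau> by simp_all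
  have mj: "map fst ?ys = js" using len(2) by (intro nth_equalityI) (auto simp: js point_act_def)
  have "point_act (\<tau>s ! i) (ys ! i) \<in> points Z" if "i < length ys" for i
    using \<tau>(2)[of i] that js ys by (intro point_act_closed) auto
  then have my: "set ?ys \<subseteq> points Z" using len by (auto simp: set_zip)
  have xh: "snd x \<in> hom V Z (arity P (length js))" using point_hom[OF x] len by simp
  let ?Xs = "map (arity P) js"
  have sl: "list_all2 (\<lambda>f (X, Y). f \<in> hom V X Y) (map2 (sact (sseq P)) js \<tau>s) (zip ?Xs ?Xs)"
    using \<tau> sact_hom[OF sseq] by (auto simp: list_all2_conv_all_nth)
  have yl: "elements Z (map snd ys) ?Xs" using points_elements[OF ys] js by simp
  show ?thesis
  proof (subst (1) mj[symmetric], rule gamma_point[OF x my _ _ _ xh])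
    show "length ?ys = fst x" using l len by simp
    show "Ident V (arity P (length js)) \<in> hom V (arity P (length js)) (arity P (length ?ys))"
      using Ident_hom[OF arity_Ob] l len by simp
    show "tens_mor_list V (map2 (sact (sseq P)) js \<tau>s) \<in> hom V (tens_arities V P js) (tens_arities V P (map fst ?ys))"
      unfolding mj by (rule tens_mor_list_hom[OF sl refl])
    show "tuple_of Z ys \<in> hom V Z (tens_arities V P js)" using points_tuple_hom[OF ys Z] js by simp
    show "Ident V (arity P (length js)) \<cdot> snd x = snd x" by (rule Comp_Ident_left[OF xh])
    have "map2 (\<cdot>) (map2 (sact (sseq P)) js \<tau>s) (map snd ys) = map snd ?ys"
      using len(2) by (intro nth_equalityI) (auto simp: js point_act_def)
    then show "tens_mor_list V (map2 (sact (sseq P)) js \<tau>s) \<cdot> tuple_of Z ys = tuple_of Z ?ys"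
      using tens_mor_list_tuple[OF sl refl yl Z] by simp
  qed
qed

lemma eval_inner_right:
  assumes Z: "Z \<in> Ob V" and x: "x \<in> points Z" and ys: "set ys \<subseteq> points Z" and l: "length ys = fst x"
    and js: "js = map fst ys" and \<tau>: "length \<tau>s = length js" "\<And>s. s < length js \<Longrightarrow> \<tau>s ! s \<in> Sym (js ! s)"
  shows "(sact (sseq P) (sum_list js) (block_sum js \<tau>s) \<cdot> gamma P js) \<cdot> pairing V (snd x) (tuple_of Z ys) =
    snd (point_act (block_sum js \<tau>s) (point_graft Z x ys))"
  using Comp_assoc[OF point_pairing_hom[OF x ys l Z, folded js] gamma_hom sact_hom[OF sseq block_sum_Sym[OF \<tau>]]]
  by (simp add: point_act_def point_graft_def js)

end

context symmetric_operad
begin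

theorem points_set_operad:
  assumes Z: "Z \<in> Ob V"
  shows "set_operad (points Z) fst (point_one Z) (point_graft Z) point_act"
proof
  show "point_one Z \<in> points Z" by (rule point_one_closed[OF Z])
  show "fst (point_one Z) = 1" by (simp add: point_one_def)
next
  fix x \<sigma> assume "x \<in> points Z" "\<sigma> \<in> Sym (fst x)"
  then show "point_act \<sigma> x \<in> points Z" "fst (point_act \<sigma> x) = fst x"
    by (rule point_act_closed) (simp add: point_act_def)
next
  fix x assume x: "x \<in> points Z"
  show "point_graft Z (point_one Z) [x] = x"
    using eval_unit_left[OF Z x refl] gamma_unit_left[of "fst x"]
    by (intro prod_eqI) (simp_all add: point_graft_def)
  show "point_graft Z x (replicate (fst x) (point_one Z)) = x"
    using eval_unit_right[OF Z x refl] gamma_unit_right[of "fst x"]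
    by (intro prod_eqI) (simp_all add: point_graft_def point_one_def sum_list_replicate)
next
  fix x ys assume x: "x \<in> points Z" "set ys \<subseteq> points Z" "length ys = fst x"
  show "point_graft Z x ys \<in> points Z" by (rule point_graft_closed[OF x Z])
  show "fst (point_graft Z x ys) = sum_list (map fst ys)" by (simp add: point_graft_def)
  {
    fix \<sigma> assume \<sigma>: "\<sigma> \<in> Sym (fst x)"
    then have "\<sigma> \<in> Sym (length (map fst ys))" using x by simp
    from eval_outer_left[OF Z x refl this] eval_outer_right[OF Z x refl this] gamma_equivariant_outer[OF this]
    have "snd (point_graft Z (point_act \<sigma> x) ys) = snd (point_act (block_perm \<sigma> (map fst ys)) (point_graft Z x (move_list \<sigma> ys)))"
      by simp
    then show "point_graft Z (point_act \<sigma> x) ys = point_act (block_perm \<sigma> (map fst ys)) (point_graft Z x (move_list \<sigma> ys))"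
      using \<sigma> x(3) sum_list_move_list[of \<sigma> "map fst ys"]
      by (intro prod_eqI) (simp_all add: point_graft_def point_act_def map_move_list)
  next
    fix \<tau>s assume "length \<tau>s = length ys" "\<And>i. i < length ys \<Longrightarrow> \<tau>s ! i \<in> Sym (fst (ys ! i))"
    then have \<tau>: "length \<tau>s = length (map fst ys)" "\<And>i. i < length (map fst ys) \<Longrightarrow> \<tau>s ! i \<in> Sym (map fst ys ! i)"
      by simp_all
    from eval_inner_left[OF Z x refl this] eval_inner_right[OF Z x refl this] gamma_equivariant_inner[OF this]
    have "snd (point_graft Z x (map2 point_act \<tau>s ys)) = snd (point_act (block_sum (map fst ys) \<tau>s) (point_graft Z x ys))"
      by simp
    moreover have "map fst (map2 point_act \<tau>s ys) = map fst ys"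
      using \<tau>(1) by (intro nth_equalityI) (auto simp: point_act_def)
    ultimately show "point_graft Z x (map2 point_act \<tau>s ys) = point_act (block_sum (map fst ys) \<tau>s) (point_graft Z x ys)"
      by (intro prod_eqI) (simp_all add: point_graft_def point_act_def)
  next
    fix zss assume z: "set (concat zss) \<subseteq> points Z" "map length zss = map fst ys"
    have "snd (point_graft Z (point_graft Z x ys) (concat zss)) = snd (point_graft Z x (map2 (point_graft Z) ys zss))"
      using eval_assoc_left[OF Z x(1,2) z(1) x(3) z(2) refl] eval_assoc_right[OF Z x(1,2) z(1) x(3) z(2) refl]
        gamma_assoc[of "map (map fst) zss"] by simp
    moreover have "map fst (map2 (point_graft Z) ys zss) = map (\<lambda>zs. sum_list (map fst zs)) zss"
      using map_eq_imp_length_eq[OF z(2)] by (intro nth_equalityI) (auto simp: point_graft_def)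
    moreover have "sum_list (map fst (concat zss)) = sum_list (map (\<lambda>zs. sum_list (map fst zs)) zss)"
      by (induction zss) auto
    ultimately show "point_graft Z (point_graft Z x ys) (concat zss) = point_graft Z x (map2 (point_graft Z) ys zss)"
      by (intro prod_eqI) (simp_all add: point_graft_def)
  }
qed

end

section \<open>The operad on a sum over masks\<close>

text \<open>A symmetric sequence \<open>B\<close> given as the sum of the objects \<open>C(|S|)\<close> over all subsets, with the action that
restricts permutations to subsets.  The inclusion \<open>\<iota> m\<close> belongs to \<open>B(n)\<close> for \<open>n\<close> the length of \<open>m\<close>.\<close>

locale mask_sequence = symmetric_operad V C
  for V :: "('o, 'm, 'z) ccat_scheme" (structure) and C :: "('o, 'm) operad" +
  fixes B :: "('o, 'm) sseq" and \<iota> :: "bool list \<Rightarrow> 'm"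
  assumes closed: "closed_category V"
    and B_sequence: "symmetric_sequence V B"
    and incl_coproduct: "is_coproduct V {m. length m = n} (\<lambda>m. arity C (weight m)) (fob B n) \<iota>"
    and incl_act: "\<sigma> \<in> Sym (length m) \<Longrightarrow>
      sact B (length m) \<sigma> \<cdot> \<iota> (move_list \<sigma> m) = \<iota> m \<cdot> sact (sseq C) (weight m) (restrict_perm \<sigma> m)"
begin

abbreviation mask_points :: "'o \<Rightarrow> (bool list \<times> nat \<times> 'm) set" where
  "mask_points Z \<equiv> set_operad.mask_set (points Z) fst"

abbreviation mask_point_graft where
  "mask_point_graft Z \<equiv> set_operad.mask_graft (point_graft Z)"

abbreviation mask_point_act where
  "mask_point_act \<equiv> set_operad.mask_act point_act"

abbreviation mask_point_one where
  "mask_point_one Z \<equiv> set_operad.mask_one (point_one Z)"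

abbreviation summand :: "bool list \<Rightarrow> 'o" where
  "summand m \<equiv> arity C (weight m)"

text \<open>The point of \<open>B\<close> given by a masked point of \<open>C\<close>.  Not every point of \<open>B\<close> is of this form, but by the
distributivity of products over coproducts these points suffice to compare morphisms.\<close>

definition embed :: "bool list \<times> nat \<times> 'm \<Rightarrow> nat \<times> 'm" where
  "embed p = (length (fst p), \<iota> (fst p) \<cdot> snd (snd p))"

lemma incl_hom: "\<iota> m \<in> hom V (summand m) (fob B (length m))"
  using coproduct_hom[OF incl_coproduct, of m] by simp

lemma B_Ob: "fob B n \<in> Ob V"
  by (rule symmetric_sequence_Ob[OF B_sequence])

lemma mask_pointsD:
  assumes "Z \<in> Ob V" "p \<in> mask_points Z"
  shows "fst (snd p) = weight (fst p)" "snd (snd p) \<in> hom V Z (summand (fst p))" "snd p \<in> points Z"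
proof -
  have "p \<in> {p. snd p \<in> points Z \<and> fst (snd p) = weight (fst p)}"
    using assms(2) unfolding set_operad.mask_set_def[OF points_set_operad[OF assms(1)]] .
  then show "fst (snd p) = weight (fst p)" "snd (snd p) \<in> hom V Z (summand (fst p))" "snd p \<in> points Z"
    by (auto simp: points_def)
qed

lemma mask_pointsI:
  assumes "c \<in> hom V Z (summand m)"
  shows "(m, weight m, c) \<in> mask_points Z"
  unfolding set_operad.mask_set_def[OF points_set_operad[OF hom_Ob(1)[OF assms]]]
  using assms by (simp add: points_def)

lemma mask_points_elements:
  "Z \<in> Ob V \<Longrightarrow> set qs \<subseteq> mask_points Z \<Longrightarrow>
   elements Z (map (snd \<circ> snd) qs) (map summand (map fst qs))"
  by (induction qs) (auto dest: mask_pointsD(2))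

lemma embed_hom: "Z \<in> Ob V \<Longrightarrow> p \<in> mask_points Z \<Longrightarrow> snd (embed p) \<in> hom V Z (fob B (length (fst p)))"
  unfolding embed_def using Comp_hom[OF mask_pointsD(2) incl_hom] by simp

lemma embed_tuple:
  assumes Z: "Z \<in> Ob V" and qs: "set qs \<subseteq> mask_points Z"
  shows "tuple_list V Z (map (snd \<circ> snd) qs) \<in> hom V Z (tens_list V (map summand (map fst qs)))"
    and "tens_mor_list V (map \<iota> (map fst qs)) \<in>
      hom V (tens_list V (map summand (map fst qs))) (tens_list V (map (fob B) (map (length \<circ> fst) qs)))"
    and "tens_mor_list V (map \<iota> (map fst qs)) \<cdot> tuple_list V Z (map (snd \<circ> snd) qs) =
      tuple_of Z (map embed qs)"
proof -
  note 1 = mask_points_elements[OF Z qs]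
  have 2: "list_all2 (\<lambda>f (X, Y). f \<in> hom V X Y) (map \<iota> (map fst qs))
      (zip (map summand (map fst qs)) (map (fob B) (map (length \<circ> fst) qs)))"
    using incl_hom by (auto simp: list_all2_conv_all_nth)
  show "tuple_list V Z (map (snd \<circ> snd) qs) \<in> hom V Z (tens_list V (map summand (map fst qs)))"
    by (rule tuple_list_hom[OF 1 Z])
  show "tens_mor_list V (map \<iota> (map fst qs)) \<in>
      hom V (tens_list V (map summand (map fst qs))) (tens_list V (map (fob B) (map (length \<circ> fst) qs)))"
    by (rule tens_mor_list_hom[OF 2]) simp
  have "map2 (\<cdot>) (map \<iota> (map fst qs)) (map (snd \<circ> snd) qs) = map snd (map embed qs)"
    by (intro nth_equalityI) (auto simp: embed_def)
  then show "tens_mor_list V (map \<iota> (map fst qs)) \<cdot> tuple_list V Z (map (snd \<circ> snd) qs) =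
      tuple_of Z (map embed qs)"
    using tens_mor_list_tuple[OF 2 _ 1 Z] by simp
qed

lemma embed_pairing:
  assumes Z: "Z \<in> Ob V" and p: "p \<in> mask_points Z" and qs: "set qs \<subseteq> mask_points Z"
  shows "tens_mor V (\<iota> (fst p)) (tens_mor_list V (map \<iota> (map fst qs)))
      \<cdot> pairing V (snd (snd p)) (tuple_list V Z (map (snd \<circ> snd) qs)) =
    pairing V (snd (embed p)) (tuple_of Z (map embed qs))"
  unfolding tens_mor_pairing[OF incl_hom embed_tuple(2)[OF Z qs] mask_pointsD(2)[OF Z p] embed_tuple(1)[OF Z qs]]
    embed_tuple(3)[OF Z qs] by (simp add: embed_def)

lemma tens_mask_point:
  assumes d: "d \<in> hom V Z (tens_list V (map summand ms))"
  obtains qs where "set qs \<subseteq> mask_points Z" "map fst qs = ms" "d = tuple_list V Z (map (snd \<circ> snd) qs)"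
proof -
  have "set (map summand ms) \<subseteq> Ob V" using arity_Ob by auto
  from tuple_list_eta[OF d this] obtain cs where cs: "elements Z cs (map summand ms)" "d = tuple_list V Z cs" .
  then have len: "length cs = length ms" using list_all2_lengthD by fastforce
  let ?qs = "map2 (\<lambda>m c. (m, weight m, c)) ms cs"
  have 1: "set ?qs \<subseteq> mask_points Z"
    using cs(1) mask_pointsI by (auto simp: list_all2_conv_all_nth set_zip)
  have 2: "map fst ?qs = ms" "map (snd \<circ> snd) ?qs = cs"
    using len[symmetric] by (induction ms cs rule: list_induct2) auto
  show ?thesis by (rule that[OF 1 2(1)]) (simp only: 2(2) cs(2))
qed

lemma list_coproduct:
  "is_coproduct V {ms. map length ms = js} (\<lambda>ms. tens_list V (map summand ms)) (tens_list V (map (fob B) js))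
     (\<lambda>ms. tens_mor_list V (map \<iota> ms))"
proof -
  have e: "list_all2 (\<lambda>m j. length m = j) ms js \<longleftrightarrow> map length ms = js" for ms :: "bool list list"
    by (induction ms arbitrary: js) (auto simp: list_all2_Cons1)
  show ?thesis
    using coproduct_tens_list[OF closed, of js "\<lambda>m j. length m = j" summand "fob B" \<iota>, OF incl_coproduct]
    unfolding e .
qed

lemmas pair_coproduct = coproduct_tens[OF closed incl_coproduct list_coproduct]
lemmas triple_coproduct = coproduct_tens[OF closed pair_coproduct list_coproduct]

text \<open>The morphism that discards the factors outside the mask \<open>m\<close>, as a Cartesian structure permits.\<close>

definition select_mor :: "bool list \<Rightarrow> bool list list \<Rightarrow> 'm" where
  "select_mor m ms = (let A = summand m; Xs = map summand ms; T = tens_list V Xs in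
     pairing V (Pr1 V A T)
       (tuple_list V (A \<otimes> T) (select m (map (\<lambda>i. proj_list V Xs i \<cdot> Pr2 V A T) [0..<length ms]))))"

lemma list_all2_select: "list_all2 R xs ys \<Longrightarrow> length xs = length m \<Longrightarrow> list_all2 R (select m xs) (select m ys)"
proof (induction m arbitrary: xs ys)
  case (Cons b m)
  then show ?case by (cases xs; cases ys) auto
qed auto

lemma select_mor_hom:
  assumes "length ms = length m"
  shows "select_mor m ms \<in> hom V (summand m \<otimes> tens_list V (map summand ms))
      (arity C (length (select m (map weight ms))) \<otimes> tens_arities V C (select m (map weight ms)))"
    and "\<And>Z p qs. Z \<in> Ob V \<Longrightarrow> p \<in> mask_points Z \<Longrightarrow> set qs \<subseteq> mask_points Z \<Longrightarrow> fst p = m \<Longrightarrow> map fst qs = ms \<Longrightarrow>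
      select_mor m ms \<cdot> pairing V (snd (snd p)) (tuple_list V Z (map (snd \<circ> snd) qs)) =
      pairing V (snd (snd p)) (tuple_of Z (select m (map snd qs)))"
proof -
  let ?A = "summand m" and ?Xs = "map summand ms"
  let ?T = "tens_list V ?Xs"
  let ?ps = "map (\<lambda>i. proj_list V ?Xs i \<cdot> Pr2 V ?A ?T) [0..<length ms]"
  have X: "set ?Xs \<subseteq> Ob V" using arity_Ob by auto
  have o: "?A \<in> Ob V" "?T \<in> Ob V" "?A \<otimes> ?T \<in> Ob V" using arity_Ob X tens_list_Ob Tens_Ob by auto
  have ph: "proj_list V ?Xs i \<in> hom V ?T (summand (ms ! i))" if "i < length ms" for i
    using proj_list_hom[OF X, of i] that by simp
  have "elements (?A \<otimes> ?T) ?ps ?Xs"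
    using Comp_hom[OF Pr2_hom[OF o(1,2)] ph] by (auto simp: list_all2_conv_all_nth)
  then have el: "elements (?A \<otimes> ?T) (select m ?ps) (map (arity C) (select m (map weight ms)))"
    using list_all2_select[of _ ?ps ?Xs m] assms by (simp add: map_select comp_def)
  have l: "length (select m (map weight ms)) = weight m" using assms by simp
  show "select_mor m ms \<in> hom V (?A \<otimes> ?T) (arity C (length (select m (map weight ms))) \<otimes> tens_arities V C (select m (map weight ms)))"
    unfolding select_mor_def Let_def l by (rule pairing_hom[OF Pr1_hom[OF o(1,2)] tuple_list_hom[OF el o(3)]])
  fix Z p qs assume Z: "Z \<in> Ob V" and p: "p \<in> mask_points Z" and qs: "set qs \<subseteq> mask_points Z" and m: "fst p = m" "map fst qs = ms"
  let ?t = "tuple_list V Z (map (snd \<circ> snd) qs)"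
  have xh: "snd (snd p) \<in> hom V Z ?A" using mask_pointsD(2)[OF Z p] m by simp
  have qel: "elements Z (map (snd \<circ> snd) qs) ?Xs"
    using mask_points_elements[OF Z qs] m(2) by simp
  have th: "?t \<in> hom V Z ?T" using embed_tuple(1)[OF Z qs] m by simp
  note eh = pairing_hom[OF xh th]
  have "map (\<lambda>f. f \<cdot> pairing V (snd (snd p)) ?t) ?ps = map (snd \<circ> snd) qs"
  proof (rule nth_equalityI)
    show "length (map (\<lambda>f. f \<cdot> pairing V (snd (snd p)) ?t) ?ps) = length (map (snd \<circ> snd) qs)" using m(2) by auto
    fix i assume "i < length (map (\<lambda>f. f \<cdot> pairing V (snd (snd p)) ?t) ?ps)"
    then have i: "i < length ms" by simp
    have "(proj_list V ?Xs i \<cdot> Pr2 V ?A ?T) \<cdot> pairing V (snd (snd p)) ?t = proj_list V ?Xs i \<cdot> ?t"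
      unfolding Comp_assoc[OF eh Pr2_hom[OF o(1,2)] ph[OF i]] Pr2_pairing[OF xh th] ..
    also have "\<dots> = map (snd \<circ> snd) qs ! i" by (rule proj_list_tuple[OF qel Z]) (use i in simp)
    finally show "map (\<lambda>f. f \<cdot> pairing V (snd (snd p)) ?t) ?ps ! i = map (snd \<circ> snd) qs ! i" using i by simp
  qed
  then have "map (\<lambda>f. f \<cdot> pairing V (snd (snd p)) ?t) (select m ?ps) = map snd (select m (map snd qs))"
    unfolding map_select by simp
  then show "select_mor m ms \<cdot> pairing V (snd (snd p)) ?t = pairing V (snd (snd p)) (tuple_of Z (select m (map snd qs)))"
    unfolding select_mor_def Let_def pairing_comp[OF Pr1_hom[OF o(1,2)] tuple_list_hom[OF el o(3)] eh]
      tuple_list_comp[OF el eh] Pr1_pairing[OF xh th] by simp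
qed

text \<open>The composition of \<open>B\<close> is prescribed on the summands of its domain: the summand of \<open>m\<close> and \<open>ms\<close> is composed
in \<open>C\<close>, after discarding factors, and lands in the summand of \<open>mask_comp m ms\<close>.\<close>

definition mask_gamma :: "nat list \<Rightarrow> 'm" where
  "mask_gamma js = (SOME u. u \<in> hom V (fob B (length js) \<otimes> tens_list V (map (fob B) js)) (fob B (sum_list js)) \<and>
     (\<forall>m ms. length m = length js \<longrightarrow> map length ms = js \<longrightarrow>
        u \<cdot> tens_mor V (\<iota> m) (tens_mor_list V (map \<iota> ms)) =
        \<iota> (mask_comp m ms) \<cdot> gamma C (select m (map weight ms)) \<cdot> select_mor m ms))"

definition mask_op :: "('o, 'm) operad" where
  "mask_op = \<lparr>sseq = B, opunit = \<iota> [True] \<cdot> opunit C, gamma = mask_gamma\<rparr>"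

lemma mask_op_simps: "sseq mask_op = B" "opunit mask_op = \<iota> [True] \<cdot> opunit C" "gamma mask_op = mask_gamma"
  by (simp_all add: mask_op_def)

lemma mask_gamma_summand_hom:
  assumes "length m = length js" "map length ms = js"
  shows "gamma C (select m (map weight ms)) \<cdot> select_mor m ms \<in>
      hom V (summand m \<otimes> tens_list V (map summand ms)) (summand (mask_comp m ms))"
    and "length (mask_comp m ms) = sum_list js"
proof -
  have l: "length ms = length m" using assms by (metis length_map)
  show "gamma C (select m (map weight ms)) \<cdot> select_mor m ms \<in>
      hom V (summand m \<otimes> tens_list V (map summand ms)) (summand (mask_comp m ms))"
    using Comp_hom[OF select_mor_hom(1)[OF l] gamma_hom] weight_mask_comp[OF l[symmetric]] by simp
  show "length (mask_comp m ms) = sum_list js" using length_mask_comp[OF l[symmetric]] assms by simp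
qed

text \<open>The domain of the composition is a product of sums, hence the sum of the objects on which it is
prescribed.\<close>

lemma mask_gamma_props:
  "mask_gamma js \<in> hom V (fob B (length js) \<otimes> tens_list V (map (fob B) js)) (fob B (sum_list js)) \<and>
     (\<forall>m ms. length m = length js \<longrightarrow> map length ms = js \<longrightarrow>
        mask_gamma js \<cdot> tens_mor V (\<iota> m) (tens_mor_list V (map \<iota> ms)) =
        \<iota> (mask_comp m ms) \<cdot> gamma C (select m (map weight ms)) \<cdot> select_mor m ms)"
  unfolding mask_gamma_def
proof (rule someI_ex)
  let ?z = "\<lambda>(m, ms). \<iota> (mask_comp m ms) \<cdot> gamma C (select m (map weight ms)) \<cdot> select_mor m ms"
  let ?I = "{m. length m = length js} \<times> {ms. map length ms = js}"
  have z: "?z i \<in> hom V (case i of (m, ms) \<Rightarrow> summand m \<otimes> tens_list V (map summand ms)) (fob B (sum_list js))"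
    if "i \<in> ?I" for i
  proof -
    obtain m ms where i: "i = (m, ms)" "length m = length js" "map length ms = js" using \<open>i \<in> ?I\<close> by auto
    from Comp_hom[OF mask_gamma_summand_hom(1)[OF i(2,3)] incl_hom] mask_gamma_summand_hom(2)[OF i(2,3)]
    show ?thesis by (simp add: i(1))
  qed
  obtain u where u: "u \<in> hom V (fob B (length js) \<otimes> tens_list V (map (fob B) js)) (fob B (sum_list js))"
      "\<And>i. i \<in> ?I \<Longrightarrow> u \<cdot> (case i of (m, ms) \<Rightarrow> tens_mor V (\<iota> m) (tens_mor_list V (map \<iota> ms))) = ?z i"
    using coproduct_exists[OF pair_coproduct B_Ob z] by blast
  show "\<exists>u. u \<in> hom V (fob B (length js) \<otimes> tens_list V (map (fob B) js)) (fob B (sum_list js)) \<and>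
     (\<forall>m ms. length m = length js \<longrightarrow> map length ms = js \<longrightarrow>
        u \<cdot> tens_mor V (\<iota> m) (tens_mor_list V (map \<iota> ms)) =
        \<iota> (mask_comp m ms) \<cdot> gamma C (select m (map weight ms)) \<cdot> select_mor m ms)"
    using u(1) u(2)[of "(m, ms)" for m ms] by auto
qed

sublocale B: operad_data V mask_op
proof
  show "symmetric_sequence V (sseq mask_op)" by (simp add: mask_op_simps B_sequence)
  show "opunit mask_op \<in> hom V \<I> (arity mask_op 1)"
    using Comp_hom[of "opunit C" \<I> _ "\<iota> [True]"] opunit_hom incl_hom[of "[True]"] by (simp add: mask_op_simps)
  show "gamma mask_op js \<in> hom V (arity mask_op (length js) \<otimes> tens_arities V mask_op js) (arity mask_op (sum_list js))" for js
    using mask_gamma_props by (simp add: mask_op_simps)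
qed

lemma embed_closed: "Z \<in> Ob V \<Longrightarrow> p \<in> mask_points Z \<Longrightarrow> embed p \<in> B.points Z"
  using embed_hom by (simp add: B.points_def mask_op_simps embed_def)

lemma embed_set_closed: "Z \<in> Ob V \<Longrightarrow> set qs \<subseteq> mask_points Z \<Longrightarrow> set (map embed qs) \<subseteq> B.points Z"
  using embed_closed by auto

lemma embed_one: assumes "Z \<in> Ob V" shows "B.point_one Z = embed (mask_point_one Z)"
proof -
  have "(\<iota> [True] \<cdot> opunit C) \<cdot> to_unit V Z = \<iota> [True] \<cdot> opunit C \<cdot> to_unit V Z"
    using Comp_assoc[OF to_unit_hom[OF assms] opunit_hom] incl_hom[of "[True]"] by simp
  then show ?thesis
    unfolding set_operad.mask_one_def[OF points_set_operad[OF assms]]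
    by (simp add: B.point_one_def point_one_def embed_def mask_op_simps)
qed

text \<open>This is the equivariance of the inclusions of the summands, read on points.\<close>

lemma embed_act:
  assumes Z: "Z \<in> Ob V" and p: "p \<in> mask_points Z" and \<sigma>: "\<sigma> \<in> Sym (length (fst p))"
  shows "B.point_act \<sigma> (embed p) = embed (mask_point_act \<sigma> p)"
proof -
  obtain m x where m: "p = (move_list \<sigma> m, x)"
    using move_list_inv(1)[OF \<sigma>] by (metis prod.collapse)
  have \<sigma>m: "\<sigma> \<in> Sym (length m)" using \<sigma> m by simp
  have w: "fst x = weight m" using mask_pointsD(1)[OF Z p] m weight_move_list[OF \<sigma>m] by simp
  have xh: "snd x \<in> hom V Z (summand m)" using mask_pointsD(2)[OF Z p] m weight_move_list[OF \<sigma>m] by simp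
  have ih: "\<iota> (move_list \<sigma> m) \<in> hom V (summand m) (fob B (length m))"
    using incl_hom[of "move_list \<sigma> m"] weight_move_list[OF \<sigma>m] by simp
  have "sact B (length m) \<sigma> \<cdot> \<iota> (move_list \<sigma> m) \<cdot> snd x = (sact B (length m) \<sigma> \<cdot> \<iota> (move_list \<sigma> m)) \<cdot> snd x"
    by (rule Comp_assoc[OF xh ih sact_hom[OF B_sequence \<sigma>m], symmetric])
  also have "\<dots> = \<iota> m \<cdot> sact (sseq C) (weight m) (restrict_perm \<sigma> m) \<cdot> snd x"
    unfolding incl_act[OF \<sigma>m] by (rule Comp_assoc[OF xh sact_hom[OF sseq restrict_perm_Sym[OF \<sigma>m]] incl_hom])
  finally show ?thesis
    by (simp add: m set_operad.mask_act_move[OF points_set_operad[OF Z] \<sigma>m] B.point_act_def point_act_def embed_def mask_op_simps w)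
qed

text \<open>The embedding of masked points is a homomorphism.  Together with \<open>embed_act\<close> and \<open>embed_one\<close> it carries the
axioms of \<open>mask_operad\<close> over to embedded points.\<close>

lemma embed_graft:
  assumes Z: "Z \<in> Ob V" and p: "p \<in> mask_points Z" and qs: "set qs \<subseteq> mask_points Z" and l: "length qs = length (fst p)"
  shows "B.point_graft Z (embed p) (map embed qs) = embed (mask_point_graft Z p qs)"
proof -
  define m ms where "m = fst p" and "ms = map fst qs"
  let ?js = "map length ms"
  have len: "length m = length ?js" "length ms = length m" using l by (simp_all add: m_def ms_def)
  let ?c = "pairing V (snd (snd p)) (tuple_list V Z (map (snd \<circ> snd) qs))"
  have fe: "map fst (map embed qs) = ?js" by (simp add: embed_def ms_def)
  have ch: "?c \<in> hom V Z (summand m \<otimes> tens_list V (map summand ms))"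
    using pairing_hom[OF mask_pointsD(2)[OF Z p] embed_tuple(1)[OF Z qs]] by (simp add: m_def ms_def)
  have th: "tens_mor V (\<iota> m) (tens_mor_list V (map \<iota> ms)) \<in>
      hom V (summand m \<otimes> tens_list V (map summand ms)) (fob B (length ?js) \<otimes> tens_list V (map (fob B) ?js))"
    using tens_mor_hom[OF incl_hom embed_tuple(2)[OF Z qs], of m] len by (simp add: ms_def comp_def)
  have gh: "mask_gamma ?js \<in> hom V (fob B (length ?js) \<otimes> tens_list V (map (fob B) ?js)) (fob B (sum_list ?js))"
    using mask_gamma_props by blast
  note sh = mask_gamma_summand_hom[OF len(1) refl]
  note sel = select_mor_hom[OF len(2)]
  have "mask_gamma ?js \<cdot> pairing V (snd (embed p)) (tuple_of Z (map embed qs)) =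
      (mask_gamma ?js \<cdot> tens_mor V (\<iota> m) (tens_mor_list V (map \<iota> ms))) \<cdot> ?c"
    using Comp_assoc[OF ch th gh] embed_pairing[OF Z p qs] by (simp add: m_def ms_def)
  also have "mask_gamma ?js \<cdot> tens_mor V (\<iota> m) (tens_mor_list V (map \<iota> ms)) =
      \<iota> (mask_comp m ms) \<cdot> gamma C (select m (map weight ms)) \<cdot> select_mor m ms"
    using mask_gamma_props len by blast
  also have "\<dots> \<cdot> ?c = \<iota> (mask_comp m ms) \<cdot> (gamma C (select m (map weight ms)) \<cdot> select_mor m ms) \<cdot> ?c"
    by (rule Comp_assoc[OF ch sh(1) incl_hom])
  also have "(gamma C (select m (map weight ms)) \<cdot> select_mor m ms) \<cdot> ?c = gamma C (select m (map weight ms)) \<cdot> select_mor m ms \<cdot> ?c"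
    by (rule Comp_assoc[OF ch sel(1) gamma_hom])
  also have "select_mor m ms \<cdot> ?c = pairing V (snd (snd p)) (tuple_of Z (select m (map snd qs)))"
    by (rule sel(2)[OF Z p qs]) (simp_all add: m_def ms_def)
  finally have "mask_gamma ?js \<cdot> pairing V (snd (embed p)) (tuple_of Z (map embed qs)) =
      \<iota> (mask_comp m ms) \<cdot> gamma C (select m (map weight ms)) \<cdot> pairing V (snd (snd p)) (tuple_of Z (select m (map snd qs)))" .
  moreover have "map fst (select m (map snd qs)) = select m (map weight ms)"
  proof -
    have "map fst (map snd qs) = map weight ms" using mask_pointsD(1)[OF Z] qs by (auto simp: ms_def)
    then show ?thesis by (simp only: map_select)
  qed
  ultimately show ?thesis
    using sh(2) unfolding B.point_graft_def fe
    by (simp add: embed_def set_operad.mask_graft_def[OF points_set_operad[OF Z]] point_graft_def mask_op_simps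
        m_def[symmetric] ms_def[symmetric])
qed

lemma mask_points_operad:
  assumes "Z \<in> Ob V"
  shows "set_operad (mask_points Z) (length \<circ> fst) (mask_point_one Z) (mask_point_graft Z) mask_point_act"
proof -
  have "set_operad.mask_ar = (length \<circ> fst :: bool list \<times> nat \<times> 'm \<Rightarrow> nat)"
    by (rule ext) (simp add: set_operad.mask_ar_def[OF points_set_operad[OF assms]])
  then show ?thesis using set_operad.mask_operad[OF points_set_operad[OF assms]] by simp
qed

lemma fst_embed: "fst (embed p) = length (fst p)"
  by (simp add: embed_def)

lemma embed_graft_assoc:
  assumes Z: "Z \<in> Ob V" and p: "p \<in> mask_points Z" and qs: "set qs \<subseteq> mask_points Z"
    and rss: "set (concat rss) \<subseteq> mask_points Z"
    and l: "length qs = length (fst p)" and lr: "map length rss = map (length \<circ> fst) qs"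
  shows "B.point_graft Z (B.point_graft Z (embed p) (map embed qs)) (map embed (concat rss)) =
    B.point_graft Z (embed p) (map2 (B.point_graft Z) (map embed qs) (map (map embed) rss))"
proof -
  interpret M: set_operad "mask_points Z" "length \<circ> fst" "mask_point_one Z" "mask_point_graft Z" mask_point_act
    by (rule mask_points_operad[OF Z])
  have l': "length qs = (length \<circ> fst) p" using l by simp
  have g: "mask_point_graft Z p qs \<in> mask_points Z" by (rule M.graft_closed[OF p qs l'])
  have lg: "length (concat rss) = length (fst (mask_point_graft Z p qs))"
    using M.ar_graft[OF p qs l'] lr by (simp add: length_concat)
  have len: "length rss = length qs" using map_eq_imp_length_eq[OF lr] .
  have li: "length (rss ! i) = length (fst (qs ! i))" if "i < length qs" for i
    using arg_cong[OF lr, of "\<lambda>xs. xs ! i"] that len by simp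
  have ri: "set (rss ! i) \<subseteq> mask_points Z" if "i < length qs" for i
    using rss that len by (metis UN_subset_iff nth_mem set_concat)
  have qi: "qs ! i \<in> mask_points Z" if "i < length qs" for i
    using qs that by (metis nth_mem subsetD)
  let ?ts = "map2 (mask_point_graft Z) qs rss"
  have ts: "set ?ts \<subseteq> mask_points Z"
    using M.graft_closed[OF qi ri] li len by (auto simp: set_zip)
  have lt: "length ?ts = length (fst p)" using l len by simp
  have e: "map embed ?ts = map2 (B.point_graft Z) (map embed qs) (map (map embed) rss)"
    using embed_graft[OF Z qi ri li] len by (intro nth_equalityI) auto
  have "B.point_graft Z (B.point_graft Z (embed p) (map embed qs)) (map embed (concat rss)) =
      embed (mask_point_graft Z (mask_point_graft Z p qs) (concat rss))"
    unfolding embed_graft[OF Z p qs l] by (rule embed_graft[OF Z g rss lg])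
  also have "mask_point_graft Z (mask_point_graft Z p qs) (concat rss) = mask_point_graft Z p ?ts"
    by (rule M.graft_assoc[OF p qs rss l' lr])
  also have "embed \<dots> = B.point_graft Z (embed p) (map embed ?ts)"
    by (rule embed_graft[OF Z p ts lt, symmetric])
  finally show ?thesis unfolding e .
qed

lemma embed_graft_one:
  assumes Z: "Z \<in> Ob V" and p: "p \<in> mask_points Z"
  shows "B.point_graft Z (B.point_one Z) [embed p] = embed p"
    and "B.point_graft Z (embed p) (replicate (length (fst p)) (B.point_one Z)) = embed p"
proof -
  interpret M: set_operad "mask_points Z" "length \<circ> fst" "mask_point_one Z" "mask_point_graft Z" mask_point_act
    by (rule mask_points_operad[OF Z])
  have o: "length [p] = length (fst (mask_point_one Z))" using M.ar_one by simp
  show "B.point_graft Z (B.point_one Z) [embed p] = embed p"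
    using embed_graft[OF Z M.one_closed _ o] p M.graft_one_left[OF p] by (simp add: embed_one[OF Z])
  have "set (replicate (length (fst p)) (mask_point_one Z)) \<subseteq> mask_points Z" using M.one_closed by auto
  from embed_graft[OF Z p this] show "B.point_graft Z (embed p) (replicate (length (fst p)) (B.point_one Z)) = embed p"
    using M.graft_one_right[OF p] by (simp add: embed_one[OF Z])
qed

lemma embed_graft_act_outer:
  assumes Z: "Z \<in> Ob V" and p: "p \<in> mask_points Z" and qs: "set qs \<subseteq> mask_points Z"
    and l: "length qs = length (fst p)" and \<sigma>: "\<sigma> \<in> Sym (length (fst p))"
  shows "B.point_graft Z (B.point_act \<sigma> (embed p)) (map embed qs) =
    B.point_act (block_perm \<sigma> (map (length \<circ> fst) qs)) (B.point_graft Z (embed p) (move_list \<sigma> (map embed qs)))"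
proof -
  interpret M: set_operad "mask_points Z" "length \<circ> fst" "mask_point_one Z" "mask_point_graft Z" mask_point_act
    by (rule mask_points_operad[OF Z])
  have \<sigma>': "\<sigma> \<in> Sym ((length \<circ> fst) p)" and l': "length qs = (length \<circ> fst) p" using \<sigma> l by simp_all
  have \<sigma>q: "\<sigma> \<in> Sym (length qs)" using \<sigma> l by simp
  have mq: "set (move_list \<sigma> qs) \<subseteq> mask_points Z" using qs set_move_list[OF \<sigma>q] by simp
  have lm: "length (move_list \<sigma> qs) = length (fst p)" using l by simp
  have lm': "length (move_list \<sigma> qs) = (length \<circ> fst) p" using l by simp
  have la: "length qs = length (fst (mask_point_act \<sigma> p))" using M.ar_act[OF p \<sigma>'] l by simp
  let ?b = "block_perm \<sigma> (map (length \<circ> fst) qs)"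
  have "sum_list (map (length \<circ> fst) (move_list \<sigma> qs)) = sum_list (map (length \<circ> fst) qs)"
    using sum_list_move_list[of \<sigma> "map (length \<circ> fst) qs"] \<sigma>q by (simp add: map_move_list)
  then have b: "?b \<in> Sym (length (fst (mask_point_graft Z p (move_list \<sigma> qs))))"
    using block_perm_Sym[of \<sigma> "map (length \<circ> fst) qs"] M.ar_graft[OF p mq lm'] \<sigma>q by simp
  have "B.point_graft Z (B.point_act \<sigma> (embed p)) (map embed qs) = embed (mask_point_graft Z (mask_point_act \<sigma> p) qs)"
    unfolding embed_act[OF Z p \<sigma>] by (rule embed_graft[OF Z M.act_closed[OF p \<sigma>'] qs la])
  also have "mask_point_graft Z (mask_point_act \<sigma> p) qs = mask_point_act ?b (mask_point_graft Z p (move_list \<sigma> qs))"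
    by (rule M.graft_act_outer[OF p qs l' \<sigma>'])
  also have "embed \<dots> = B.point_act ?b (B.point_graft Z (embed p) (map embed (move_list \<sigma> qs)))"
    unfolding embed_graft[OF Z p mq lm] by (rule embed_act[OF Z M.graft_closed[OF p mq lm'] b, symmetric])
  finally show ?thesis unfolding map_move_list[OF \<sigma>q] .
qed

lemma embed_graft_act_inner:
  assumes Z: "Z \<in> Ob V" and p: "p \<in> mask_points Z" and qs: "set qs \<subseteq> mask_points Z"
    and l: "length qs = length (fst p)" "length \<tau>s = length qs"
    and \<tau>: "\<And>i. i < length qs \<Longrightarrow> \<tau>s ! i \<in> Sym (length (fst (qs ! i)))"
  shows "B.point_graft Z (embed p) (map2 B.point_act \<tau>s (map embed qs)) =
    B.point_act (block_sum (map (length \<circ> fst) qs) \<tau>s) (B.point_graft Z (embed p) (map embed qs))"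
proof -
  interpret M: set_operad "mask_points Z" "length \<circ> fst" "mask_point_one Z" "mask_point_graft Z" mask_point_act
    by (rule mask_points_operad[OF Z])
  have l': "length qs = (length \<circ> fst) p" using l by simp
  have \<tau>': "\<tau>s ! i \<in> Sym ((length \<circ> fst) (qs ! i))" if "i < length qs" for i using \<tau>[OF that] by simp
  have qi: "qs ! i \<in> mask_points Z" if "i < length qs" for i
    using qs that by (metis nth_mem subsetD)
  let ?ts = "map2 mask_point_act \<tau>s qs" and ?b = "block_sum (map (length \<circ> fst) qs) \<tau>s"
  have ts: "set ?ts \<subseteq> mask_points Z"
    using M.act_closed[OF qi \<tau>'] l(2) by (auto simp: set_zip)
  have lt: "length ?ts = length (fst p)" using l by simp
  have e: "map embed ?ts = map2 B.point_act \<tau>s (map embed qs)"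
    using embed_act[OF Z qi \<tau>] l(2) by (intro nth_equalityI) auto
  have b: "?b \<in> Sym (length (fst (mask_point_graft Z p qs)))"
    using block_sum_Sym[of \<tau>s "map (length \<circ> fst) qs"] M.ar_graft[OF p qs l'] \<tau> l(2) by simp
  have "B.point_graft Z (embed p) (map embed ?ts) = embed (mask_point_graft Z p ?ts)"
    by (rule embed_graft[OF Z p ts lt])
  also have "mask_point_graft Z p ?ts = mask_point_act ?b (mask_point_graft Z p qs)"
    by (rule M.graft_act_inner[OF p qs l' l(2) \<tau>'])
  also have "embed \<dots> = B.point_act ?b (B.point_graft Z (embed p) (map embed qs))"
    unfolding embed_graft[OF Z p qs l(1)] by (rule embed_act[OF Z M.graft_closed[OF p qs l'] b, symmetric])
  finally show ?thesis unfolding e .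
qed

text \<open>The domains of the axioms are products of objects of \<open>B\<close> and copies of the unit object.  By distributivity,
equality of morphisms out of them can be tested on tuples of embedded masked points.\<close>

lemma pair_eqI:
  assumes "f \<in> hom V (arity mask_op k \<otimes> tens_arities V mask_op js) Y" "g \<in> hom V (arity mask_op k \<otimes> tens_arities V mask_op js) Y"
    and "\<And>Z p qs. Z \<in> Ob V \<Longrightarrow> p \<in> mask_points Z \<Longrightarrow> set qs \<subseteq> mask_points Z \<Longrightarrow>
      length (fst p) = k \<Longrightarrow> map (length \<circ> fst) qs = js \<Longrightarrow>
      f \<cdot> pairing V (snd (embed p)) (tuple_of Z (map embed qs)) =
      g \<cdot> pairing V (snd (embed p)) (tuple_of Z (map embed qs))"
  shows "f = g"
proof (rule coproduct_elements_eqI[OF pair_coproduct assms(1,2)[unfolded mask_op_simps]])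
  fix i Z c assume i: "i \<in> {m. length m = k} \<times> {ms. map length ms = js}"
    and c: "c \<in> hom V Z (case i of (m, ms) \<Rightarrow> summand m \<otimes> tens_list V (map summand ms))"
  obtain m ms where mi: "i = (m, ms)" "length m = k" "map length ms = js" using i by auto
  then have c: "c \<in> hom V Z (summand m \<otimes> tens_list V (map summand ms))" using c by simp
  have Z: "Z \<in> Ob V" using c hom_Ob by blast
  have "set (map summand ms) \<subseteq> Ob V" using arity_Ob by auto
  from pairing_eta[OF c arity_Ob tens_list_Ob[OF this]] obtain a d
    where ad: "a \<in> hom V Z (summand m)" "d \<in> hom V Z (tens_list V (map summand ms))" "c = pairing V a d" .
  from tens_mask_point[OF ad(2)] obtain qs
    where qs: "set qs \<subseteq> mask_points Z" "map fst qs = ms" "d = tuple_list V Z (map (snd \<circ> snd) qs)" .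
  note p = mask_pointsI[OF ad(1)]
  have "map (length \<circ> fst) qs = js" using qs(2) mi(3) by auto
  from assms(3)[OF Z p qs(1) _ this] show "f \<cdot> ((case i of (m, ms) \<Rightarrow> tens_mor V (\<iota> m) (tens_mor_list V (map \<iota> ms))) \<cdot> c) =
      g \<cdot> ((case i of (m, ms) \<Rightarrow> tens_mor V (\<iota> m) (tens_mor_list V (map \<iota> ms))) \<cdot> c)"
    using embed_pairing[OF Z p qs(1)] mi ad qs by simp
qed

lemma triple_eqI:
  assumes "f \<in> hom V ((arity mask_op k \<otimes> tens_arities V mask_op js) \<otimes> tens_arities V mask_op ks) Y"
    "g \<in> hom V ((arity mask_op k \<otimes> tens_arities V mask_op js) \<otimes> tens_arities V mask_op ks) Y"
    and "\<And>Z p qs rs. Z \<in> Ob V \<Longrightarrow> p \<in> mask_points Z \<Longrightarrow> set qs \<subseteq> mask_points Z \<Longrightarrow> set rs \<subseteq> mask_points Z \<Longrightarrow>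
      length (fst p) = k \<Longrightarrow> map (length \<circ> fst) qs = js \<Longrightarrow> map (length \<circ> fst) rs = ks \<Longrightarrow>
      f \<cdot> pairing V (pairing V (snd (embed p)) (tuple_of Z (map embed qs))) (tuple_of Z (map embed rs)) =
      g \<cdot> pairing V (pairing V (snd (embed p)) (tuple_of Z (map embed qs))) (tuple_of Z (map embed rs))"
  shows "f = g"
proof (rule coproduct_elements_eqI[OF triple_coproduct assms(1,2)[unfolded mask_op_simps]])
  fix i Z c assume i: "i \<in> ({m. length m = k} \<times> {ms. map length ms = js}) \<times> {ns. map length ns = ks}"
    and c: "c \<in> hom V Z (case i of (j, ns) \<Rightarrow>
      (case j of (m, ms) \<Rightarrow> summand m \<otimes> tens_list V (map summand ms)) \<otimes> tens_list V (map summand ns))"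
  obtain m ms ns where mi: "i = ((m, ms), ns)" "length m = k" "map length ms = js" "map length ns = ks" using i by auto
  let ?L = "\<lambda>ms. tens_list V (map summand ms)"
  have c: "c \<in> hom V Z ((summand m \<otimes> ?L ms) \<otimes> ?L ns)" using c mi by simp
  have Z: "Z \<in> Ob V" using c hom_Ob by blast
  have o: "summand m \<in> Ob V" "?L ms \<in> Ob V" "?L ns \<in> Ob V" "summand m \<otimes> ?L ms \<in> Ob V"
    using arity_Ob by (auto intro!: tens_list_Ob Tens_Ob)
  from pairing_eta[OF c o(4,3)] obtain b e
    where be: "b \<in> hom V Z (summand m \<otimes> ?L ms)" "e \<in> hom V Z (?L ns)" "c = pairing V b e" .
  from pairing_eta[OF be(1) o(1,2)] obtain a d
    where ad: "a \<in> hom V Z (summand m)" "d \<in> hom V Z (?L ms)" "b = pairing V a d" .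
  from tens_mask_point[OF ad(2)] obtain qs
    where qs: "set qs \<subseteq> mask_points Z" "map fst qs = ms" "d = tuple_list V Z (map (snd \<circ> snd) qs)" .
  from tens_mask_point[OF be(2)] obtain rs
    where rs: "set rs \<subseteq> mask_points Z" "map fst rs = ns" "e = tuple_list V Z (map (snd \<circ> snd) rs)" .
  note p = mask_pointsI[OF ad(1)]
  have l: "map (length \<circ> fst) qs = js" "map (length \<circ> fst) rs = ks" using qs(2) rs(2) mi by auto
  have ih: "tens_mor V (\<iota> m) (tens_mor_list V (map \<iota> ms)) \<in> hom V (summand m \<otimes> ?L ms) (fob B (length m) \<otimes> tens_list V (map (fob B) (map (length \<circ> fst) qs)))"
    "tens_mor_list V (map \<iota> ns) \<in> hom V (?L ns) (tens_list V (map (fob B) (map (length \<circ> fst) rs)))"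
    using tens_mor_hom[OF incl_hom embed_tuple(2)[OF Z qs(1)]] embed_tuple(2)[OF Z rs(1)] qs(2) rs(2) by simp_all
  have "tens_mor V (tens_mor V (\<iota> m) (tens_mor_list V (map \<iota> ms))) (tens_mor_list V (map \<iota> ns)) \<cdot> c =
     pairing V (pairing V (snd (embed (m, weight m, a))) (tuple_of Z (map embed qs))) (tuple_of Z (map embed rs))"
    using tens_mor_pairing[OF ih be(1,2)] embed_pairing[OF Z p qs(1)] embed_tuple(3)[OF Z rs(1)] qs(2,3) rs(2,3) ad(3) be(3)
    by simp
  then show "f \<cdot> ((case i of (j, ns) \<Rightarrow> tens_mor V (case j of (m, ms) \<Rightarrow> tens_mor V (\<iota> m) (tens_mor_list V (map \<iota> ms))) (tens_mor_list V (map \<iota> ns))) \<cdot> c) =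
      g \<cdot> ((case i of (j, ns) \<Rightarrow> tens_mor V (case j of (m, ms) \<Rightarrow> tens_mor V (\<iota> m) (tens_mor_list V (map \<iota> ms))) (tens_mor_list V (map \<iota> ns))) \<cdot> c)"
    using assms(3)[OF Z p qs(1) rs(1) _ l] mi by simp
qed

lemma unit_left_eqI:
  assumes "f \<in> hom V (\<I> \<otimes> tens_arities V mask_op js) Y" "g \<in> hom V (\<I> \<otimes> tens_arities V mask_op js) Y"
    and "\<And>Z qs. Z \<in> Ob V \<Longrightarrow> set qs \<subseteq> mask_points Z \<Longrightarrow> map (length \<circ> fst) qs = js \<Longrightarrow>
      f \<cdot> pairing V (to_unit V Z) (tuple_of Z (map embed qs)) =
      g \<cdot> pairing V (to_unit V Z) (tuple_of Z (map embed qs))"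
  shows "f = g"
proof (rule coproduct_elements_eqI[OF coproduct_tens_left[OF closed list_coproduct UnitOb_Ob] assms(1,2)[unfolded mask_op_simps]])
  fix ms Z c assume ms: "ms \<in> {ms. map length ms = js}" and c: "c \<in> hom V Z (\<I> \<otimes> tens_list V (map summand ms))"
  have Z: "Z \<in> Ob V" using c hom_Ob by blast
  have "set (map summand ms) \<subseteq> Ob V" using arity_Ob by auto
  from pairing_eta[OF c UnitOb_Ob tens_list_Ob[OF this]] obtain a d
    where ad: "a \<in> hom V Z \<I>" "d \<in> hom V Z (tens_list V (map summand ms))" "c = pairing V a d" .
  from tens_mask_point[OF ad(2)] obtain qs
    where qs: "set qs \<subseteq> mask_points Z" "map fst qs = ms" "d = tuple_list V Z (map (snd \<circ> snd) qs)" .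
  have l: "map (length \<circ> fst) qs = js" using qs(2) ms by auto
  have ih: "tens_mor_list V (map \<iota> ms) \<in> hom V (tens_list V (map summand ms)) (tens_list V (map (fob B) (map (length \<circ> fst) qs)))"
    using embed_tuple(2)[OF Z qs(1)] qs(2) by simp
  have "tens_mor V (Ident V \<I>) (tens_mor_list V (map \<iota> ms)) \<cdot> c = pairing V (to_unit V Z) (tuple_of Z (map embed qs))"
    using tens_mor_pairing[OF Ident_hom[OF UnitOb_Ob] ih ad(1,2)] embed_tuple(3)[OF Z qs(1)] qs(2,3) ad(3)
      Comp_Ident_left[OF ad(1)] to_unit_unique[OF ad(1)] by simp
  then show "f \<cdot> (tens_mor V (Ident V \<I>) (tens_mor_list V (map \<iota> ms)) \<cdot> c) = g \<cdot> (tens_mor V (Ident V \<I>) (tens_mor_list V (map \<iota> ms)) \<cdot> c)"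
    using assms(3)[OF Z qs(1) l] by simp
qed

lemma unit_right_eqI:
  assumes "f \<in> hom V (arity mask_op k \<otimes> tens_list V (replicate n \<I>)) Y" "g \<in> hom V (arity mask_op k \<otimes> tens_list V (replicate n \<I>)) Y"
    and "\<And>Z p. Z \<in> Ob V \<Longrightarrow> p \<in> mask_points Z \<Longrightarrow> length (fst p) = k \<Longrightarrow>
      f \<cdot> pairing V (snd (embed p)) (tuple_list V Z (replicate n (to_unit V Z))) =
      g \<cdot> pairing V (snd (embed p)) (tuple_list V Z (replicate n (to_unit V Z)))"
  shows "f = g"
proof -
  have o: "set (replicate n \<I>) \<subseteq> Ob V" using UnitOb_Ob by auto
  note W = tens_list_Ob[OF o]
  show ?thesis
  proof (rule coproduct_elements_eqI[OF coproduct_tens_right[OF closed incl_coproduct W] assms(1,2)[unfolded mask_op_simps]])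
    fix m Z c assume m: "m \<in> {m. length m = k}" and c: "c \<in> hom V Z (summand m \<otimes> tens_list V (replicate n \<I>))"
    have Z: "Z \<in> Ob V" using c hom_Ob by blast
    from pairing_eta[OF c arity_Ob W] obtain a d
      where ad: "a \<in> hom V Z (summand m)" "d \<in> hom V Z (tens_list V (replicate n \<I>))" "c = pairing V a d" .
    from tuple_list_eta[OF ad(2) o] obtain cs where cs: "elements Z cs (replicate n \<I>)" "d = tuple_list V Z cs" .
    have "cs = replicate n (to_unit V Z)"
      using cs(1) to_unit_unique by (intro nth_equalityI) (auto simp: list_all2_conv_all_nth)
    then have "tens_mor V (\<iota> m) (Ident V (tens_list V (replicate n \<I>))) \<cdot> c =
        pairing V (snd (embed (m, weight m, a))) (tuple_list V Z (replicate n (to_unit V Z)))"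
      using tens_mor_pairing[OF incl_hom Ident_hom[OF W] ad(1,2)] Comp_Ident_left[OF ad(2)] ad(3) cs(2)
      by (simp add: embed_def)
    then show "f \<cdot> (tens_mor V (\<iota> m) (Ident V (tens_list V (replicate n \<I>))) \<cdot> c) =
        g \<cdot> (tens_mor V (\<iota> m) (Ident V (tens_list V (replicate n \<I>))) \<cdot> c)"
      using assms(3)[OF Z mask_pointsI[OF ad(1)]] m by simp
  qed
qed

text \<open>For each axiom, both sides are evaluated on embedded masked points, where the equation is already known.\<close>

theorem mask_op_operad: "symmetric_operad V mask_op"
proof unfold_locales
  have hom_left: "gamma mask_op js \<cdot> tens_mor V f g \<in> hom V (X \<otimes> Y) (arity mask_op (sum_list js))"
    if "f \<in> hom V X (arity mask_op (length js))" "g \<in> hom V Y (tens_arities V mask_op js)" for js f g X Y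
    using Comp_hom[OF tens_mor_hom[OF that] B.gamma_hom] .
  note iB = Ident_hom[OF B.arity_Ob] and iT = Ident_hom[OF B.tens_arities_Ob]
  have fe: "map fst (map embed qs) = map (length \<circ> fst) qs" for qs by (simp add: embed_def)
  {
    fix iss :: "nat list list"
    show "gamma mask_op (concat iss) \<cdot> tens_mor V (gamma mask_op (map length iss)) (Ident V (tens_arities V mask_op (concat iss))) =
         gamma mask_op (map sum_list iss) \<cdot> tens_mor V (Ident V (arity mask_op (length iss))) (tens_mor_list V (map (gamma mask_op) iss))
           \<cdot> operad_shuffle V mask_op iss" (is "?l = ?r")
    proof (rule triple_eqI[where k = "length iss" and js = "map length iss" and ks = "concat iss"])
      have g: "gamma mask_op (map length iss) \<in>
          hom V (arity mask_op (length iss) \<otimes> tens_arities V mask_op (map length iss)) (arity mask_op (length (concat iss)))"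
        using B.gamma_hom[of "map length iss"] by (simp add: length_concat)
      have sc: "sum_list (concat iss) = sum_list (map sum_list iss)" by (induction iss) auto
      show "?l \<in> hom V ((arity mask_op (length iss) \<otimes> tens_arities V mask_op (map length iss)) \<otimes> tens_arities V mask_op (concat iss))
          (arity mask_op (sum_list (map sum_list iss)))"
        using hom_left[OF g iT] unfolding sc .
      let ?L = "map2 (\<lambda>j is. arity mask_op j \<otimes> tens_arities V mask_op is) (map length iss) iss"
      have gl: "list_all2 (\<lambda>f (X, Y). f \<in> hom V X Y) (map (gamma mask_op) iss) (zip ?L (map (arity mask_op) (map sum_list iss)))"
        using B.gamma_hom by (auto simp: list_all2_conv_all_nth)
      have gh: "tens_mor_list V (map (gamma mask_op) iss) \<in> hom V (tens_list V ?L) (tens_arities V mask_op (map sum_list iss))"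
        by (rule tens_mor_list_hom[OF gl]) simp
      have ik: "Ident V (arity mask_op (length iss)) \<in> hom V (arity mask_op (length iss)) (arity mask_op (length (map sum_list iss)))"
        using iB by simp
      show "?r \<in> hom V ((arity mask_op (length iss) \<otimes> tens_arities V mask_op (map length iss)) \<otimes> tens_arities V mask_op (concat iss))
          (arity mask_op (sum_list (map sum_list iss)))"
        by (rule Comp_hom[OF Comp_hom[OF B.operad_shuffle_points(1) tens_mor_hom[OF ik gh]] B.gamma_hom])
      fix Z p qs rs assume Z: "Z \<in> Ob V" and p: "p \<in> mask_points Z" and qs: "set qs \<subseteq> mask_points Z"
        and rs: "set rs \<subseteq> mask_points Z" and lp: "length (fst p) = length iss"
        and lq: "map (length \<circ> fst) qs = map length iss" and lr: "map (length \<circ> fst) rs = concat iss"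
      \<comment> \<open>The points in the last factor form one list; it is cut along the arities of \<open>qs\<close>.\<close>
      have "length rs = sum_list (map length iss)"
        using arg_cong[OF lr, of length] by (simp only: length_map length_concat)
      then obtain rss where rss: "concat rss = rs" "map length rss = map length iss" by (rule concat_splitE)
      have len: "length qs = length (fst p)" using arg_cong[OF lq, of length] lp by simp
      have i: "iss = map (map fst) (map (map embed) rss)"
      proof (rule concat_injective[symmetric])
        show "concat (map (map fst) (map (map embed) rss)) = concat iss"
          using lr fe[of rs] unfolding rss(1)[symmetric] map_concat by simp
        show "length (map (map fst) (map (map embed) rss)) = length iss"
          using arg_cong[OF rss(2), of length] by simp
        have "length (rss ! k) = length (iss ! k)" if "k < length iss" for k
          using arg_cong[OF rss(2), of "\<lambda>xs. xs ! k"] arg_cong[OF rss(2), of length] that by simp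
        then show "\<forall>(x, y)\<in>set (zip (map (map fst) (map (map embed) rss)) iss). length x = length y"
          by (auto simp: set_zip)
      qed
      have rs': "set (concat rss) \<subseteq> mask_points Z" using rs rss by simp
      have c: "concat (map (map embed) rss) = map embed rs" using rss(1) by (simp add: map_concat[symmetric])
      have zs: "set (concat (map (map embed) rss)) \<subseteq> B.points Z" unfolding c by (rule embed_set_closed[OF Z rs])
      have l1: "length (map embed qs) = fst (embed p)" using len by (simp add: fst_embed)
      have l2: "map length (map (map embed) rss) = map fst (map embed qs)" using rss(2) lq unfolding fe by (simp add: comp_def)
      note pts = Z embed_closed[OF Z p] embed_set_closed[OF Z qs] zs l1 l2 i
      show "?l \<cdot> pairing V (pairing V (snd (embed p)) (tuple_of Z (map embed qs))) (tuple_of Z (map embed rs)) =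
          ?r \<cdot> pairing V (pairing V (snd (embed p)) (tuple_of Z (map embed qs))) (tuple_of Z (map embed rs))"
        using B.eval_assoc_left[OF pts] B.eval_assoc_right[OF pts] embed_graft_assoc[OF Z p qs rs' len] rss lq
        unfolding c by simp
    qed
  next
    fix j :: nat
    show "gamma mask_op [j] \<cdot> tens_mor V (opunit mask_op) (Ident V (tens_arities V mask_op [j])) =
         Pr1 V (arity mask_op j) \<I> \<cdot> Pr2 V \<I> (tens_arities V mask_op [j])" (is "?l = ?r")
    proof (rule unit_left_eqI[where js = "[j]"])
      have o: "opunit mask_op \<in> hom V \<I> (arity mask_op (length [j]))" using B.opunit_hom by simp
      show "?l \<in> hom V (\<I> \<otimes> tens_arities V mask_op [j]) (arity mask_op j)" using hom_left[OF o iT] by simp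
      have "Pr1 V (arity mask_op j) \<I> \<in> hom V (tens_arities V mask_op [j]) (arity mask_op j)"
        using Pr1_hom[OF B.arity_Ob UnitOb_Ob] by simp
      then show "?r \<in> hom V (\<I> \<otimes> tens_arities V mask_op [j]) (arity mask_op j)"
        by (rule Comp_hom[OF Pr2_hom[OF UnitOb_Ob B.tens_arities_Ob]])
      fix Z qs assume Z: "Z \<in> Ob V" and qs: "set qs \<subseteq> mask_points Z" and l: "map (length \<circ> fst) qs = [j]"
      obtain p where q: "qs = [p]" "length (fst p) = j" using l by (cases qs) auto
      then have p: "p \<in> mask_points Z" using qs by simp
      have j: "j = fst (embed p)" using q by (simp add: fst_embed)
      show "?l \<cdot> pairing V (to_unit V Z) (tuple_of Z (map embed qs)) =
          ?r \<cdot> pairing V (to_unit V Z) (tuple_of Z (map embed qs))"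
        using B.eval_unit_left[OF Z embed_closed[OF Z p] j] embed_graft_one(1)[OF Z p] unfolding q(1) by simp
    qed
  next
    fix k :: nat
    show "gamma mask_op (replicate k 1) \<cdot> tens_mor V (Ident V (arity mask_op k)) (tens_mor_list V (replicate k (opunit mask_op))) =
        Pr1 V (arity mask_op k) (tens_list V (replicate k \<I>))" (is "?l = ?r")
    proof (rule unit_right_eqI[where k = k and n = k])
      have ol: "list_all2 (\<lambda>f (X, Y). f \<in> hom V X Y) (replicate k (opunit mask_op)) (zip (replicate k \<I>) (replicate k (arity mask_op 1)))"
        using B.opunit_hom by (simp add: list_all2_conv_all_nth)
      have oh: "tens_mor_list V (replicate k (opunit mask_op)) \<in> hom V (tens_list V (replicate k \<I>)) (tens_arities V mask_op (replicate k 1))"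
        using tens_mor_list_hom[OF ol] by simp
      have ik: "Ident V (arity mask_op k) \<in> hom V (arity mask_op k) (arity mask_op (length (replicate k 1)))" using iB by simp
      show "?l \<in> hom V (arity mask_op k \<otimes> tens_list V (replicate k \<I>)) (arity mask_op k)"
        using hom_left[OF ik oh] by (simp add: sum_list_replicate)
      have "set (replicate k \<I>) \<subseteq> Ob V" using UnitOb_Ob by auto
      then show "?r \<in> hom V (arity mask_op k \<otimes> tens_list V (replicate k \<I>)) (arity mask_op k)"
        by (rule Pr1_hom[OF B.arity_Ob tens_list_Ob])
      fix Z p assume Z: "Z \<in> Ob V" and p: "p \<in> mask_points Z" and l: "length (fst p) = k"
      have k: "k = fst (embed p)" using l by (simp add: fst_embed)
      show "?l \<cdot> pairing V (snd (embed p)) (tuple_list V Z (replicate k (to_unit V Z))) =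
          ?r \<cdot> pairing V (snd (embed p)) (tuple_list V Z (replicate k (to_unit V Z)))"
        using B.eval_unit_right[OF Z embed_closed[OF Z p] k] embed_graft_one(2)[OF Z p] unfolding l by simp
    qed
  next
    fix \<sigma> and js :: "nat list" assume \<sigma>: "\<sigma> \<in> Sym (length js)"
    show "gamma mask_op js \<cdot> tens_mor V (sact (sseq mask_op) (length js) \<sigma>) (Ident V (tens_arities V mask_op js)) =
        sact (sseq mask_op) (sum_list js) (block_perm \<sigma> js) \<cdot> gamma mask_op (move_list \<sigma> js)
         \<cdot> tens_mor V (Ident V (arity mask_op (length js))) (permute_factors V mask_op \<sigma> js)" (is "?l = ?r")
    proof (rule pair_eqI[where k = "length js" and js = js])
      show "?l \<in> hom V (arity mask_op (length js) \<otimes> tens_arities V mask_op js) (arity mask_op (sum_list js))"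
        by (rule hom_left[OF sact_hom[OF B.sseq \<sigma>] iT])
      have ik: "Ident V (arity mask_op (length js)) \<in> hom V (arity mask_op (length js)) (arity mask_op (length (move_list \<sigma> js)))" using iB by simp
      show "?r \<in> hom V (arity mask_op (length js) \<otimes> tens_arities V mask_op js) (arity mask_op (sum_list js))"
        using Comp_hom[OF hom_left[OF ik B.permute_factors_points(1)[OF \<sigma>]]] sact_hom[OF B.sseq block_perm_Sym[OF \<sigma>]]
        unfolding sum_list_move_list[OF \<sigma>] by blast
      fix Z p qs assume Z: "Z \<in> Ob V" and p: "p \<in> mask_points Z" and qs: "set qs \<subseteq> mask_points Z"
        and lp: "length (fst p) = length js" and lq: "map (length \<circ> fst) qs = js"
      have len: "length qs = length (fst p)" using lp arg_cong[OF lq, of length] by simp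
      have js: "js = map fst (map embed qs)" using lq unfolding fe by simp
      have l1: "length (map embed qs) = fst (embed p)" using len by (simp add: fst_embed)
      note pts = Z embed_closed[OF Z p] embed_set_closed[OF Z qs] l1 js \<sigma>
      show "?l \<cdot> pairing V (snd (embed p)) (tuple_of Z (map embed qs)) =
          ?r \<cdot> pairing V (snd (embed p)) (tuple_of Z (map embed qs))"
        using embed_graft_act_outer[OF Z p qs len] \<sigma> lp lq
        unfolding B.eval_outer_left[OF pts] B.eval_outer_right[OF pts] by simp
    qed
  next
    fix \<tau>s and js :: "nat list"
    assume \<tau>: "length \<tau>s = length js" "\<And>s. s < length js \<Longrightarrow> \<tau>s ! s \<in> Sym (js ! s)"
    show "gamma mask_op js \<cdot> tens_mor V (Ident V (arity mask_op (length js))) (tens_mor_list V (map2 (sact (sseq mask_op)) js \<tau>s)) =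
       sact (sseq mask_op) (sum_list js) (block_sum js \<tau>s) \<cdot> gamma mask_op js" (is "?l = ?r")
    proof (rule pair_eqI[where k = "length js" and js = js])
      have sl: "list_all2 (\<lambda>f (X, Y). f \<in> hom V X Y) (map2 (sact (sseq mask_op)) js \<tau>s) (zip (map (arity mask_op) js) (map (arity mask_op) js))"
        using \<tau> sact_hom[OF B.sseq] by (auto simp: list_all2_conv_all_nth)
      show "?l \<in> hom V (arity mask_op (length js) \<otimes> tens_arities V mask_op js) (arity mask_op (sum_list js))"
        by (rule hom_left[OF iB tens_mor_list_hom[OF sl refl]])
      show "?r \<in> hom V (arity mask_op (length js) \<otimes> tens_arities V mask_op js) (arity mask_op (sum_list js))"
        by (rule Comp_hom[OF B.gamma_hom sact_hom[OF B.sseq block_sum_Sym[OF \<tau>]]])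
      fix Z p qs assume Z: "Z \<in> Ob V" and p: "p \<in> mask_points Z" and qs: "set qs \<subseteq> mask_points Z"
        and lp: "length (fst p) = length js" and lq: "map (length \<circ> fst) qs = js"
      have lj: "length qs = length js" using arg_cong[OF lq, of length] by simp
      have len: "length qs = length (fst p)" using lp lj by simp
      have js: "js = map fst (map embed qs)" using lq unfolding fe by simp
      have l1: "length (map embed qs) = fst (embed p)" using len by (simp add: fst_embed)
      note pts = Z embed_closed[OF Z p] embed_set_closed[OF Z qs] l1 js \<tau>
      have \<tau>q: "\<tau>s ! i \<in> Sym (length (fst (qs ! i)))" if "i < length qs" for i
        using \<tau>(2)[of i] arg_cong[OF lq, of "\<lambda>xs. xs ! i"] that lj by simp
      have l\<tau>: "length \<tau>s = length qs" using \<tau>(1) lj by simp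
      show "?l \<cdot> pairing V (snd (embed p)) (tuple_of Z (map embed qs)) =
          ?r \<cdot> pairing V (snd (embed p)) (tuple_of Z (map embed qs))"
        using B.eval_inner_left[OF pts] B.eval_inner_right[OF pts] embed_graft_act_inner[OF Z p qs len l\<tau> \<tau>q]
        unfolding lq by simp
    qed
  }
qed (rule B.sseq B.opunit_hom B.gamma_hom)+

end

section \<open>Day convolution\<close>

context category
begin

lemma balanced_tensor_eqI:
  assumes T: "is_balanced_tensor V X G act H lact Q q" and act: "\<And>g. g \<in> G \<Longrightarrow> act g \<in> hom V X X"
    and lact: "\<And>g h. g \<in> G \<Longrightarrow> h \<in> H \<Longrightarrow> lact g h \<in> H"
    and uv: "u \<in> hom V Q Z" "v \<in> hom V Q Z" "\<And>h. h \<in> H \<Longrightarrow> u \<cdot> q h = v \<cdot> q h"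
  shows "u = v"
proof -
  have q: "q h \<in> hom V X Q" if "h \<in> H" for h using T that by (simp add: is_balanced_tensor_def)
  have bal: "q h \<cdot> act g = q (lact g h)" if "g \<in> G" "h \<in> H" for g h using T that by (simp add: is_balanced_tensor_def)
  have "(u \<cdot> q h) \<cdot> act g = u \<cdot> q (lact g h)" if "g \<in> G" "h \<in> H" for g h
    using Comp_assoc[OF act[OF that(1)] q[OF that(2)] uv(1)] bal[OF that] by simp
  moreover have "u \<cdot> q h \<in> hom V X Z" if "h \<in> H" for h using Comp_hom q[OF that] uv(1) by blast
  ultimately have "\<exists>!w. w \<in> hom V Q Z \<and> (\<forall>h\<in>H. w \<cdot> q h = u \<cdot> q h)"
    using T hom_Ob(2)[OF uv(1)] unfolding is_balanced_tensor_def by (elim conjE) (drule bspec, assumption, simp)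
  then obtain w0 where "\<And>w. w \<in> hom V Q Z \<and> (\<forall>h\<in>H. w \<cdot> q h = u \<cdot> q h) \<Longrightarrow> w = w0" by blast
  from this[of u] this[of v] show ?thesis using uv by simp
qed

lemma balanced_tensor_exists:
  assumes T: "is_balanced_tensor V X G act H lact Q q" and Z: "Z \<in> Ob V"
    and z: "\<And>h. h \<in> H \<Longrightarrow> z h \<in> hom V X Z" "\<And>g h. g \<in> G \<Longrightarrow> h \<in> H \<Longrightarrow> z h \<cdot> act g = z (lact g h)"
  obtains u where "u \<in> hom V Q Z" "\<And>h. h \<in> H \<Longrightarrow> u \<cdot> q h = z h"
proof -
  have "\<exists>!u. u \<in> hom V Q Z \<and> (\<forall>h\<in>H. u \<cdot> q h = z h)"
    using T Z z unfolding is_balanced_tensor_def by (elim conjE) (drule bspec, assumption, simp)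
  then show ?thesis using that by blast
qed

lemma symmetric_sequenceI:
  assumes "\<And>n. fob F n \<in> Ob V" "\<And>n \<sigma>. \<sigma> \<in> Sym n \<Longrightarrow> sact F n \<sigma> \<in> hom V (fob F n) (fob F n)"
    "\<And>n. sact F n id = Ident V (fob F n)"
    "\<And>n \<sigma> \<tau>. \<sigma> \<in> Sym n \<Longrightarrow> \<tau> \<in> Sym n \<Longrightarrow> sact F n (\<sigma> \<circ> \<tau>) = sact F n \<tau> \<cdot> sact F n \<sigma>"
  shows "symmetric_sequence V F"
  using assms by (auto simp: symmetric_sequence_def is_functor_def opposite_def Sigma_cat_def)

end

context cartesian_monoidal_category
begin

definition day_act :: "('o, 'm) sseq \<Rightarrow> ('o, 'm) sseq \<Rightarrow> nat \<times> nat \<Rightarrow> (nat \<Rightarrow> nat) \<times> (nat \<Rightarrow> nat) \<Rightarrow> 'm" where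
  "day_act D E p g = tens_mor V (sact D (fst p) (fst g)) (sact E (snd p) (snd g))"

abbreviation day_tensor where
  "day_tensor D E p T t \<equiv> is_balanced_tensor V (fob D (fst p) \<otimes> fob E (snd p))
     (Sym (fst p) \<times> Sym (snd p)) (day_act D E p)
     (Sym (fst p + snd p)) (\<lambda>(\<sigma>, \<rho>) \<tau>. block_sum [fst p, snd p] [\<sigma>, \<rho>] \<circ> \<tau>) T t"

lemma day_act_hom:
  assumes "symmetric_sequence V D" "symmetric_sequence V E" "g \<in> Sym (fst p) \<times> Sym (snd p)"
  shows "day_act D E p g \<in> hom V (fob D (fst p) \<otimes> fob E (snd p)) (fob D (fst p) \<otimes> fob E (snd p))"
  using assms by (auto simp: day_act_def intro!: tens_mor_hom sact_hom)

text \<open>The same condition with a pair \<open>p = (j, k)\<close> as index, so that choices can be made for all \<open>p\<close> at once.\<close>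

lemma is_day_convolution_iff:
  "is_day_convolution V D E F \<longleftrightarrow> symmetric_sequence V F \<and>
     (\<forall>n. \<exists>T t incl. (\<forall>p \<in> {(j, k). j + k = n}. day_tensor D E p (T p) (t p)) \<and>
        is_coproduct V {(j, k). j + k = n} T (fob F n) incl \<and>
        (\<forall>p \<in> {(j, k). j + k = n}. \<forall>\<tau>\<in>Sym n. \<forall>\<sigma>\<in>Sym n.
           sact F n \<sigma> \<cdot> (incl p \<cdot> t p \<tau>) = incl p \<cdot> t p (\<tau> \<circ> \<sigma>)))"
proof -
  have "(\<lambda>(\<sigma>, \<rho>). tens_mor V (sact D j \<sigma>) (sact E k \<rho>)) = day_act D E (j, k)" for j k
    by (auto simp: day_act_def)
  then show ?thesis unfolding is_day_convolution_def by (simp cong: conj_cong)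
qed

text \<open>Left multiplication by \<open>Sym j \<times> Sym k\<close> commutes with right multiplication on \<open>Sym n\<close>.  Hence replacing \<open>\<tau>\<close> by
\<open>\<tau> \<circ> \<sigma>\<close> in the structure maps gives another balanced family, and universality turns it into the action of
\<open>\<sigma>\<close>.\<close>

lemma day_convolution_exists:
  assumes D: "symmetric_sequence V D" and E: "symmetric_sequence V E"
    and tens: "\<And>p. \<exists>T t. day_tensor D E p T t"
    and coprod: "\<And>n (T :: nat \<times> nat \<Rightarrow> 'o). (\<And>p. T p \<in> Ob V) \<Longrightarrow> \<exists>Q incl. is_coproduct V {(j, k). j + k = n} T Q incl"
  obtains F where "is_day_convolution V D E F"
proof -
  obtain T t where t: "\<And>p. day_tensor D E p (T p) (t p)" using tens by metis
  then have TO: "T p \<in> Ob V" for p by (simp add: is_balanced_tensor_def)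
  then obtain Q incl where Q: "\<And>n. is_coproduct V {(j, k). j + k = n} T (Q n) (incl n)"
    using coprod by metis
  have QO: "Q n \<in> Ob V" for n using Q by (simp add: is_coproduct_def)
  have th: "t p \<tau> \<in> hom V (fob D (fst p) \<otimes> fob E (snd p)) (T p)" if "\<tau> \<in> Sym (fst p + snd p)" for p \<tau>
    using t[of p] that by (simp add: is_balanced_tensor_def)
  have bal: "t p \<tau> \<cdot> day_act D E p (\<sigma>, \<rho>) = t p (block_sum [fst p, snd p] [\<sigma>, \<rho>] \<circ> \<tau>)"
    if "\<sigma> \<in> Sym (fst p)" "\<rho> \<in> Sym (snd p)" "\<tau> \<in> Sym (fst p + snd p)" for p \<sigma> \<rho> \<tau>
    using t[of p] that by (auto simp: is_balanced_tensor_def)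
  have ih: "incl n p \<in> hom V (T p) (Q n)" if "fst p + snd p = n" for n p
    by (cases p) (use coproduct_hom[OF Q, of p n] that in auto)
  note act = day_act_hom[OF D E]
  have eqI: "u = v" if u: "u \<in> hom V (Q n) Z" and v: "v \<in> hom V (Q n) Z"
    and uv: "\<And>p \<tau>. fst p + snd p = n \<Longrightarrow> \<tau> \<in> Sym n \<Longrightarrow> u \<cdot> (incl n p \<cdot> t p \<tau>) = v \<cdot> (incl n p \<cdot> t p \<tau>)" for n u v Z
  proof (rule coproduct_eqI[OF Q u v])
    fix p assume "p \<in> {(j, k). j + k = n}"
    then have p: "fst p + snd p = n" by auto
    show "u \<cdot> incl n p = v \<cdot> incl n p"
    proof (rule balanced_tensor_eqI[OF t act])
      show "u \<cdot> incl n p \<in> hom V (T p) Z" "v \<cdot> incl n p \<in> hom V (T p) Z" 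
        using Comp_hom[OF ih[OF p]] u v by blast+
      show "(u \<cdot> incl n p) \<cdot> t p \<tau> = (v \<cdot> incl n p) \<cdot> t p \<tau>" if \<tau>: "\<tau> \<in> Sym (fst p + snd p)" for \<tau>
        unfolding Comp_assoc[OF th[OF \<tau>] ih[OF p] u] Comp_assoc[OF th[OF \<tau>] ih[OF p] v]
        by (rule uv[OF p]) (use \<tau> p in simp)
    qed (auto intro: comp_Sym block_sum2_Sym)
  qed
  have ex: "\<exists>a. a \<in> hom V (Q n) (Q n) \<and> (\<forall>p \<tau>. fst p + snd p = n \<longrightarrow> \<tau> \<in> Sym n \<longrightarrow>
      a \<cdot> (incl n p \<cdot> t p \<tau>) = incl n p \<cdot> t p (\<tau> \<circ> \<sigma>))" if \<sigma>: "\<sigma> \<in> Sym n" for n \<sigma>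
  proof -
    have "\<exists>b. b \<in> hom V (T p) (Q n) \<and> (\<forall>\<tau> \<in> Sym n. b \<cdot> t p \<tau> = incl n p \<cdot> t p (\<tau> \<circ> \<sigma>))"
      if p: "p \<in> {(j, k). j + k = n}" for p
    proof -
      have p: "fst p + snd p = n" using p by auto
      have c: "\<tau> \<circ> \<sigma> \<in> Sym (fst p + snd p)" if "\<tau> \<in> Sym n" for \<tau> using that \<sigma> p comp_Sym by simp
      have h: "incl n p \<cdot> t p (\<tau> \<circ> \<sigma>) \<in> hom V (fob D (fst p) \<otimes> fob E (snd p)) (Q n)" if "\<tau> \<in> Sym (fst p + snd p)" for \<tau>
        using Comp_hom[OF th[OF c] ih[OF p]] that p by simp
      have b: "(incl n p \<cdot> t p (\<tau> \<circ> \<sigma>)) \<cdot> day_act D E p g = incl n p \<cdot> t p ((case g of (\<sigma>, \<rho>) \<Rightarrow> \<lambda>\<tau>. block_sum [fst p, snd p] [\<sigma>, \<rho>] \<circ> \<tau>) \<tau> \<circ> \<sigma>)"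
        if g: "g \<in> Sym (fst p) \<times> Sym (snd p)" and \<tau>: "\<tau> \<in> Sym (fst p + snd p)" for g \<tau>
      proof -
        have \<tau>n: "\<tau> \<in> Sym n" using \<tau> p by simp
        obtain \<sigma>' \<rho> where g': "g = (\<sigma>', \<rho>)" "\<sigma>' \<in> Sym (fst p)" "\<rho> \<in> Sym (snd p)" using g by auto
        have "(incl n p \<cdot> t p (\<tau> \<circ> \<sigma>)) \<cdot> day_act D E p g = incl n p \<cdot> (t p (\<tau> \<circ> \<sigma>) \<cdot> day_act D E p g)"
          by (rule Comp_assoc[OF act[OF g] th[OF c[OF \<tau>n]] ih[OF p]])
        also have "t p (\<tau> \<circ> \<sigma>) \<cdot> day_act D E p g = t p (block_sum [fst p, snd p] [\<sigma>', \<rho>] \<circ> (\<tau> \<circ> \<sigma>))"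
          unfolding g'(1) by (rule bal[OF g'(2,3) c[OF \<tau>n]])
        finally show ?thesis unfolding g'(1) by (simp only: prod.case comp_assoc)
      qed
      show ?thesis
        using balanced_tensor_exists[OF t QO, of p "\<lambda>\<tau>. incl n p \<cdot> t p (\<tau> \<circ> \<sigma>)" n, OF h b] p by metis
    qed
    then obtain b where b: "\<And>p. p \<in> {(j, k). j + k = n} \<Longrightarrow> b p \<in> hom V (T p) (Q n)"
      "\<And>p \<tau>. p \<in> {(j, k). j + k = n} \<Longrightarrow> \<tau> \<in> Sym n \<Longrightarrow> b p \<cdot> t p \<tau> = incl n p \<cdot> t p (\<tau> \<circ> \<sigma>)" by metis
    obtain a where a: "a \<in> hom V (Q n) (Q n)" "\<And>p. p \<in> {(j, k). j + k = n} \<Longrightarrow> a \<cdot> incl n p = b p"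
      using coproduct_exists[OF Q QO, of n b n] b(1) by metis
    have "a \<cdot> (incl n p \<cdot> t p \<tau>) = incl n p \<cdot> t p (\<tau> \<circ> \<sigma>)" if p: "fst p + snd p = n" and \<tau>: "\<tau> \<in> Sym n" for p \<tau>
    proof -
      have p': "p \<in> {(j, k). j + k = n}" using p by auto
      have "t p \<tau> \<in> hom V (fob D (fst p) \<otimes> fob E (snd p)) (T p)" using th \<tau> p by simp
      from Comp_assoc[OF this ih[OF p] a(1)] show ?thesis using a(2)[OF p'] b(2)[OF p' \<tau>] by simp
    qed
    then show ?thesis using a(1) by blast
  qed
  define a where "a n \<sigma> = (SOME a. a \<in> hom V (Q n) (Q n) \<and> (\<forall>p \<tau>. fst p + snd p = n \<longrightarrow> \<tau> \<in> Sym n \<longrightarrow>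
      a \<cdot> (incl n p \<cdot> t p \<tau>) = incl n p \<cdot> t p (\<tau> \<circ> \<sigma>)))" for n \<sigma>
  have a: "a n \<sigma> \<in> hom V (Q n) (Q n)"
    and aeq: "\<And>p \<tau>. fst p + snd p = n \<Longrightarrow> \<tau> \<in> Sym n \<Longrightarrow>
      a n \<sigma> \<cdot> (incl n p \<cdot> t p \<tau>) = incl n p \<cdot> t p (\<tau> \<circ> \<sigma>)" if "\<sigma> \<in> Sym n" for n \<sigma>
    using someI_ex[OF ex[OF that]] unfolding a_def[symmetric] by blast+
  have inc: "incl n p \<cdot> t p \<tau> \<in> hom V (fob D (fst p) \<otimes> fob E (snd p)) (Q n)"
    if "fst p + snd p = n" "\<tau> \<in> Sym n" for n p \<tau>
    using Comp_hom[OF th ih[OF that(1)]] that by simp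
  define F where "F = \<lparr>fob = Q, fmor = (\<lambda>(n, \<sigma>). a n \<sigma>)\<rparr>"
  have "symmetric_sequence V F"
  proof (rule symmetric_sequenceI)
    show "sact F n id = Ident V (fob F n)" for n
    proof (rule eqI[of _ n "Q n"])
      show "sact F n id \<in> hom V (Q n) (Q n)" "Ident V (fob F n) \<in> hom V (Q n) (Q n)"
        using a id_Sym Ident_hom[OF QO] by (simp_all add: F_def)
      show "sact F n id \<cdot> (incl n p \<cdot> t p \<tau>) = Ident V (fob F n) \<cdot> (incl n p \<cdot> t p \<tau>)"
        if "fst p + snd p = n" "\<tau> \<in> Sym n" for p \<tau>
        using aeq[OF id_Sym that] Comp_Ident_left[OF inc[OF that]] by (simp add: F_def)
    qed
    show "sact F n (\<sigma> \<circ> \<tau>) = sact F n \<tau> \<cdot> sact F n \<sigma>" if st: "\<sigma> \<in> Sym n" "\<tau> \<in> Sym n" for n \<sigma> \<tau>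
    proof (rule eqI[of _ n "Q n"])
      show "sact F n (\<sigma> \<circ> \<tau>) \<in> hom V (Q n) (Q n)" "sact F n \<tau> \<cdot> sact F n \<sigma> \<in> hom V (Q n) (Q n)"
        using a[OF comp_Sym[OF st]] Comp_hom[OF a[OF st(1)] a[OF st(2)]] by (simp_all add: F_def)
      show "sact F n (\<sigma> \<circ> \<tau>) \<cdot> (incl n p \<cdot> t p \<rho>) = (sact F n \<tau> \<cdot> sact F n \<sigma>) \<cdot> (incl n p \<cdot> t p \<rho>)"
        if p: "fst p + snd p = n" "\<rho> \<in> Sym n" for p \<rho>
        using aeq[OF comp_Sym[OF st] p] aeq[OF st(1) p] aeq[OF st(2) p(1) comp_Sym[OF p(2) st(1)]]
          Comp_assoc[OF inc[OF p] a[OF st(1)] a[OF st(2)]] by (simp add: F_def comp_assoc)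
    qed
  qed (use a QO in \<open>auto simp: F_def\<close>)
  moreover have "\<exists>T t incl. (\<forall>p \<in> {(j, k). j + k = n}. day_tensor D E p (T p) (t p)) \<and>
        is_coproduct V {(j, k). j + k = n} T (fob F n) incl \<and>
        (\<forall>p \<in> {(j, k). j + k = n}. \<forall>\<tau>\<in>Sym n. \<forall>\<sigma>\<in>Sym n.
           sact F n \<sigma> \<cdot> (incl p \<cdot> t p \<tau>) = incl p \<cdot> t p (\<tau> \<circ> \<sigma>))" for n
    using t Q[of n] aeq[of _ n]
    by (intro exI[of _ T] exI[of _ t] exI[of _ "incl n"]) (auto simp: F_def)
  ultimately show ?thesis using that unfolding is_day_convolution_iff by blast
qed

section \<open>Day convolution with the commutativity operad\<close>

lemma Comm_sequence: "symmetric_sequence V (sseq (Comm V))"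
  by (rule symmetric_sequenceI) (simp_all add: Comm_def UnitOb_Ob Ident_hom Comp_Ident_left[OF Ident_hom])

text \<open>The inverse of the isomorphism \<open>X \<otimes> \<I> \<rightarrow> X\<close>.\<close>

definition unit_section :: "'o \<Rightarrow> 'm" where
  "unit_section X = pairing V (Ident V X) (to_unit V X)"

lemma unit_section_hom: "X \<in> Ob V \<Longrightarrow> unit_section X \<in> hom V X (X \<otimes> \<I>)"
  by (simp add: unit_section_def pairing_hom Ident_hom to_unit_hom)

lemma Pr1_unit_section: "X \<in> Ob V \<Longrightarrow> Pr1 V X \<I> \<cdot> unit_section X = Ident V X"
  by (simp add: unit_section_def Pr1_pairing[OF Ident_hom to_unit_hom])

lemma unit_section_Pr1:
  assumes X: "X \<in> Ob V" shows "unit_section X \<cdot> Pr1 V X \<I> = Ident V (X \<otimes> \<I>)"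
proof (rule tens_eqI)
  note p1 = Pr1_hom[OF X UnitOb_Ob] and p2 = Pr2_hom[OF X UnitOb_Ob] and s = unit_section_hom[OF X]
  note i = Ident_hom[OF Tens_Ob[OF X UnitOb_Ob]]
  show h: "unit_section X \<cdot> Pr1 V X \<I> \<in> hom V (X \<otimes> \<I>) (X \<otimes> \<I>)" by (rule Comp_hom[OF p1 s])
  show "Ident V (X \<otimes> \<I>) \<in> hom V (X \<otimes> \<I>) (X \<otimes> \<I>)" by (rule i)
  show "Pr1 V X \<I> \<cdot> unit_section X \<cdot> Pr1 V X \<I> = Pr1 V X \<I> \<cdot> Ident V (X \<otimes> \<I>)"
    using Comp_assoc[OF p1 s p1] Pr1_unit_section[OF X] Comp_Ident_left[OF p1] Comp_Ident_right[OF p1] by simp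
  show "Pr2 V X \<I> \<cdot> unit_section X \<cdot> Pr1 V X \<I> = Pr2 V X \<I> \<cdot> Ident V (X \<otimes> \<I>)"
    using to_unit_unique[OF Comp_hom[OF h p2]] to_unit_unique[OF Comp_hom[OF i p2]] by simp
qed (use X UnitOb_Ob in auto)

lemma unit_section_natural:
  assumes f: "f \<in> hom V X Y"
  shows "tens_mor V f (Ident V \<I>) \<cdot> unit_section X = unit_section Y \<cdot> f"
    and "f \<cdot> Pr1 V X \<I> = Pr1 V Y \<I> \<cdot> tens_mor V f (Ident V \<I>)"
proof -
  have o: "X \<in> Ob V" "Y \<in> Ob V" using f hom_Ob by blast+
  note i = Ident_hom[OF UnitOb_Ob] and p1 = Pr1_hom[OF o(1) UnitOb_Ob]
  show 1: "tens_mor V f (Ident V \<I>) \<cdot> unit_section X = unit_section Y \<cdot> f"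
    unfolding unit_section_def tens_mor_pairing[OF f i Ident_hom[OF o(1)] to_unit_hom[OF o(1)]]
      pairing_comp[OF Ident_hom[OF o(2)] to_unit_hom[OF o(2)] f]
    using to_unit_unique[OF Comp_hom[OF f to_unit_hom[OF o(2)]]] to_unit_unique[OF Comp_hom[OF to_unit_hom[OF o(1)] i]]
    by (simp add: Comp_Ident_right[OF f] Comp_Ident_left[OF f])
  note t = tens_mor_hom[OF f i] and s = unit_section_hom
  have "f \<cdot> Pr1 V X \<I> = (Pr1 V Y \<I> \<cdot> unit_section Y) \<cdot> f \<cdot> Pr1 V X \<I>"
    unfolding Pr1_unit_section[OF o(2)] Comp_Ident_left[OF Comp_hom[OF p1 f]] ..
  also have "\<dots> = Pr1 V Y \<I> \<cdot> unit_section Y \<cdot> f \<cdot> Pr1 V X \<I>"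
    by (rule Comp_assoc[OF Comp_hom[OF p1 f] s[OF o(2)] Pr1_hom[OF o(2) UnitOb_Ob]])
  also have "unit_section Y \<cdot> f \<cdot> Pr1 V X \<I> = tens_mor V f (Ident V \<I>) \<cdot> unit_section X \<cdot> Pr1 V X \<I>"
    using Comp_assoc[OF p1 f s[OF o(2)]] Comp_assoc[OF p1 s[OF o(1)] t] 1 by simp
  finally show "f \<cdot> Pr1 V X \<I> = Pr1 V Y \<I> \<cdot> tens_mor V f (Ident V \<I>)"
    unfolding unit_section_Pr1[OF o(1)] Comp_Ident_right[OF t] .
qed

lemma day_act_Comm: "day_act D (sseq (Comm V)) p g = tens_mor V (sact D (fst p) (fst g)) (Ident V \<I>)"
  by (simp add: day_act_def Comm_def)

text \<open>By \<open>factor_through_sorter\<close>, balancedness expresses the value at any permutation through the value at a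
sorting permutation.\<close>

lemma day_tensor_sorter:
  assumes D: "symmetric_sequence V D" and \<tau>: "\<tau> \<in> Sym (length m)" and m: "move_list \<tau> m = std_mask j k" "length m = j + k"
    and z: "z (sorter m) \<in> hom V (fob D j \<otimes> \<I>) Z"
    and bal: "\<And>\<sigma> \<rho> \<tau>. \<sigma> \<in> Sym j \<Longrightarrow> \<rho> \<in> Sym k \<Longrightarrow> \<tau> \<in> Sym (j + k) \<Longrightarrow>
      z \<tau> \<cdot> tens_mor V (sact D j \<sigma>) (Ident V \<I>) = z (block_sum [j, k] [\<sigma>, \<rho>] \<circ> \<tau>)"
  shows "z \<tau> = z (sorter m) \<cdot> tens_mor V (sact D j (restrict_perm \<tau> m)) (Ident V \<I>)"
    and "z \<tau> \<cdot> unit_section (fob D j) = (z (sorter m) \<cdot> unit_section (fob D j)) \<cdot> sact D j (restrict_perm \<tau> m)"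
proof -
  note f = factor_through_sorter[OF \<tau> m]
  show 1: "z \<tau> = z (sorter m) \<cdot> tens_mor V (sact D j (restrict_perm \<tau> m)) (Ident V \<I>)"
    using bal[OF f(2,3)] sorter_Sym[of m] m(2) f(1) by simp
  have o: "fob D j \<in> Ob V" by (rule symmetric_sequence_Ob[OF D])
  note s = sact_hom[OF D f(2)] and u = unit_section_hom[OF o]
  show "z \<tau> \<cdot> unit_section (fob D j) = (z (sorter m) \<cdot> unit_section (fob D j)) \<cdot> sact D j (restrict_perm \<tau> m)"
    unfolding 1 Comp_assoc[OF u tens_mor_hom[OF s Ident_hom[OF UnitOb_Ob]] z] unit_section_natural(1)[OF s]
      Comp_assoc[OF s u z] ..
qed

text \<open>Any morphisms out of \<open>D(j)\<close>, one for each subset with \<open>j\<close> elements, arise from a balanced family: a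
permutation \<open>\<tau>\<close> uses the subset that it moves to the front, twisted by the permutation induced on it.\<close>

lemma sorted_mask_balanced:
  fixes z :: "bool list \<Rightarrow> 'm"
  assumes D: "symmetric_sequence V D"
    and z: "\<And>m. length m = j + k \<Longrightarrow> weight m = j \<Longrightarrow> z m \<in> hom V (fob D j) Z"
  defines "y \<equiv> \<lambda>\<tau>. let m = sorted_mask j k \<tau> in z m \<cdot> sact D j (restrict_perm \<tau> m) \<cdot> Pr1 V (fob D j) \<I>"
  shows "\<And>\<tau>. \<tau> \<in> Sym (j + k) \<Longrightarrow> y \<tau> \<in> hom V (fob D j \<otimes> \<I>) Z"
    and "\<And>\<sigma> \<rho> \<tau>. \<sigma> \<in> Sym j \<Longrightarrow> \<rho> \<in> Sym k \<Longrightarrow> \<tau> \<in> Sym (j + k) \<Longrightarrow>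
      y \<tau> \<cdot> tens_mor V (sact D j \<sigma>) (Ident V \<I>) = y (block_sum [j, k] [\<sigma>, \<rho>] \<circ> \<tau>)"
    and "\<And>m. length m = j + k \<Longrightarrow> weight m = j \<Longrightarrow> y (sorter m) \<cdot> unit_section (fob D j) = z m"
proof -
  let ?X = "fob D j"
  have o: "?X \<in> Ob V" by (rule symmetric_sequence_Ob[OF D])
  note p1 = Pr1_hom[OF o UnitOb_Ob] and u = unit_section_hom[OF o]
  have y: "y \<tau> = z m \<cdot> sact D j (restrict_perm \<tau> m) \<cdot> Pr1 V ?X \<I>" "sact D j (restrict_perm \<tau> m) \<in> hom V ?X ?X"
    "z m \<in> hom V ?X Z" "restrict_perm \<tau> m \<in> Sym j"
    if "\<tau> \<in> Sym (j + k)" "length m = j + k" "move_list \<tau> m = std_mask j k" for \<tau> m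
  proof -
    have \<tau>: "\<tau> \<in> Sym (length m)" using that by simp
    note f = factor_through_sorter[OF \<tau> that(3,2)]
    show "restrict_perm \<tau> m \<in> Sym j" by (rule f)
    show "y \<tau> = z m \<cdot> sact D j (restrict_perm \<tau> m) \<cdot> Pr1 V ?X \<I>" unfolding y_def Let_def sorted_mask_eqI[OF \<tau> that(3)] ..
    show "sact D j (restrict_perm \<tau> m) \<in> hom V ?X ?X" by (rule sact_hom[OF D f(2)])
    show "z m \<in> hom V ?X Z" by (rule z[OF that(2) f(4)])
  qed
  show "y \<tau> \<in> hom V (?X \<otimes> \<I>) Z" if \<tau>: "\<tau> \<in> Sym (j + k)" for \<tau>
  proof -
    note m = y[OF \<tau> sorted_mask(1,2)[OF \<tau>]]
    show ?thesis unfolding m(1) by (rule Comp_hom[OF Comp_hom[OF p1 m(2)] m(3)])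
  qed
  show "y \<tau> \<cdot> tens_mor V (sact D j \<sigma>) (Ident V \<I>) = y (block_sum [j, k] [\<sigma>, \<rho>] \<circ> \<tau>)"
    if s: "\<sigma> \<in> Sym j" "\<rho> \<in> Sym k" "\<tau> \<in> Sym (j + k)" for \<sigma> \<rho> \<tau>
  proof -
    let ?m = "sorted_mask j k \<tau>" and ?b = "block_sum [j, k] [\<sigma>, \<rho>]"
    note m = sorted_mask(1,2)[OF s(3)] and b = block_sum2_Sym[OF s(1,2)]
    have bm: "move_list (?b \<circ> \<tau>) ?m = std_mask j k"
      using move_list_comp[of ?b ?m \<tau>] b s m move_list_block_sum_std_mask[OF s(1,2)] by simp
    have r: "restrict_perm (?b \<circ> \<tau>) ?m = \<sigma> \<circ> restrict_perm \<tau> ?m"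
      using restrict_perm_comp[of ?b ?m \<tau>] b s m restrict_perm_block_sum_std_mask[OF s(1,2)] by simp
    note t1 = y[OF s(3) m] and sh = sact_hom[OF D s(1)]
    note tm = tens_mor_hom[OF sh Ident_hom[OF UnitOb_Ob]]
    have "y \<tau> \<cdot> tens_mor V (sact D j \<sigma>) (Ident V \<I>) = z ?m \<cdot> (sact D j (restrict_perm \<tau> ?m) \<cdot> Pr1 V ?X \<I>) \<cdot> tens_mor V (sact D j \<sigma>) (Ident V \<I>)"
      unfolding t1(1) by (rule Comp_assoc[OF tm Comp_hom[OF p1 t1(2)] t1(3)])
    also have "(sact D j (restrict_perm \<tau> ?m) \<cdot> Pr1 V ?X \<I>) \<cdot> tens_mor V (sact D j \<sigma>) (Ident V \<I>) =
        sact D j (restrict_perm \<tau> ?m) \<cdot> sact D j \<sigma> \<cdot> Pr1 V ?X \<I>"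
      unfolding Comp_assoc[OF tm p1 t1(2)] unit_section_natural(2)[OF sh] ..
    also have "\<dots> = sact D j (restrict_perm (?b \<circ> \<tau>) ?m) \<cdot> Pr1 V ?X \<I>"
      unfolding r sact_comp[OF D s(1) t1(4)] by (rule Comp_assoc[OF p1 sh t1(2), symmetric])
    also have "z ?m \<cdot> \<dots> = y (?b \<circ> \<tau>)"
      by (rule y(1)[OF comp_Sym[OF b s(3)] m(1) bm, symmetric])
    finally show ?thesis .
  qed
  show "y (sorter m) \<cdot> unit_section ?X = z m" if m: "length m = j + k" "weight m = j" for m
  proof -
    have s: "sorter m \<in> Sym (j + k)" "move_list (sorter m) m = std_mask j k"
      using sorter_Sym[of m] move_list_sorter_self[of m] weight_Not[of m] m by simp_all
    have "y (sorter m) = z m \<cdot> Pr1 V ?X \<I>"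
      using y(1)[OF s(1) m(1) s(2)] sact_id[OF D, of j] Comp_Ident_left[OF p1] by (simp add: restrict_perm_sorter)
    then show ?thesis
      using Comp_assoc[OF u p1 z[OF m]] by (simp add: Pr1_unit_section[OF o] Comp_Ident_right[OF z[OF m]])
  qed
qed

lemma sorter_std_mask:
  assumes "length m = j + k" "weight m = j"
  shows "sorter m \<in> Sym (j + k)" "move_list (sorter m) m = std_mask j k"
  using sorter_Sym[of m] move_list_sorter_self[of m] weight_Not[of m] assms by simp_all

text \<open>By \<open>day_tensor_sorter\<close> the values at the sorting permutations give all values, up to the isomorphism
\<open>unit_section\<close>.\<close>

lemma balanced_determined:
  assumes D: "symmetric_sequence V D"
    and u: "\<And>\<tau>. \<tau> \<in> Sym (j + k) \<Longrightarrow> x \<tau> \<in> hom V (fob D j \<otimes> \<I>) Z"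
      "\<And>\<sigma> \<rho> \<tau>. \<sigma> \<in> Sym j \<Longrightarrow> \<rho> \<in> Sym k \<Longrightarrow> \<tau> \<in> Sym (j + k) \<Longrightarrow>
        x \<tau> \<cdot> tens_mor V (sact D j \<sigma>) (Ident V \<I>) = x (block_sum [j, k] [\<sigma>, \<rho>] \<circ> \<tau>)"
    and v: "\<And>\<tau>. \<tau> \<in> Sym (j + k) \<Longrightarrow> y \<tau> \<in> hom V (fob D j \<otimes> \<I>) Z"
      "\<And>\<sigma> \<rho> \<tau>. \<sigma> \<in> Sym j \<Longrightarrow> \<rho> \<in> Sym k \<Longrightarrow> \<tau> \<in> Sym (j + k) \<Longrightarrow>
        y \<tau> \<cdot> tens_mor V (sact D j \<sigma>) (Ident V \<I>) = y (block_sum [j, k] [\<sigma>, \<rho>] \<circ> \<tau>)"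
    and eq: "\<And>m. length m = j + k \<Longrightarrow> weight m = j \<Longrightarrow>
      x (sorter m) \<cdot> unit_section (fob D j) = y (sorter m) \<cdot> unit_section (fob D j)"
    and \<tau>: "\<tau> \<in> Sym (j + k)"
  shows "x \<tau> = y \<tau>"
proof -
  let ?m = "sorted_mask j k \<tau>" and ?X = "fob D j"
  have o: "?X \<in> Ob V" by (rule symmetric_sequence_Ob[OF D])
  note m = sorted_mask[OF \<tau>]
  have \<tau>m: "\<tau> \<in> Sym (length ?m)" using \<tau> m by simp
  note s = sorter_std_mask(1)[OF m(1,3)]
  have "x \<tau> \<cdot> unit_section ?X = (x (sorter ?m) \<cdot> unit_section ?X) \<cdot> sact D j (restrict_perm \<tau> ?m)"
    by (rule day_tensor_sorter(2)[OF D \<tau>m m(2,1), where z = x, OF u(1)[OF s]]) (rule u(2))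
  also have "\<dots> = y \<tau> \<cdot> unit_section ?X"
    unfolding eq[OF m(1,3)]
    by (rule day_tensor_sorter(2)[OF D \<tau>m m(2,1), where z = y, OF v(1)[OF s], symmetric]) (rule v(2))
  finally have "(x \<tau> \<cdot> unit_section ?X) \<cdot> Pr1 V ?X \<I> = (y \<tau> \<cdot> unit_section ?X) \<cdot> Pr1 V ?X \<I>" by simp
  then show ?thesis
    using Comp_assoc[OF Pr1_hom[OF o UnitOb_Ob] unit_section_hom[OF o] u(1)[OF \<tau>]]
      Comp_assoc[OF Pr1_hom[OF o UnitOb_Ob] unit_section_hom[OF o] v(1)[OF \<tau>]]
    by (simp add: unit_section_Pr1[OF o] Comp_Ident_right[OF u(1)[OF \<tau>]] Comp_Ident_right[OF v(1)[OF \<tau>]])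
qed

text \<open>A balanced family is a free choice of a morphism out of \<open>D(j)\<close> for every subset with \<open>j\<close> elements, so the sum
of copies of \<open>D(j)\<close> over these subsets has the universal property of the balanced tensor.\<close>

lemma day_tensor_Comm:
  assumes D: "symmetric_sequence V D" and \<kappa>: "is_coproduct V {m. length m = j + k \<and> weight m = j} (\<lambda>_. fob D j) T \<kappa>"
  defines "t \<equiv> \<lambda>\<tau>. let m = sorted_mask j k \<tau> in \<kappa> m \<cdot> sact D j (restrict_perm \<tau> m) \<cdot> Pr1 V (fob D j) \<I>"
  shows "day_tensor D (sseq (Comm V)) (j, k) T t"
proof -
  let ?X = "fob D j"
  have o: "?X \<in> Ob V" by (rule symmetric_sequence_Ob[OF D])
  note u = unit_section_hom[OF o]
  have TO: "T \<in> Ob V" using \<kappa> by (simp add: is_coproduct_def)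
  have \<kappa>h: "\<kappa> m \<in> hom V ?X T" if "length m = j + k" "weight m = j" for m using coproduct_hom[OF \<kappa>, of m] that by simp
  have th: "t \<tau> \<in> hom V (?X \<otimes> \<I>) T" if "\<tau> \<in> Sym (j + k)" for \<tau>
    unfolding t_def by (rule sorted_mask_balanced(1)[OF D \<kappa>h that])
  have bal: "t \<tau> \<cdot> tens_mor V (sact D j \<sigma>) (Ident V \<I>) = t (block_sum [j, k] [\<sigma>, \<rho>] \<circ> \<tau>)"
    if "\<sigma> \<in> Sym j" "\<rho> \<in> Sym k" "\<tau> \<in> Sym (j + k)" for \<sigma> \<rho> \<tau>
    unfolding t_def by (rule sorted_mask_balanced(2)[OF D \<kappa>h that])
  have ts: "t (sorter m) \<cdot> unit_section ?X = \<kappa> m" if "length m = j + k" "weight m = j" for m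
    unfolding t_def by (rule sorted_mask_balanced(3)[OF D \<kappa>h that])
  have univ: "\<exists>!w. w \<in> hom V T Z \<and> (\<forall>\<tau>\<in>Sym (j + k). w \<cdot> t \<tau> = z \<tau>)"
    if Z: "Z \<in> Ob V" and z: "\<And>\<tau>. \<tau> \<in> Sym (j + k) \<Longrightarrow> z \<tau> \<in> hom V (?X \<otimes> \<I>) Z"
      and zbal: "\<And>\<sigma> \<rho> \<tau>. \<sigma> \<in> Sym j \<Longrightarrow> \<rho> \<in> Sym k \<Longrightarrow> \<tau> \<in> Sym (j + k) \<Longrightarrow>
        z \<tau> \<cdot> tens_mor V (sact D j \<sigma>) (Ident V \<I>) = z (block_sum [j, k] [\<sigma>, \<rho>] \<circ> \<tau>)" for Z z
  proof -
    let ?I = "{m. length m = j + k \<and> weight m = j}"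
    have "z (sorter m) \<cdot> unit_section ?X \<in> hom V ?X Z" if "m \<in> ?I" for m
      using Comp_hom[OF u z[OF sorter_std_mask(1)]] that by simp
    then obtain w where w: "w \<in> hom V T Z" and wk: "\<And>m. m \<in> ?I \<Longrightarrow> w \<cdot> \<kappa> m = z (sorter m) \<cdot> unit_section ?X"
      using coproduct_exists[OF \<kappa> Z, of "\<lambda>m. z (sorter m) \<cdot> unit_section ?X"] by blast
    show ?thesis
    proof (rule ex1I[of _ w], intro conjI ballI)
      show "w \<in> hom V T Z" by (rule w)
      fix \<tau> assume \<tau>: "\<tau> \<in> Sym (j + k)"
      show "w \<cdot> t \<tau> = z \<tau>"
      proof (rule balanced_determined[OF D _ _ z zbal _ \<tau>])
        show "w \<cdot> t \<tau> \<in> hom V (?X \<otimes> \<I>) Z" if "\<tau> \<in> Sym (j + k)" for \<tau>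
          by (rule Comp_hom[OF th[OF that] w])
        show "(w \<cdot> t \<tau>) \<cdot> tens_mor V (sact D j \<sigma>) (Ident V \<I>) = w \<cdot> t (block_sum [j, k] [\<sigma>, \<rho>] \<circ> \<tau>)"
          if s: "\<sigma> \<in> Sym j" "\<rho> \<in> Sym k" "\<tau> \<in> Sym (j + k)" for \<sigma> \<rho> \<tau>
          unfolding bal[OF s, symmetric]
          by (rule Comp_assoc[OF tens_mor_hom[OF sact_hom[OF D s(1)] Ident_hom[OF UnitOb_Ob]] th[OF s(3)] w])
        show "(w \<cdot> t (sorter m)) \<cdot> unit_section ?X = z (sorter m) \<cdot> unit_section ?X"
          if m: "length m = j + k" "weight m = j" for m
          using Comp_assoc[OF u th[OF sorter_std_mask(1)[OF m]] w] ts[OF m] wk[of m] m by simp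
      qed
    next
      fix v assume v: "v \<in> hom V T Z \<and> (\<forall>\<tau>\<in>Sym (j + k). v \<cdot> t \<tau> = z \<tau>)"
      show "v = w"
      proof (rule coproduct_eqI[OF \<kappa>])
        show "v \<in> hom V T Z" "w \<in> hom V T Z" using v w by auto
        fix m assume mI: "m \<in> ?I"
        then have m: "length m = j + k" "weight m = j" by auto
        note s = sorter_std_mask(1)[OF m]
        have "v \<cdot> \<kappa> m = (v \<cdot> t (sorter m)) \<cdot> unit_section ?X"
          unfolding ts[OF m, symmetric] by (rule Comp_assoc[OF u th[OF s] conjunct1[OF v], symmetric])
        then show "v \<cdot> \<kappa> m = w \<cdot> \<kappa> m" using v s wk[OF mI] by simp
      qed
    qed
  qed
  have E: "fob (sseq (Comm V)) k = \<I>" by (simp add: Comm_def)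
  show ?thesis
    unfolding is_balanced_tensor_def day_act_Comm fst_conv snd_conv E
  proof (intro conjI ballI allI impI)
    fix Z z
    assume Z: "Z \<in> Ob V"
      and z: "(\<forall>h\<in>Sym (j + k). z h \<in> hom V (?X \<otimes> \<I>) Z) \<and>
        (\<forall>g\<in>Sym j \<times> Sym k. \<forall>h\<in>Sym (j + k). z h \<cdot> tens_mor V (sact D j (fst g)) (Ident V \<I>) =
          z ((case g of (\<sigma>, \<rho>) \<Rightarrow> \<lambda>\<tau>. block_sum [j, k] [\<sigma>, \<rho>] \<circ> \<tau>) h))"
    show "\<exists>!w. w \<in> hom V T Z \<and> (\<forall>\<tau>\<in>Sym (j + k). w \<cdot> t \<tau> = z \<tau>)"
    proof (rule univ[OF Z])
      show "z \<tau> \<in> hom V (?X \<otimes> \<I>) Z" if "\<tau> \<in> Sym (j + k)" for \<tau> using z that by blast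
      show "z \<tau> \<cdot> tens_mor V (sact D j \<sigma>) (Ident V \<I>) = z (block_sum [j, k] [\<sigma>, \<rho>] \<circ> \<tau>)"
        if "\<sigma> \<in> Sym j" "\<rho> \<in> Sym k" "\<tau> \<in> Sym (j + k)" for \<sigma> \<rho> \<tau>
        using bspec[OF bspec[OF conjunct2[OF z], of "(\<sigma>, \<rho>)"] that(3)] that by simp
    qed
  qed (use TO th bal in auto)
qed

theorem day_convolution_Comm_exists:
  assumes "cocomplete_category TYPE('u::infinite) V" and D: "symmetric_sequence V D"
  obtains F where "is_day_convolution V D (sseq (Comm V)) F"
proof (rule day_convolution_exists[OF D Comm_sequence])
  fix p :: "nat \<times> nat"
  obtain j k where p: "p = (j, k)" by (cases p)
  have "finite {m :: bool list. length m = j + k \<and> weight m = j}"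
    by (rule finite_subset[OF _ finite_lists_length_eq[of UNIV "j + k"]]) auto
  from finite_coproduct_exists[OF assms(1) this, of "\<lambda>_. fob D j"] obtain T \<kappa>
    where "is_coproduct V {m. length m = j + k \<and> weight m = j} (\<lambda>_. fob D j) T \<kappa>"
    using symmetric_sequence_Ob[OF D] by metis
  from day_tensor_Comm[OF D this] show "\<exists>T t. day_tensor D (sseq (Comm V)) p T t" unfolding p by blast
next
  fix n :: nat and T :: "nat \<times> nat \<Rightarrow> 'o" assume T: "\<And>p. T p \<in> Ob V"
  have "finite {(j, k). j + k = n}" by (rule finite_subset[of _ "{..n} \<times> {..n}"]) auto
  from finite_coproduct_exists[OF assms(1) this, of T] T
  show "\<exists>Q incl. is_coproduct V {(j, k). j + k = n} T Q incl" by metis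
qed (rule that)

text \<open>The index \<open>r i\<close> names the partial sum that contains the summand \<open>i\<close>.\<close>

lemma coproduct_of_coproducts:
  assumes Q: "is_coproduct V K T Q inc"
    and T: "\<And>p. p \<in> K \<Longrightarrow> is_coproduct V {i \<in> I. r i = p} X (T p) \<kappa>"
    and r: "\<And>i. i \<in> I \<Longrightarrow> r i \<in> K"
  shows "is_coproduct V I X Q (\<lambda>i. inc (r i) \<cdot> \<kappa> i)"
proof (rule is_coproductI)
  have \<kappa>: "\<kappa> i \<in> hom V (X i) (T (r i))" if "i \<in> I" for i using coproduct_hom[OF T[OF r[OF that]]] that by simp
  have inc: "inc (r i) \<in> hom V (T (r i)) Q" if "i \<in> I" for i using coproduct_hom[OF Q r[OF that]] .
  have assoc: "(u \<cdot> inc (r i)) \<cdot> \<kappa> i = u \<cdot> (inc (r i) \<cdot> \<kappa> i)" if "i \<in> I" "u \<in> hom V Q Z" for i u Z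
    by (rule Comp_assoc[OF \<kappa>[OF that(1)] inc[OF that(1)] that(2)])
  show "Q \<in> Ob V" using Q by (simp add: is_coproduct_def)
  show "inc (r i) \<cdot> \<kappa> i \<in> hom V (X i) Q" if "i \<in> I" for i by (rule Comp_hom[OF \<kappa>[OF that] inc[OF that]])
  fix Z
  {
    fix z assume Z: "Z \<in> Ob V" and z: "\<And>i. i \<in> I \<Longrightarrow> z i \<in> hom V (X i) Z"
    have "\<exists>w. w \<in> hom V (T p) Z \<and> (\<forall>i\<in>I. r i = p \<longrightarrow> w \<cdot> \<kappa> i = z i)" if p: "p \<in> K" for p
    proof -
      have "z i \<in> hom V (X i) Z" if "i \<in> {i \<in> I. r i = p}" for i using z that by simp
      then obtain w where "w \<in> hom V (T p) Z" "\<And>i. i \<in> {i \<in> I. r i = p} \<Longrightarrow> w \<cdot> \<kappa> i = z i"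
        using coproduct_exists[OF T[OF p] Z, of z] by blast
      then show ?thesis by blast
    qed
    then obtain w where w: "\<And>p. p \<in> K \<Longrightarrow> w p \<in> hom V (T p) Z"
      and wz: "\<And>p i. p \<in> K \<Longrightarrow> i \<in> I \<Longrightarrow> r i = p \<Longrightarrow> w p \<cdot> \<kappa> i = z i" by metis
    obtain v where v: "v \<in> hom V Q Z" "\<And>p. p \<in> K \<Longrightarrow> v \<cdot> inc p = w p"
      using coproduct_exists[OF Q Z, of w] w by metis
    show "\<exists>u\<in>hom V Q Z. \<forall>i\<in>I. u \<cdot> (inc (r i) \<cdot> \<kappa> i) = z i"
    proof (intro bexI[OF _ v(1)] ballI)
      show "v \<cdot> (inc (r i) \<cdot> \<kappa> i) = z i" if "i \<in> I" for i
        using assoc[OF that v(1)] v(2)[OF r[OF that]] wz[OF r[OF that] that refl] by simp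
    qed
  next
    fix u v assume u: "u \<in> hom V Q Z" and v: "v \<in> hom V Q Z"
      and uv: "\<And>i. i \<in> I \<Longrightarrow> u \<cdot> (inc (r i) \<cdot> \<kappa> i) = v \<cdot> (inc (r i) \<cdot> \<kappa> i)"
    show "u = v"
    proof (rule coproduct_eqI[OF Q u v])
      fix p assume p: "p \<in> K"
      show "u \<cdot> inc p = v \<cdot> inc p"
      proof (rule coproduct_eqI[OF T[OF p]])
        show "u \<cdot> inc p \<in> hom V (T p) Z" "v \<cdot> inc p \<in> hom V (T p) Z"
          using Comp_hom[OF coproduct_hom[OF Q p]] u v by blast+
        show "(u \<cdot> inc p) \<cdot> \<kappa> i = (v \<cdot> inc p) \<cdot> \<kappa> i" if "i \<in> {i \<in> I. r i = p}" for i
          using uv assoc[OF _ u] assoc[OF _ v] that by auto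
      qed
    qed
  }
qed

lemma day_tensor_Comm_facts:
  assumes D: "symmetric_sequence V D" and T: "day_tensor D (sseq (Comm V)) (j, k) T t"
  shows "\<And>\<tau>. \<tau> \<in> Sym (j + k) \<Longrightarrow> t \<tau> \<in> hom V (fob D j \<otimes> \<I>) T"
    and "\<And>\<sigma> \<rho> \<tau>. \<sigma> \<in> Sym j \<Longrightarrow> \<rho> \<in> Sym k \<Longrightarrow> \<tau> \<in> Sym (j + k) \<Longrightarrow>
      t \<tau> \<cdot> tens_mor V (sact D j \<sigma>) (Ident V \<I>) = t (block_sum [j, k] [\<sigma>, \<rho>] \<circ> \<tau>)"
proof -
  have E: "fob (sseq (Comm V)) k = \<I>" by (simp add: Comm_def)
  show "t \<tau> \<in> hom V (fob D j \<otimes> \<I>) T" if "\<tau> \<in> Sym (j + k)" for \<tau>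
    using T that by (simp add: is_balanced_tensor_def E)
  show "t \<tau> \<cdot> tens_mor V (sact D j \<sigma>) (Ident V \<I>) = t (block_sum [j, k] [\<sigma>, \<rho>] \<circ> \<tau>)"
    if "\<sigma> \<in> Sym j" "\<rho> \<in> Sym k" "\<tau> \<in> Sym (j + k)" for \<sigma> \<rho> \<tau>
    using T that by (auto simp: is_balanced_tensor_def day_act_Comm)
qed

text \<open>Conversely, the structure maps of any balanced tensor at the sorting permutations are the inclusions of
such a sum, since a balanced family can be prescribed freely there and is determined by these values.\<close>

lemma day_tensor_Comm_summands:
  assumes D: "symmetric_sequence V D" and T: "day_tensor D (sseq (Comm V)) (j, k) T t"
  shows "is_coproduct V {m. length m = j + k \<and> weight m = j} (\<lambda>_. fob D j) T
    (\<lambda>m. t (sorter m) \<cdot> unit_section (fob D j))"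
proof (rule is_coproductI)
  let ?X = "fob D j" and ?I = "{m. length m = j + k \<and> weight m = j}"
  have o: "?X \<in> Ob V" by (rule symmetric_sequence_Ob[OF D])
  have E: "fob (sseq (Comm V)) k = \<I>" by (simp add: Comm_def)
  note u = unit_section_hom[OF o] and th = day_tensor_Comm_facts(1)[OF D T] and tbal = day_tensor_Comm_facts(2)[OF D T]
  show "T \<in> Ob V" using T by (simp add: is_balanced_tensor_def)
  have s: "sorter m \<in> Sym (j + k)" if "m \<in> ?I" for m using sorter_std_mask(1)[of m j k] that by simp
  show "t (sorter m) \<cdot> unit_section ?X \<in> hom V ?X T" if "m \<in> ?I" for m
    by (rule Comp_hom[OF u th[OF s[OF that]]])
  have wt: "(w \<cdot> t \<tau>) \<cdot> tens_mor V (sact D j \<sigma>) (Ident V \<I>) = w \<cdot> t (block_sum [j, k] [\<sigma>, \<rho>] \<circ> \<tau>)"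
    if "w \<in> hom V T Z" and g: "\<sigma> \<in> Sym j" "\<rho> \<in> Sym k" "\<tau> \<in> Sym (j + k)" for w Z \<sigma> \<rho> \<tau>
    unfolding tbal[OF g, symmetric]
    by (rule Comp_assoc[OF tens_mor_hom[OF sact_hom[OF D g(1)] Ident_hom[OF UnitOb_Ob]] th[OF g(3)] that(1)])
  fix Z
  {
    fix z assume Z: "Z \<in> Ob V" and z: "\<And>m. m \<in> ?I \<Longrightarrow> z m \<in> hom V ?X Z"
    have zh: "z m \<in> hom V ?X Z" if "length m = j + k" "weight m = j" for m using z[of m] that by simp
    define y where "y \<tau> = (let m = sorted_mask j k \<tau> in z m \<cdot> sact D j (restrict_perm \<tau> m) \<cdot> Pr1 V ?X \<I>)" for \<tau>
    have yh: "y \<tau> \<in> hom V (?X \<otimes> \<I>) Z" if "\<tau> \<in> Sym (j + k)" for \<tau>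
      unfolding y_def by (rule sorted_mask_balanced(1)[OF D zh that])
    have ybal: "y \<tau> \<cdot> tens_mor V (sact D j \<sigma>) (Ident V \<I>) = y (block_sum [j, k] [\<sigma>, \<rho>] \<circ> \<tau>)"
      if "\<sigma> \<in> Sym j" "\<rho> \<in> Sym k" "\<tau> \<in> Sym (j + k)" for \<sigma> \<rho> \<tau>
      unfolding y_def by (rule sorted_mask_balanced(2)[OF D zh that])
    have ys: "y (sorter m) \<cdot> unit_section ?X = z m" if "length m = j + k" "weight m = j" for m
      unfolding y_def by (rule sorted_mask_balanced(3)[OF D zh that])
    obtain w where w: "w \<in> hom V T Z" "\<And>\<tau>. \<tau> \<in> Sym (j + k) \<Longrightarrow> w \<cdot> t \<tau> = y \<tau>"
    proof (rule balanced_tensor_exists[OF T Z, of y])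
      show "y \<tau> \<in> hom V (fob D (fst (j, k)) \<otimes> fob (sseq (Comm V)) (snd (j, k))) Z"
        if "\<tau> \<in> Sym (fst (j, k) + snd (j, k))" for \<tau> using yh that by (simp add: E)
      show "y \<tau> \<cdot> day_act D (sseq (Comm V)) (j, k) g =
          y ((case g of (\<sigma>, \<rho>) \<Rightarrow> \<lambda>\<tau>. block_sum [fst (j, k), snd (j, k)] [\<sigma>, \<rho>] \<circ> \<tau>) \<tau>)"
        if "g \<in> Sym (fst (j, k)) \<times> Sym (snd (j, k))" "\<tau> \<in> Sym (fst (j, k) + snd (j, k))" for g \<tau>
        using that by (cases g) (simp add: day_act_Comm ybal)
    qed auto
    have "w \<cdot> (t (sorter m) \<cdot> unit_section ?X) = z m" if m: "m \<in> ?I" for m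
      using Comp_assoc[OF u th[OF s[OF m]] w(1)] w(2)[OF s[OF m]] ys[of m] m by simp
    then show "\<exists>w\<in>hom V T Z. \<forall>m\<in>?I. w \<cdot> (t (sorter m) \<cdot> unit_section ?X) = z m" using w(1) by blast
  next
    fix v w assume v: "v \<in> hom V T Z" and w: "w \<in> hom V T Z"
      and vw: "\<And>m. m \<in> ?I \<Longrightarrow> v \<cdot> (t (sorter m) \<cdot> unit_section ?X) = w \<cdot> (t (sorter m) \<cdot> unit_section ?X)"
    show "v = w"
    proof (rule balanced_tensor_eqI[OF T day_act_hom[OF D Comm_sequence] _ v w])
      fix \<tau> assume "\<tau> \<in> Sym (fst (j, k) + snd (j, k))"
      then have \<tau>: "\<tau> \<in> Sym (j + k)" by simp
      show "v \<cdot> t \<tau> = w \<cdot> t \<tau>"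
      proof (rule balanced_determined[OF D Comp_hom[OF th v] wt[OF v] Comp_hom[OF th w] wt[OF w] _ \<tau>])
        fix m assume "length m = j + k" "weight m = j"
        then have m: "m \<in> ?I" by simp
        show "(v \<cdot> t (sorter m)) \<cdot> unit_section ?X = (w \<cdot> t (sorter m)) \<cdot> unit_section ?X"
          unfolding Comp_assoc[OF u th[OF s[OF m]] v] Comp_assoc[OF u th[OF s[OF m]] w] by (rule vw[OF m])
      qed
    qed (auto intro: comp_Sym block_sum2_Sym)
  }
qed

text \<open>For the action, the sorting permutation of the image of \<open>m\<close>, precomposed with \<open>\<sigma>\<close>, again moves \<open>m\<close> to the
front, and it induces on \<open>m\<close> the same permutation as \<open>\<sigma>\<close>.\<close>

theorem day_convolution_Comm_summands:
  assumes D: "symmetric_sequence V D" and F: "is_day_convolution V D (sseq (Comm V)) F"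
  obtains \<iota> where "\<And>n. is_coproduct V {m. length m = n} (\<lambda>m. fob D (weight m)) (fob F n) \<iota>"
    and "\<And>\<sigma> m. \<sigma> \<in> Sym (length m) \<Longrightarrow>
      sact F (length m) \<sigma> \<cdot> \<iota> (move_list \<sigma> m) = \<iota> m \<cdot> sact D (weight m) (restrict_perm \<sigma> m)"
proof -
  let ?E = "sseq (Comm V)"
  have Fs: "symmetric_sequence V F" using F by (simp add: is_day_convolution_iff)
  have "\<exists>T t incl. (\<forall>p \<in> {(j, k). j + k = n}. day_tensor D ?E p (T p) (t p)) \<and>
        is_coproduct V {(j, k). j + k = n} T (fob F n) incl \<and>
        (\<forall>p \<in> {(j, k). j + k = n}. \<forall>\<tau>\<in>Sym n. \<forall>\<sigma>\<in>Sym n.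
           sact F n \<sigma> \<cdot> (incl p \<cdot> t p \<tau>) = incl p \<cdot> t p (\<tau> \<circ> \<sigma>))" for n
    using F by (simp only: is_day_convolution_iff)
  then obtain T t incl where T0: "\<And>n p. p \<in> {(j, k). j + k = n} \<Longrightarrow> day_tensor D ?E p (T n p) (t n p)"
    and Q: "\<And>n. is_coproduct V {(j, k). j + k = n} (T n) (fob F n) (incl n)"
    and act0: "\<And>n p \<tau> \<sigma>. p \<in> {(j, k). j + k = n} \<Longrightarrow> \<tau> \<in> Sym n \<Longrightarrow> \<sigma> \<in> Sym n \<Longrightarrow>
      sact F n \<sigma> \<cdot> (incl n p \<cdot> t n p \<tau>) = incl n p \<cdot> t n p (\<tau> \<circ> \<sigma>)"
    by metis
  have T: "day_tensor D ?E (j, k) (T (j + k) (j, k)) (t (j + k) (j, k))" for j k by (rule T0) simp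
  have DO: "fob D j \<in> Ob V" for j by (rule symmetric_sequence_Ob[OF D])
  note u = unit_section_hom[OF DO]
  have th: "t (j + k) (j, k) \<tau> \<in> hom V (fob D j \<otimes> \<I>) (T (j + k) (j, k))" if "\<tau> \<in> Sym (j + k)" for j k \<tau>
    by (rule day_tensor_Comm_facts(1)[OF D T that])
  have ih: "incl (j + k) (j, k) \<in> hom V (T (j + k) (j, k)) (fob F (j + k))" for j k
    using coproduct_hom[OF Q, of "(j, k)" "j + k"] by simp
  have tbal: "t (j + k) (j, k) \<tau> \<cdot> tens_mor V (sact D j \<sigma>) (Ident V \<I>) = t (j + k) (j, k) (block_sum [j, k] [\<sigma>, \<rho>] \<circ> \<tau>)"
    if "\<sigma> \<in> Sym j" "\<rho> \<in> Sym k" "\<tau> \<in> Sym (j + k)" for j k \<sigma> \<rho> \<tau>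
    by (rule day_tensor_Comm_facts(2)[OF D T that])
  \<comment> \<open>\<open>\<iota>'\<close> is defined for all permutations, because the action leads out of the sorting ones.\<close>
  define \<iota>' where "\<iota>' j k \<tau> = incl (j + k) (j, k) \<cdot> t (j + k) (j, k) \<tau> \<cdot> unit_section (fob D j)" for j k \<tau>
  define \<iota> where "\<iota> m = \<iota>' (weight m) (weight (map Not m)) (sorter m)" for m
  have \<iota>'h: "\<iota>' j k \<tau> \<in> hom V (fob D j) (fob F (j + k))" if "\<tau> \<in> Sym (j + k)" for j k \<tau>
    unfolding \<iota>'_def by (rule Comp_hom[OF Comp_hom[OF u th[OF that]] ih])
  have \<iota>h: "\<iota> m \<in> hom V (fob D (weight m)) (fob F (length m))" for m
    using \<iota>'h[of "sorter m" "weight m" "weight (map Not m)"] sorter_Sym[of m] by (simp add: \<iota>_def weight_Not)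
  have star: "\<iota>' j k \<tau> = \<iota> m \<cdot> sact D j (restrict_perm \<tau> m)" "weight m = j" "weight (map Not m) = k"
    if \<tau>: "\<tau> \<in> Sym (length m)" and m: "move_list \<tau> m = std_mask j k" "length m = j + k" for j k \<tau> m
  proof -
    note f = factor_through_sorter[OF \<tau> m]
    have so: "sorter m \<in> Sym (j + k)" using sorter_Sym[of m] m by simp
    have ds: "t (j + k) (j, k) \<tau> \<cdot> unit_section (fob D j) =
        (t (j + k) (j, k) (sorter m) \<cdot> unit_section (fob D j)) \<cdot> sact D j (restrict_perm \<tau> m)"
      by (rule day_tensor_sorter(2)[OF D \<tau> m, where z = "t (j + k) (j, k)", OF th[OF so]]) (rule tbal)
    show w: "weight m = j" "weight (map Not m) = k" by (rule f)+
    show "\<iota>' j k \<tau> = \<iota> m \<cdot> sact D j (restrict_perm \<tau> m)"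
      unfolding \<iota>'_def \<iota>_def w ds
      using Comp_assoc[OF sact_hom[OF D f(2)] Comp_hom[OF u th[OF so]] ih] by simp
  qed
  have act: "sact F (j + k) \<sigma> \<cdot> \<iota>' j k \<tau> = \<iota>' j k (\<tau> \<circ> \<sigma>)" if "\<sigma> \<in> Sym (j + k)" "\<tau> \<in> Sym (j + k)" for j k \<sigma> \<tau>
  proof -
    note sh = sact_hom[OF Fs that(1)] and tt = th[OF that(2)] and c = th[OF comp_Sym[OF that(2,1)]]
    have "sact F (j + k) \<sigma> \<cdot> \<iota>' j k \<tau> = (sact F (j + k) \<sigma> \<cdot> incl (j + k) (j, k) \<cdot> t (j + k) (j, k) \<tau>) \<cdot> unit_section (fob D j)"
      unfolding \<iota>'_def using Comp_assoc[OF u tt ih] Comp_assoc[OF u Comp_hom[OF tt ih] sh] by simp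
    also have "\<dots> = (incl (j + k) (j, k) \<cdot> t (j + k) (j, k) (\<tau> \<circ> \<sigma>)) \<cdot> unit_section (fob D j)"
      using act0[of "(j, k)" "j + k" \<tau> \<sigma>] that by simp
    finally show ?thesis unfolding \<iota>'_def Comp_assoc[OF u c ih] .
  qed
  have "sact F (length m) \<sigma> \<cdot> \<iota> (move_list \<sigma> m) = \<iota> m \<cdot> sact D (weight m) (restrict_perm \<sigma> m)"
    if \<sigma>: "\<sigma> \<in> Sym (length m)" for \<sigma> m
  proof -
    let ?m = "move_list \<sigma> m"
    let ?j = "weight ?m" and ?k = "weight (map Not ?m)"
    have len: "length m = ?j + ?k" using weight_Not[of ?m] by simp
    have so: "sorter ?m \<in> Sym (length m)" using sorter_Sym[of ?m] by simp
    have c: "sorter ?m \<circ> \<sigma> \<in> Sym (length m)" by (rule comp_Sym[OF so \<sigma>])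
    have mv: "move_list (sorter ?m \<circ> \<sigma>) m = std_mask ?j ?k"
      using move_list_comp[OF so \<sigma>] move_list_sorter_self[of ?m] by simp
    have "restrict_perm (sorter ?m \<circ> \<sigma>) m = restrict_perm \<sigma> m"
      using restrict_perm_comp[OF so \<sigma>] restrict_perm_sorter[of ?m] by simp
    moreover have "sact F (length m) \<sigma> \<cdot> \<iota> ?m = \<iota>' ?j ?k (sorter ?m \<circ> \<sigma>)"
      using act[of \<sigma> ?j ?k "sorter ?m"] \<sigma> so len by (simp add: \<iota>_def)
    ultimately show ?thesis using star(1)[OF c mv len] weight_move_list[OF \<sigma>] by simp
  qed
  moreover have "is_coproduct V {m. length m = n} (\<lambda>m. fob D (weight m)) (fob F n) \<iota>" for n
  proof -
    let ?r = "\<lambda>m. (weight m, weight (map Not m))"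
    have "is_coproduct V {m \<in> {m. length m = n}. ?r m = p} (\<lambda>m. fob D (weight m)) (T n p)
        (\<lambda>m. t n (?r m) (sorter m) \<cdot> unit_section (fob D (weight m)))" if p: "p \<in> {(j, k). j + k = n}" for p
    proof -
      obtain j k where jk: "p = (j, k)" "n = j + k" using p by auto
      have I: "{m \<in> {m. length m = n}. ?r m = p} = {m. length m = j + k \<and> weight m = j}"
        using weight_Not jk by (auto, metis add_left_cancel)
      show ?thesis
        unfolding I unfolding jk
        by (rule coproduct_cong[OF day_tensor_Comm_summands[OF D T]]) (use weight_Not in \<open>auto, metis add_left_cancel\<close>)
    qed
    then have "is_coproduct V {m. length m = n} (\<lambda>m. fob D (weight m)) (fob F n)
        (\<lambda>m. incl n (?r m) \<cdot> t n (?r m) (sorter m) \<cdot> unit_section (fob D (weight m)))"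
      by (rule coproduct_of_coproducts[OF Q]) (use weight_Not in auto)
    then show ?thesis
      by (rule coproduct_cong) (use weight_Not in \<open>auto simp: \<iota>_def \<iota>'_def\<close>)
  qed
  ultimately show ?thesis using that by blast
qed

end

section \<open>The Day convolution of an operad with the commutativity operad\<close>

theorem proposition2p9:
  fixes V :: "('o, 'm) ccat" and C :: "('o, 'm) operad"
  assumes "cartesian_monoidal_category V"
    and "closed_category V"
    and "complete_category TYPE('u::infinite) V"
    and "cocomplete_category TYPE('u::infinite) V"
    and "symmetric_operad V C"
  shows "(\<exists>B. is_day_convolution V (sseq C) (sseq (Comm V)) B) \<and>
    (\<forall>B. is_day_convolution V (sseq C) (sseq (Comm V)) B \<longrightarrow>
      (\<exists>P. sseq P = B \<and> symmetric_operad V P \<and>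
        ((\<exists>\<eta>. based_operad V C \<eta>) \<longrightarrow> (\<exists>\<theta>. based_operad V P \<theta>))))"
proof (intro conjI allI impI)
  interpret symmetric_operad V C by (rule assms(5))
  show "\<exists>B. is_day_convolution V (sseq C) (sseq (Comm V)) B"
    using day_convolution_Comm_exists[OF assms(4) sseq] by blast
  fix B assume B: "is_day_convolution V (sseq C) (sseq (Comm V)) B"
  then have "symmetric_sequence V B" by (simp add: is_day_convolution_def)
  moreover obtain \<iota> where "\<And>n. is_coproduct V {m. length m = n} (\<lambda>m. arity C (weight m)) (fob B n) \<iota>"
    "\<And>\<sigma> m. \<sigma> \<in> Sym (length m) \<Longrightarrow>
      sact B (length m) \<sigma> \<cdot>\<^bsub>V\<^esub> \<iota> (move_list \<sigma> m) = \<iota> m \<cdot>\<^bsub>V\<^esub> sact (sseq C) (weight m) (restrict_perm \<sigma> m)"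
    using day_convolution_Comm_summands[OF sseq B] by blast
  ultimately interpret mask_sequence V C B \<iota>
    using assms(2) by unfold_locales
  show "\<exists>P. sseq P = B \<and> symmetric_operad V P \<and>
      ((\<exists>\<eta>. based_operad V C \<eta>) \<longrightarrow> (\<exists>\<theta>. based_operad V P \<theta>))"
  proof (intro exI[of _ mask_op] conjI impI)
    show "sseq mask_op = B" by (simp add: mask_op_simps)
    show P: "symmetric_operad V mask_op" by (rule mask_op_operad)
    assume "\<exists>\<eta>. based_operad V C \<eta>"
    then obtain \<eta> where "\<eta> \<in> hom V \<I>\<^bsub>V\<^esub> (arity C 0)" by (auto simp: based_operad_def)
    \<comment> \<open>The base point lies in the only summand of arity zero, that of the empty mask.\<close>
    then have "\<iota> [] \<cdot>\<^bsub>V\<^esub> \<eta> \<in> hom V \<I>\<^bsub>V\<^esub> (arity mask_op 0)"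
      using Comp_hom[of \<eta> "\<I>\<^bsub>V\<^esub>" "arity C 0" "\<iota> []"] incl_hom[of "[]"] by (simp add: mask_op_simps)
    then show "\<exists>\<theta>. based_operad V mask_op \<theta>" using P by (auto simp: based_operad_def)
  qed
qed

end
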